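(* Suppose that $f \in C^2(\mathbb{R}^d)$ (real-valued) has a unique global minimizer $x_\star$, that $C_{\mathsf{PL}}(f) < \infty$, and that there exists $L > 0$ such that $\Delta f(x) \le L\,(1+\|\nabla f(x)\|^2)$ for all $x\in\mathbb{R}^d$. For $t>0$ let $\mu_t = \frac{1}{Z_t}\,e^{-f/t}$, where $Z_t = \int_{\mathbb{R}^d} e^{-f/t}$. Then the limit $$C_{\mathsf{bP}}(f) := \lim_{t\to 0^+}\frac{C_{\mathsf{P}}(\mu_t)}{t}$$ exists, and $$C_{\mathsf{bP}}(f) = \frac{1}{\lambda_{\min}(\nabla^2 f(x_\star))}.$$
   Context: Probability measures with a Lebesgue density are identified with their densities. For a probability measure $\mu$ on $\mathbb{R}^d$, the Poincaré constant $C_{\mathsf{P}}(\mu)$ is the least constant $C$ such that for all smooth, compactly supported $h:\mathbb{R}^d\to\mathbb{R}$, $$\int h^2\,d\mu - \Bigl(\int h\,d\mu\Bigr)^2 \le C\int \|\nabla h\|^2\,d\mu .$$ For $f$ bounded below and differentiable, with $f_\star = \inf_{x\in\mathbb{R}^d} f(x)$, the Polyak--Łojasiewicz (PL) constant $C_{\mathsf{PL}}(f)$ is the least constant $C>0$ such that $f(x) - f_\star \le \frac{C}{2}\,\|\nabla f(x)\|^2$ for all $x\in\mathbb{R}^d$, or $+\infty$ if no such constant exists. $\lambda_{\min}$ denotes the smallest eigenvalue of a symmetric matrix. *)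

theory Defs
  imports "HOL-Analysis.Analysis"
begin

definition gradient :: "(real ^ 'n \<Rightarrow> real) \<Rightarrow> real ^ 'n \<Rightarrow> real ^ 'n"
  where "gradient f x = (\<chi> i. frechet_derivative f (at x) (axis i 1))"

definition hessian :: "(real ^ 'n \<Rightarrow> real) \<Rightarrow> real ^ 'n \<Rightarrow> real ^ 'n ^ 'n"
  where "hessian f x = jacobian (gradient f) (at x)"

definition laplacian :: "(real ^ 'n \<Rightarrow> real) \<Rightarrow> real ^ 'n \<Rightarrow> real"
  where "laplacian f x = trace (hessian f x)"

text \<open>\<open>C_k k f\<close>: the function \<open>f\<close> is \<open>k\<close> times continuously differentiable on the whole space.
  Differentiability at every step is implied by continuity of the partial derivatives, so this
  is the usual class of functions with continuous partial derivatives up to order \<open>k\<close>.\<close>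

primrec C_k :: "nat \<Rightarrow> (real ^ 'n \<Rightarrow> real) \<Rightarrow> bool"
  where
    "C_k 0 f \<longleftrightarrow> continuous_on UNIV f"
  | "C_k (Suc k) f \<longleftrightarrow> (\<forall>x. f differentiable (at x)) \<and> (\<forall>i. C_k k (\<lambda>x. gradient f x $ i))"

definition smooth :: "(real ^ 'n \<Rightarrow> real) \<Rightarrow> bool"
  where "smooth f \<longleftrightarrow> (\<forall>k. C_k k f)"

definition compactly_supported :: "(real ^ 'n \<Rightarrow> real) \<Rightarrow> bool"
  where "compactly_supported h \<longleftrightarrow> compact (closure {x. h x \<noteq> 0})"

text \<open>The infima are taken in the extended reals, so the value is \<open>\<infinity>\<close> if no constant is
  admissible. The admissible Poincare constants of a probability measure form a closed set of
  nonnegative reals, and likewise the admissible PL constants of a nonconstant \<open>f\<close> bounded below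
  form a set closed in the positive reals and bounded away from \<open>0\<close>: the infima are attained if finite.\<close>

definition poincare_const :: "(real ^ 'n) measure \<Rightarrow> ereal"
  where "poincare_const \<mu> = Inf {ereal C | C. \<forall>h. smooth h \<and> compactly_supported h \<longrightarrow>
    (\<integral>x. (h x)\<^sup>2 \<partial>\<mu>) - (\<integral>x. h x \<partial>\<mu>)\<^sup>2 \<le> C * (\<integral>x. (norm (gradient h x))\<^sup>2 \<partial>\<mu>)}"

definition PL_const :: "(real ^ 'n \<Rightarrow> real) \<Rightarrow> ereal"
  where "PL_const f = Inf {ereal C | C. C > 0 \<and>
    (\<forall>x. f x - (INF y. f y) \<le> C / 2 * (norm (gradient f x))\<^sup>2)}"

definition lambda_min :: "real ^ 'n ^ 'n \<Rightarrow> real"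
  where "lambda_min A = Min {c. \<exists>v. v \<noteq> 0 \<and> A *v v = c *\<^sub>R v}"

definition gibbs_Z :: "(real ^ 'n \<Rightarrow> real) \<Rightarrow> real \<Rightarrow> real"
  where "gibbs_Z f t = (\<integral>x. exp (- f x / t) \<partial>lborel)"

definition gibbs :: "(real ^ 'n \<Rightarrow> real) \<Rightarrow> real \<Rightarrow> (real ^ 'n) measure"
  where "gibbs f t = density lborel (\<lambda>x. ennreal (exp (- f x / t) / gibbs_Z f t))"

text \<open>\<open>Lim\<close> is unspecified if there is no limit, so existence has to be asserted separately.\<close>

definition C_bP :: "(real ^ 'n \<Rightarrow> real) \<Rightarrow> ereal"
  where "C_bP f = Lim (at_right 0) (\<lambda>t. poincare_const (gibbs f t) / ereal t)"

end

theory Submission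
  imports Defs "HOL-Probability.Distributions"
begin

text \<open>Rescale around the minimiser: with \<open>F\<^sub>t(y) = (f(x\<^sub>\<star> + sqrt t y) - f(x\<^sub>\<star>)) / t\<close> one has
  \<open>C\<^sub>P(\<mu>\<^sub>t) / t = C\<^sub>P(e\<^sup>-\<^sup>F)\<close>, and \<open>F\<^sub>t\<close> converges locally uniformly to the quadratic form
  \<open>Q(y) = \<langle>y, H y\<rangle> / 2\<close>, where \<open>H\<close> is the Hessian at \<open>x\<^sub>\<star>\<close> and \<open>\<lambda>\<close> its smallest eigenvalue. The PL inequality gives quadratic growth of \<open>f\<close>, hence a positive definite \<open>H\<close>
  and Gaussian tails uniformly in \<open>t\<close>; together with the bound on the Laplacian it also makes the Witten
  potential \<open>\<bar>\<nabla>F\<^sub>t\<bar>\<^sup>2/4 - \<Delta>F\<^sub>t/2\<close> grow quadratically, uniformly in small \<open>t\<close>.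
  Upper bound: an IMS partition of unity separates a ball of large radius, where the measure is a small
  perturbation of the Gaussian \<open>e\<^sup>-\<^sup>Q\<close> with Poincare constant \<open>1/\<lambda>\<close>, from its complement, where the
  Witten potential yields an arbitrarily small constant. Lower bound: smooth truncations of the linear
  function along an eigenvector for \<open>\<lambda>\<close> are almost extremal.\<close>

section \<open>Integration by parts and Gaussian integrability\<close>

text \<open>Rescaling leaves the Hessian and the quadratic growth of \<open>f\<close> unchanged but
  divides the squared gradient by t. In the bound on the Laplacian the gradient term therefore
  carries a factor t, and for small t it is absorbed by the quarter of the squared gradient in the
  Witten potential: this is where the hypothesis on the Laplacian enters. Near the origin only the
  values of \<open>F t\<close> and \<open>Q\<close> are compared: densities that differ by a factor
  of at most exp(d) have Poincare constants that differ by a factor of at most exp(2 d). The radius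
  and d depend on eps alone and are fixed before t is made small, which makes the estimate uniform
  in the test function. The centring constant m is an obstacle. The inner piece must have mean zero
  for the Gaussian, so h - m replaces h, and the outer piece then equals - m far away instead of
  vanishing. The Witten inequality is first proved for compact support and then extended to bounded
  functions. The upper bound is proved for all C^1 functions of compact support, so C^1 spline
  cutoffs suffice. The lower bound needs a genuine smooth bump, built from exp(-1/s).\<close>

lemma continuous_on_compact_support_bounded:
  fixes f :: "'a::euclidean_space \<Rightarrow> 'b::real_normed_vector"
  assumes "continuous_on UNIV f" and "\<And>x. norm x > r \<Longrightarrow> f x = 0"
  obtains B where "B \<ge> 0" "\<And>x. norm (f x) \<le> B"
proof -
  have "compact (f ` cball 0 r)"
    using assms(1) by (intro compact_continuous_image) (auto intro: continuous_on_subset)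
  then obtain B where B: "\<And>y. y \<in> f ` cball 0 r \<Longrightarrow> norm y \<le> B"
    by (meson bounded_iff compact_imp_bounded)
  have "norm (f x) \<le> max 0 B" for x
  proof (cases "norm x > r")
    case False
    then show ?thesis using B[of "f x"] by auto
  qed (simp add: assms(2))
  then show ?thesis using that[of "max 0 B"] by auto
qed

lemma integrable_compact_support:
  fixes f :: "'a::euclidean_space \<Rightarrow> 'b::{banach, second_countable_topology}"
  assumes "continuous_on UNIV f" and "\<And>x. norm x > r \<Longrightarrow> f x = 0"
  shows "integrable lborel f"
proof -
  have "integrable lborel (\<lambda>x. indicator (cball 0 r) x *\<^sub>R f x)"
    using assms(1) by (intro borel_integrable_compact) (auto intro: continuous_on_subset)
  moreover have "(\<lambda>x. indicator (cball 0 r) x *\<^sub>R f x) = f"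
    using assms(2) by (fastforce simp: indicator_def)
  ultimately show ?thesis by simp
qed

lemma has_derivative_zero_outside:
  fixes w :: "'a::euclidean_space \<Rightarrow> 'b::real_normed_vector"
  assumes "(w has_derivative w') (at x)" and "\<And>x. norm x > r \<Longrightarrow> w x = 0" and "norm x > r"
  shows "w' = (\<lambda>_. 0)"
proof -
  have "open {x::'a. norm x > r}"
    by (intro open_Collect_less continuous_intros)
  then have "((\<lambda>x. 0) has_derivative w') (at x)"
    using assms by (intro has_derivative_transform_within_open[OF assms(1)]) auto
  then show ?thesis
    using has_derivative_unique has_derivative_const by blast
qed

lemma lborel_integral_translation:
  fixes f :: "'a::euclidean_space \<Rightarrow> 'b::{banach, second_countable_topology}"
  assumes "f \<in> borel_measurable borel"
  shows "(\<integral>x. f (x + c) \<partial>lborel) = (\<integral>x. f x \<partial>lborel)"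
proof -
  have "(\<integral>x. f x \<partial>lborel) = (\<integral>x. f x \<partial>distr lborel borel ((+) c))"
    by (simp add: lborel_distr_plus)
  also have "\<dots> = (\<integral>x. f (c + x) \<partial>lborel)"
    using assms by (subst integral_distr) auto
  finally show ?thesis by (simp add: add.commute)
qed

text \<open>By translation invariance every difference quotient of \<open>w\<close> along
  \<open>v\<close> has integral 0, and these quotients converge boundedly to the derivative.
  Continuity is asked of the derivative in the single direction \<open>v\<close>, which later
  matches the continuity available for diagonal second derivatives.\<close>

lemma integral_directional_derivative_zero:
  fixes w :: "'a::euclidean_space \<Rightarrow> real"
  assumes D: "\<And>x. (w has_derivative w' x) (at x)"
    and cont: "continuous_on UNIV (\<lambda>x. w' x v)"
    and supp: "\<And>x. norm x > r \<Longrightarrow> w x = 0"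
  shows "(\<integral>x. w' x v \<partial>lborel) = 0"
proof -
  have supp': "w' x v = 0" if "norm x > r" for x
    using has_derivative_zero_outside[OF D supp that] by simp
  obtain B where B: "B \<ge> 0" "\<And>x. norm (w' x v) \<le> B"
    using continuous_on_compact_support_bounded[OF cont supp'] by blast
  have contw: "continuous_on UNIV w"
    using D has_derivative_continuous by (blast intro: continuous_at_imp_continuous_on)
  have mw: "w \<in> borel_measurable borel" "(\<lambda>x. w' x v) \<in> borel_measurable borel"
    using contw cont by (auto intro: borel_measurable_continuous_onI)
  have line: "((\<lambda>s. w (x + s *\<^sub>R v)) has_real_derivative w' (x + s *\<^sub>R v) v) (at s)" for x s
  proof -
    have "((\<lambda>s. w (x + s *\<^sub>R v)) has_derivative (\<lambda>h. w' (x + s *\<^sub>R v) (h *\<^sub>R v))) (at s)"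
      by (rule has_derivative_compose[OF _ D]) (auto intro!: derivative_eq_intros)
    moreover have "linear (w' (x + s *\<^sub>R v))"
      using D has_derivative_linear by blast
    ultimately show ?thesis
      by (simp add: has_field_derivative_def linear_cmul mult.commute[of _ "w' _ v"])
  qed
  define s where "s n = 1 / real (Suc n)" for n
  have s0: "s n > 0" "s n \<le> 1" for n by (auto simp: s_def)
  have slim: "s \<longlonglongrightarrow> 0"
    unfolding s_def by (rule LIMSEQ_Suc[OF lim_1_over_n])
  define d where "d n x = (w (x + s n *\<^sub>R v) - w x) / s n" for n x
  have int_w: "integrable lborel w"
    using integrable_compact_support[OF contw supp] .
  have int_w': "integrable lborel (\<lambda>x. w (x + s n *\<^sub>R v))" for n
  proof (rule integrable_compact_support)
    show "continuous_on UNIV (\<lambda>x. w (x + s n *\<^sub>R v))"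
      by (intro continuous_on_compose2[OF contw] continuous_intros) auto
    show "w (x + s n *\<^sub>R v) = 0" if "norm x > r + norm v" for x
    proof (rule supp)
      have "norm (s n *\<^sub>R v) \<le> norm v"
        using s0[of n] by (simp add: mult_left_le_one_le)
      then show "r < norm (x + s n *\<^sub>R v)"
        using that norm_diff_ineq[of x "s n *\<^sub>R v"] by linarith
    qed
  qed
  have zero: "(\<integral>x. d n x \<partial>lborel) = 0" for n
  proof -
    have "(\<integral>x. d n x \<partial>lborel) = ((\<integral>x. w (x + s n *\<^sub>R v) \<partial>lborel) - (\<integral>x. w x \<partial>lborel)) / s n"
      unfolding d_def using int_w int_w' by simp
    then show ?thesis using lborel_integral_translation[OF mw(1)] by simp
  qed
  have dlim: "(\<lambda>n. d n x) \<longlonglongrightarrow> w' x v" for x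
  proof -
    have "((\<lambda>h. (w (x + h *\<^sub>R v) - w x) / h) \<longlongrightarrow> w' x v) (at 0)"
      using line[of x 0] by (simp add: DERIV_def)
    moreover have "filterlim s (at 0) sequentially"
      using slim s0 by (auto simp: filterlim_at intro!: eventuallyI dest: order.strict_implies_not_eq)
        (metis less_irrefl)
    ultimately show ?thesis
      unfolding d_def by (rule filterlim_compose)
  qed
  \<comment> \<open>The step sizes are at most 1, so all quotients vanish outside the ball enlarged
    by \<open>norm v\<close>; inside it the mean value theorem bounds them by
    \<open>B\<close>.\<close>
  have dbound: "norm (d n x) \<le> indicator (cball 0 (r + norm v)) x * B" for n x
  proof (cases "x \<in> cball 0 (r + norm v)")
    case True
    obtain z where z: "0 < z" "z < s n"
      "w (x + s n *\<^sub>R v) - w (x + 0 *\<^sub>R v) = (s n - 0) * w' (x + z *\<^sub>R v) v"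
      using MVT2[OF s0(1)[of n], of "\<lambda>s. w (x + s *\<^sub>R v)" "\<lambda>s. w' (x + s *\<^sub>R v) v"] line by blast
    then have "d n x = w' (x + z *\<^sub>R v) v"
      using s0[of n] by (simp add: d_def)
    then show ?thesis using True B(2) by simp
  next
    case False
    then have nx: "norm x > r + norm v" by simp
    have "norm (s n *\<^sub>R v) \<le> norm v"
      using s0[of n] by (simp add: mult_left_le_one_le)
    then have "norm (x + s n *\<^sub>R v) > r"
      using nx norm_diff_ineq[of x "s n *\<^sub>R v"] by linarith
    moreover have "norm x > r" using nx norm_ge_zero[of v] by linarith
    ultimately show ?thesis using False by (simp add: d_def supp)
  qed
  have "(\<lambda>n. \<integral>x. d n x \<partial>lborel) \<longlonglongrightarrow> (\<integral>x. w' x v \<partial>lborel)"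
  proof (rule integral_dominated_convergence[where w="\<lambda>x. indicator (cball 0 (r + norm v)) x * B"])
    show "(\<lambda>x. w' x v) \<in> borel_measurable lborel" using mw by simp
    show "d n \<in> borel_measurable lborel" for n
      unfolding d_def using int_w int_w'[of n]
      by (intro borel_measurable_divide borel_measurable_diff) auto
    show "integrable lborel (\<lambda>x::'a. indicator (cball 0 (r + norm v)) x * B)"
      by (intro integrable_mult_left integrable_real_indicator)
         (simp_all add: emeasure_lborel_cball_finite[unfolded infinity_ennreal_def])
    show "AE x in lborel. (\<lambda>n. d n x) \<longlonglongrightarrow> w' x v" using dlim by simp
    show "AE x in lborel. norm (d n x) \<le> indicator (cball 0 (r + norm v)) x * B" for n
      using dbound by simp
  qed
  then show ?thesis by (simp add: zero LIMSEQ_const_iff)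
qed

text \<open>The function is a product over the coordinates, and each factor is a multiple of the
  centred normal density with variance 1/(2a).\<close>

lemma integrable_exp_neg_norm_sq:
  assumes "a > 0"
  shows "integrable lborel (\<lambda>x::'a::euclidean_space. exp (- a * (norm x)\<^sup>2))"
proof (rule integrableI_nonneg)
  let ?g = "\<lambda>u::real. exp (- a * u\<^sup>2)"
  have eq: "?g u = sqrt (pi / a) * normal_density 0 (1 / sqrt (2 * a)) u" for u
    using assms by (simp add: normal_density_def real_sqrt_divide real_sqrt_mult field_simps power_divide power2_eq_square)
  have "integrable lborel ?g"
    unfolding eq using assms by (intro integrable_mult_right integrable_normal_density) simp
  then have fin: "(\<integral>\<^sup>+u. ennreal (?g u) \<partial>lborel) < \<infinity>"
    by (simp add: integrable_iff_bounded)
  have eqp: "ennreal (exp (- a * (norm x)\<^sup>2)) = (\<Prod>b\<in>Basis. ennreal (?g (x \<bullet> b)))" for x :: 'a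
  proof -
    have "(norm x)\<^sup>2 = (\<Sum>b\<in>Basis. (x \<bullet> b)\<^sup>2)"
      unfolding power2_norm_eq_inner by (subst euclidean_inner) (simp add: power2_eq_square)
    then show ?thesis
      by (simp add: prod_ennreal exp_sum[symmetric] sum_distrib_left sum_negf)
  qed
  have "(\<integral>\<^sup>+x. ennreal (exp (- a * (norm x)\<^sup>2)) \<partial>(lborel::'a measure))
    = (\<integral>\<^sup>+x. (\<Prod>b\<in>Basis. ennreal (?g (x \<bullet> b))) \<partial>(lborel::'a measure))"
    by (rule nn_integral_cong) (rule eqp)
  also have "\<dots> = (\<Prod>b\<in>(Basis::'a set). \<integral>\<^sup>+u. ennreal (?g u) \<partial>lborel)"
    by (rule nn_integral_lborel_prod) auto
  also have "\<dots> < \<infinity>"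
    using fin by (simp add: power_less_top_ennreal)
  finally show "(\<integral>\<^sup>+x. ennreal (exp (- a * (norm x)\<^sup>2)) \<partial>(lborel::'a measure)) < \<infinity>" .
qed (auto)

text \<open>Half of the exponent pays for the quadratic factor: 1 + u is at most (1 + 2/a) exp(a u /
  2).\<close>

lemma integrable_gauss_bound:
  fixes g :: "'a::euclidean_space \<Rightarrow> real"
  assumes "a > 0" and "g \<in> borel_measurable borel"
    and bd: "\<And>x. \<bar>g x\<bar> \<le> M * (1 + (norm x)\<^sup>2) * exp (- a * (norm x)\<^sup>2)"
  shows "integrable lborel g"
proof (rule Bochner_Integration.integrable_bound)
  show "integrable lborel (\<lambda>x::'a. \<bar>M\<bar> * (1 + 2 / a) * exp (- (a/2) * (norm x)\<^sup>2))"
    using integrable_exp_neg_norm_sq[of "a/2"] assms(1) by (intro integrable_mult_right) auto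
  show "g \<in> borel_measurable lborel" using assms by simp
  have "norm (g x) \<le> norm (\<bar>M\<bar> * (1 + 2 / a) * exp (- (a/2) * (norm x)\<^sup>2))" for x
  proof -
    let ?u = "(norm x)\<^sup>2"
    have "1 + ?u \<le> (1 + 2/a) * (1 + a/2 * ?u)"
      using assms(1) by (simp add: field_simps)
    also have "\<dots> \<le> (1 + 2/a) * exp (a/2 * ?u)"
      using assms(1) exp_ge_add_one_self by (intro mult_left_mono) auto
    finally have 1: "1 + ?u \<le> (1 + 2/a) * exp (a/2 * ?u)" .
    have "\<bar>g x\<bar> \<le> M * ((1 + ?u) * exp (- a * ?u))" using bd[of x] by (simp add: mult.assoc)
    also have "\<dots> \<le> \<bar>M\<bar> * ((1 + ?u) * exp (- a * ?u))"
      by (intro mult_right_mono) auto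
    also have "\<dots> \<le> \<bar>M\<bar> * (((1 + 2/a) * exp (a/2 * ?u)) * exp (- a * ?u))"
      using 1 by (intro mult_left_mono mult_right_mono) auto
    also have "\<dots> = \<bar>M\<bar> * (1 + 2 / a) * exp (- (a/2) * ?u)"
      by (simp add: mult_exp_exp field_simps)
    finally show ?thesis using assms(1) by simp
  qed
  then show "AE x in lborel. norm (g x) \<le> norm (\<bar>M\<bar> * (1 + 2 / a) * exp (- (a/2) * (norm x)\<^sup>2))"
    by simp
qed

text \<open>The mean value theorem turns the bound on the derivative into a bound on the difference
  quotients, so dominated convergence applies. It serves to differentiate the Gaussian interpolation
  in its angle.\<close>

lemma has_field_derivative_parametric_integral:
  fixes f f' :: "real \<Rightarrow> 'b \<Rightarrow> real"
  assumes int: "\<And>s. integrable M (f s)"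
    and D: "\<And>s x. ((\<lambda>s. f s x) has_field_derivative f' s x) (at s)"
    and bd: "\<And>s x. \<bar>f' s x\<bar> \<le> B x" and intB: "integrable M B"
    and meas: "f' t \<in> borel_measurable M"
  shows "((\<lambda>s. \<integral>x. f s x \<partial>M) has_field_derivative (\<integral>x. f' t x \<partial>M)) (at t)"
  unfolding DERIV_def tendsto_at_iff_sequentially
proof (intro allI impI)
  fix X :: "nat \<Rightarrow> real"
  assume X: "\<forall>i. X i \<in> UNIV - {0}" and lim: "X \<longlonglongrightarrow> 0"
  define d where "d n x = (f (t + X n) x - f t x) / X n" for n x
  have "(\<lambda>n. \<integral>x. d n x \<partial>M) \<longlonglongrightarrow> (\<integral>x. f' t x \<partial>M)"
  proof (rule integral_dominated_convergence[where w=B])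
    show "d n \<in> borel_measurable M" for n
      unfolding d_def using int by (intro borel_measurable_divide borel_measurable_diff) auto
    have "(\<lambda>n. d n x) \<longlonglongrightarrow> f' t x" for x
      using D[of x t, unfolded DERIV_def tendsto_at_iff_sequentially] X lim
      by (auto simp: d_def o_def)
    then show "AE x in M. (\<lambda>n. d n x) \<longlonglongrightarrow> f' t x" by simp
    have "norm (d n x) \<le> B x" for n x
    proof -
      have "\<bar>f (t + X n) x - f t x\<bar> \<le> B x * \<bar>t + X n - t\<bar>"
        using field_differentiable_bound[of UNIV "\<lambda>s. f s x" "\<lambda>s. f' s x" "B x" "t + X n" t] D bd
        by auto
      then show ?thesis
        using X by (auto simp: d_def field_simps)
    qed
    then show "AE x in M. norm (d n x) \<le> B x" for n by simp
  qed (use meas intB in auto)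
  moreover have "(\<integral>x. d n x \<partial>M) = ((\<integral>x. f (t + X n) x \<partial>M) - (\<integral>x. f t x \<partial>M)) / X n" for n
    unfolding d_def using int by simp
  ultimately show "((\<lambda>h. ((\<integral>x. f (t + h) x \<partial>M) - (\<integral>x. f t x \<partial>M)) / h) \<circ> X) \<longlonglongrightarrow> (\<integral>x. f' t x \<partial>M)"
    by (simp add: o_def)
qed

section \<open>Rotations of a product space preserve Lebesgue measure\<close>

lemma lborel_distr_shear_fst:
  "distr lborel borel (\<lambda>z::'a::euclidean_space \<times> 'a. (fst z + k *\<^sub>R snd z, snd z)) = lborel"
proof (rule measure_eqI)
  let ?T = "\<lambda>z::'a \<times> 'a. (fst z + k *\<^sub>R snd z, snd z)"
  have mT[measurable]: "?T \<in> borel \<rightarrow>\<^sub>M borel"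
    by (intro borel_measurable_continuous_onI continuous_intros)
  fix A assume "A \<in> sets (distr lborel borel ?T)"
  then have A[measurable]: "A \<in> sets (borel :: ('a \<times> 'a) measure)" by simp
  have A'[measurable]: "A \<in> sets (borel \<Otimes>\<^sub>M borel)" using A unfolding borel_prod .
  have m1: "(\<lambda>z. indicator A (?T z) :: ennreal) \<in> borel_measurable (lborel \<Otimes>\<^sub>M lborel)"
    by (simp add: lborel_prod)
  have m2: "(\<lambda>z. indicator A z :: ennreal) \<in> borel_measurable (lborel \<Otimes>\<^sub>M lborel)"
    by (simp add: lborel_prod)
  have "emeasure (distr lborel borel ?T) A = (\<integral>\<^sup>+z. indicator A (?T z) \<partial>lborel)"
    by (simp add: nn_integral_distr flip: nn_integral_indicator)
  also have "\<dots> = (\<integral>\<^sup>+z. indicator A (?T z) \<partial>(lborel \<Otimes>\<^sub>M lborel))"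
    by (simp add: lborel_prod)
  also have "\<dots> = (\<integral>\<^sup>+y. (\<integral>\<^sup>+x. indicator A (x + k *\<^sub>R y, y) \<partial>lborel) \<partial>lborel)"
    by (subst lborel_pair.nn_integral_snd[symmetric, OF m1]) simp
  also have "\<dots> = (\<integral>\<^sup>+y. (\<integral>\<^sup>+x. indicator A (x, y) \<partial>lborel) \<partial>lborel)"
  proof (rule nn_integral_cong)
    fix y :: 'a
    have [measurable]: "(\<lambda>x. indicator A (x, y) :: ennreal) \<in> borel_measurable borel"
      by (rule measurable_compose[of "\<lambda>x. (x, y)" _ "borel \<Otimes>\<^sub>M borel"]) measurable
    have "(\<integral>\<^sup>+x. indicator A (x, y) \<partial>lborel) = (\<integral>\<^sup>+x. indicator A (x, y) \<partial>distr lborel borel ((+) (k *\<^sub>R y)))"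
      by (simp add: lborel_distr_plus)
    also have "\<dots> = (\<integral>\<^sup>+x. indicator A (k *\<^sub>R y + x, y) \<partial>lborel)"
      by (subst nn_integral_distr) auto
    finally show "(\<integral>\<^sup>+x. indicator A (x + k *\<^sub>R y, y) \<partial>lborel) = (\<integral>\<^sup>+x. (indicator A (x, y) :: ennreal) \<partial>lborel)"
      by (simp add: add.commute)
  qed
  also have "\<dots> = (\<integral>\<^sup>+z. indicator A z \<partial>(lborel \<Otimes>\<^sub>M lborel))"
    using lborel_pair.nn_integral_snd[OF m2] by simp
  also have "\<dots> = emeasure lborel A" by (simp add: lborel_prod)
  finally show "emeasure (distr lborel borel ?T) A = emeasure lborel A" .
qed simp

lemma lborel_distr_shear_snd:
  "distr lborel borel (\<lambda>z::'a::euclidean_space \<times> 'a. (fst z, snd z + k *\<^sub>R fst z)) = lborel"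
proof -
  let ?swap = "\<lambda>z::'a \<times> 'a. (snd z, fst z)"
  let ?T = "\<lambda>z::'a \<times> 'a. (fst z + k *\<^sub>R snd z, snd z)"
  have msw[measurable]: "?swap \<in> borel \<rightarrow>\<^sub>M borel" and mT[measurable]: "?T \<in> borel \<rightarrow>\<^sub>M borel"
    by (intro borel_measurable_continuous_onI continuous_intros)+
  have sw: "distr lborel borel ?swap = lborel"
  proof -
    have "(lborel :: ('a \<times> 'a) measure) = distr lborel lborel (\<lambda>(x, y). (y, x))"
      using lborel_pair.distr_pair_swap[where 'a='a and 'b='a] by (simp only: lborel_prod)
    also have "\<dots> = distr lborel borel ?swap"
      by (rule distr_cong) auto
    finally show ?thesis by simp
  qed
  have "(\<lambda>z::'a\<times>'a. (fst z, snd z + k *\<^sub>R fst z)) = ?swap \<circ> (?T \<circ> ?swap)" by (auto simp: fun_eq_iff)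
  then have "distr lborel borel (\<lambda>z::'a\<times>'a. (fst z, snd z + k *\<^sub>R fst z))
      = distr (distr (distr lborel borel ?swap) borel ?T) borel ?swap"
    by (simp add: distr_distr)
  then show ?thesis by (simp add: sw lborel_distr_shear_fst)
qed

text \<open>A rotation in the plane is a product of three shears, and shears preserve Lebesgue measure
  by Fubini and translation invariance.\<close>

lemma lborel_distr_rotation:
  fixes c s :: real
  assumes "c\<^sup>2 + s\<^sup>2 = 1" "c > 0"
  shows "distr lborel borel (\<lambda>z::'a::euclidean_space \<times> 'a.
    (c *\<^sub>R fst z + s *\<^sub>R snd z, c *\<^sub>R snd z - s *\<^sub>R fst z)) = lborel"
proof -
  \<comment> \<open>This is the tangent of half the rotation angle, the coefficient for which the
    shears \<open>?A\<close>, \<open>?B\<close>, \<open>?A\<close> compose to the rotation;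
    positivity of \<open>c\<close> keeps the denominator nonzero.\<close>
  define k where "k = s / (1 + c)"
  let ?A = "\<lambda>z::'a \<times> 'a. (fst z + k *\<^sub>R snd z, snd z)"
  let ?B = "\<lambda>z::'a \<times> 'a. (fst z, snd z + (- s) *\<^sub>R fst z)"
  have mA: "?A \<in> borel \<rightarrow>\<^sub>M borel" and mB: "?B \<in> borel \<rightarrow>\<^sub>M borel"
    by (intro borel_measurable_continuous_onI continuous_intros)+
  have sq: "s\<^sup>2 = (1 - c) * (1 + c)" using assms(1) by (simp add: algebra_simps power2_eq_square)
  have 1: "1 - k * s = c"
    using assms(2) sq by (simp add: k_def field_simps power2_eq_square)
  have 2: "k * (1 + c) = s" using assms(2) by (simp add: k_def)
  have "?A (?B (?A z)) = (c *\<^sub>R fst z + s *\<^sub>R snd z, c *\<^sub>R snd z - s *\<^sub>R fst z)" for z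
  proof -
    obtain x y where z: "z = (x, y)" by fastforce
    have "snd (?B (?A z)) = (1 - k * s) *\<^sub>R y - s *\<^sub>R x"
      by (simp add: z algebra_simps)
    then have b: "snd (?B (?A z)) = c *\<^sub>R y - s *\<^sub>R x" by (simp only: 1)
    have "fst (?A (?B (?A z))) = x + k *\<^sub>R y + k *\<^sub>R (c *\<^sub>R y - s *\<^sub>R x)"
      using b by (simp add: z)
    also have "\<dots> = (1 - k * s) *\<^sub>R x + (k * (1 + c)) *\<^sub>R y" by (simp add: algebra_simps)
    finally have "fst (?A (?B (?A z))) = c *\<^sub>R x + s *\<^sub>R y" by (simp only: 1 2)
    then show ?thesis using b by (simp add: z prod_eq_iff)
  qed
  then have "(\<lambda>z. (c *\<^sub>R fst z + s *\<^sub>R snd z, c *\<^sub>R snd z - s *\<^sub>R fst z)) = ?A \<circ> (?B \<circ> ?A)"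
    by (intro ext) (simp only: o_apply)
  moreover have "distr (distr lborel borel ?A) borel ?B = distr lborel borel (?B \<circ> ?A)"
    using mA mB by (intro distr_distr) (simp_all only: measurable_lborel1 measurable_lborel2)
  moreover have "distr (distr lborel borel (?B \<circ> ?A)) borel ?A = distr lborel borel (?A \<circ> (?B \<circ> ?A))"
    using mA measurable_comp[OF mA mB] by (intro distr_distr) (simp_all only: measurable_lborel1 measurable_lborel2)
  ultimately have "distr lborel borel (\<lambda>z::'a \<times> 'a. (c *\<^sub>R fst z + s *\<^sub>R snd z, c *\<^sub>R snd z - s *\<^sub>R fst z))
     = distr (distr (distr lborel borel ?A) borel ?B) borel ?A"
    by (simp only:)
  also have "\<dots> = lborel" unfolding lborel_distr_shear_fst lborel_distr_shear_snd ..
  finally show ?thesis .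
qed

lemma lborel_integral_rotation:
  fixes g :: "'a::euclidean_space \<times> 'a \<Rightarrow> real"
  assumes "c\<^sup>2 + s\<^sup>2 = 1" "c > 0" "g \<in> borel_measurable borel"
  shows "(\<integral>z. g (c *\<^sub>R fst z + s *\<^sub>R snd z, c *\<^sub>R snd z - s *\<^sub>R fst z) \<partial>lborel) = (\<integral>z. g z \<partial>lborel)"
proof -
  have "(\<lambda>z::'a \<times> 'a. (c *\<^sub>R fst z + s *\<^sub>R snd z, c *\<^sub>R snd z - s *\<^sub>R fst z)) \<in> borel \<rightarrow>\<^sub>M borel"
    by (intro borel_measurable_continuous_onI continuous_intros)
  then show ?thesis
    using assms(3) by (subst (2) lborel_distr_rotation[OF assms(1,2), symmetric], subst integral_distr) auto
qed

lemma lborel_integral_fst_snd: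
  fixes g :: "'a::euclidean_space \<times> 'b::euclidean_space \<Rightarrow> real"
  assumes "integrable lborel g"
  shows "(\<integral>z. g z \<partial>lborel) = (\<integral>x. (\<integral>y. g (x, y) \<partial>lborel) \<partial>lborel)"
  using lborel_pair.integral_fst'[of g] assms by (simp add: lborel_prod)

lemma lborel_integral_prod_mult:
  fixes f :: "'a::euclidean_space \<Rightarrow> real" and g :: "'b::euclidean_space \<Rightarrow> real"
  assumes "integrable lborel (\<lambda>z::'a \<times> 'b. f (fst z) * g (snd z))"
  shows "(\<integral>z. f (fst z) * g (snd z) \<partial>lborel) = (\<integral>x. f x \<partial>lborel) * (\<integral>y. g y \<partial>lborel)"
  using lborel_integral_fst_snd[OF assms] by simp

section \<open>The Gaussian Poincare inequality\<close>

text \<open>Here \<open>lam\<close> is any positive lower bound of the form. That it is attained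
  enters only in the lower bound for the Poincare constant, through an eigenvector.\<close>

locale pos_def_form =
  fixes H :: "'a::euclidean_space \<Rightarrow> 'a" and lam :: real
  assumes linear_H: "linear H"
    and sym_H: "\<And>x y. H x \<bullet> y = x \<bullet> H y"
    and pos_H: "\<And>x. lam * (norm x)\<^sup>2 \<le> x \<bullet> H x"
    and lam_pos: "lam > 0"
begin

definition Q :: "'a \<Rightarrow> real" where "Q x = x \<bullet> H x / 2"

lemma bounded_linear_H: "bounded_linear H"
  using linear_H by (simp add: linear_conv_bounded_linear)

lemma continuous_on_H [continuous_intros]:
  "continuous_on S g \<Longrightarrow> continuous_on S (\<lambda>x. H (g x))"
  using bounded_linear_H by (rule bounded_linear.continuous_on)

lemma continuous_on_Q [continuous_intros]:
  "continuous_on S g \<Longrightarrow> continuous_on S (\<lambda>x. Q (g x))"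
  unfolding Q_def by (intro continuous_intros) auto

lemma has_derivative_Q: "(Q has_derivative (\<lambda>v. H x \<bullet> v)) (at x)"
proof -
  have "(H has_derivative H) (at x)"
    using bounded_linear_H by (rule bounded_linear_imp_has_derivative)
  then have "((\<lambda>x. x \<bullet> H x / 2) has_derivative (\<lambda>v. (x \<bullet> H v + v \<bullet> H x) / 2)) (at x)"
    by (auto intro!: derivative_eq_intros)
  moreover have "(\<lambda>v. (x \<bullet> H v + v \<bullet> H x) / 2) = (\<lambda>v. H x \<bullet> v)"
  proof
    fix v show "(x \<bullet> H v + v \<bullet> H x) / 2 = H x \<bullet> v"
      using sym_H[of x v] inner_commute[of v "H x"] by simp
  qed
  ultimately show ?thesis by (simp add: Q_def[abs_def])
qed

lemma Q_ge: "lam / 2 * (norm x)\<^sup>2 \<le> Q x"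
  using pos_H[of x] by (simp add: Q_def)

lemma norm_H_ge: "lam * norm x \<le> norm (H x)"
proof (cases "x = 0")
  case False
  have "lam * (norm x)\<^sup>2 \<le> norm x * norm (H x)"
    using pos_H[of x] norm_cauchy_schwarz[of x "H x"] by linarith
  then have "norm x * (lam * norm x) \<le> norm x * norm (H x)"
    by (simp add: power2_eq_square mult_ac)
  then show ?thesis using False by simp
qed (use linear_H in \<open>simp add: linear_0\<close>)

text \<open>The covariance operator of the Gaussian with density proportional to
  \<open>exp (- Q x)\<close>.\<close>

definition G :: "'a \<Rightarrow> 'a" where "G = inv H"

lemma inj_H: "inj H"
  using norm_H_ge lam_pos linear_H
  by (auto simp: linear_injective_0) (metis mult_le_0_iff norm_le_zero_iff norm_zero not_le)

lemma H_G: "H (G a) = a"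
proof -
  have "surj H"
    using linear_H inj_H linear_injective_imp_surjective by blast
  then show ?thesis by (simp add: G_def surj_f_inv_f)
qed

lemma norm_G_le: "norm (G a) \<le> norm a / lam"
  using norm_H_ge[of "G a"] lam_pos by (simp add: H_G field_simps)

text \<open>Stein's identity. Along the direction \<open>G a\<close> the derivative of
  \<open>Q\<close> is \<open>H x \<bullet> G a\<close>, which equals \<open>a \<bullet> x\<close>,
  so the integral of the derivative of \<open>u x * exp (- Q x)\<close> in that direction splits
  into the two sides.\<close>

lemma gaussian_ibp:
  fixes u :: "'a \<Rightarrow> real"
  assumes D: "\<And>x. (u has_derivative (\<lambda>v. Du x \<bullet> v)) (at x)"
    and cont: "continuous_on UNIV Du"
    and supp: "\<And>x. norm x > r \<Longrightarrow> u x = 0"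
  shows "(\<integral>x. u x * (a \<bullet> x) * exp (- Q x) \<partial>lborel) = (\<integral>x. (Du x \<bullet> G a) * exp (- Q x) \<partial>lborel)"
proof -
  have contu: "continuous_on UNIV u"
    using D has_derivative_continuous by (blast intro: continuous_at_imp_continuous_on)
  have Du0: "Du x \<bullet> v = 0" if "norm x > r" for x v
    using has_derivative_zero_outside[OF D supp that] by (metis)
  let ?w' = "\<lambda>x v. (Du x \<bullet> v) * exp (- Q x) - u x * (H x \<bullet> v) * exp (- Q x)"
  have "(\<integral>x. ?w' x (G a) \<partial>lborel) = 0"
  proof (rule integral_directional_derivative_zero)
    show "((\<lambda>x. u x * exp (- Q x)) has_derivative ?w' x) (at x)" for x
      by (rule derivative_eq_intros D has_derivative_Q refl)+ (auto simp: algebra_simps)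
    show "continuous_on UNIV (\<lambda>x. ?w' x (G a))"
      by (intro continuous_intros cont contu)
    show "u x * exp (- Q x) = 0" if "norm x > r" for x
      using supp[OF that] by simp
  qed
  moreover have "H x \<bullet> G a = a \<bullet> x" for x
    using sym_H[of x "G a"] by (simp add: H_G inner_commute)
  moreover have "integrable lborel (\<lambda>x. (Du x \<bullet> G a) * exp (- Q x))"
    by (rule integrable_compact_support[where r=r]) (auto intro!: continuous_intros cont simp: Du0)
  moreover have "integrable lborel (\<lambda>x. u x * (a \<bullet> x) * exp (- Q x))"
    by (rule integrable_compact_support[where r=r]) (auto intro!: continuous_intros contu simp: supp)
  ultimately show ?thesis by simp
qed

lemma integrable_exp_neg_Q: "integrable lborel (\<lambda>x. exp (- Q x))"
proof (rule integrable_gauss_bound[of "lam / 2" _ 1])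
  show "\<bar>exp (- Q x)\<bar> \<le> 1 * (1 + (norm x)\<^sup>2) * exp (- (lam / 2) * (norm x)\<^sup>2)" for x
  proof -
    have "exp (- Q x) \<le> 1 * exp (- (lam / 2) * (norm x)\<^sup>2)" using Q_ge[of x] by simp
    also have "\<dots> \<le> (1 + (norm x)\<^sup>2) * exp (- (lam / 2) * (norm x)\<^sup>2)"
      by (intro mult_right_mono) auto
    finally show ?thesis by simp
  qed
qed (use lam_pos in \<open>auto intro!: borel_measurable_continuous_onI continuous_intros\<close>)

abbreviation W :: "'a \<times> 'a \<Rightarrow> real" where "W z \<equiv> exp (- Q (fst z)) * exp (- Q (snd z))"

lemma integrable_W:
  fixes g :: "'a \<times> 'a \<Rightarrow> real"
  assumes cont: "continuous_on UNIV g" and bd: "\<And>z. \<bar>g z\<bar> \<le> M * (1 + (norm z)\<^sup>2)"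
  shows "integrable lborel (\<lambda>z. g z * W z)"
proof (rule integrable_gauss_bound[of "lam / 2" _ M])
  show "\<bar>g z * W z\<bar> \<le> M * (1 + (norm z)\<^sup>2) * exp (- (lam / 2) * (norm z)\<^sup>2)" for z
  proof -
    have "(norm z)\<^sup>2 = (norm (fst z))\<^sup>2 + (norm (snd z))\<^sup>2"
      by (cases z) (simp add: norm_Pair)
    then have "- Q (fst z) + - Q (snd z) \<le> - (lam / 2) * (norm z)\<^sup>2"
      using Q_ge[of "fst z"] Q_ge[of "snd z"] by (simp add: algebra_simps)
    then have "W z \<le> exp (- (lam / 2) * (norm z)\<^sup>2)"
      by (simp only: mult_exp_exp exp_le_cancel_iff)
    then have "\<bar>g z\<bar> * W z \<le> (M * (1 + (norm z)\<^sup>2)) * exp (- (lam / 2) * (norm z)\<^sup>2)"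
      using bd[of z] by (intro mult_mono) (auto intro: order_trans)
    then show ?thesis by (simp add: abs_mult)
  qed
qed (use lam_pos in \<open>auto intro!: borel_measurable_continuous_onI continuous_intros cont\<close>)

text \<open>Both copies carry the same quadratic form, and the cross terms cancel because
  \<open>H\<close> is symmetric.\<close>

lemma W_rotation:
  assumes "c\<^sup>2 + s\<^sup>2 = 1"
  shows "W (c *\<^sub>R x + s *\<^sub>R y, c *\<^sub>R y - s *\<^sub>R x) = W (x, y)"
proof -
  have "Q (c *\<^sub>R x + s *\<^sub>R y) + Q (c *\<^sub>R y - s *\<^sub>R x)
    = (c\<^sup>2 + s\<^sup>2) * Q x + (c\<^sup>2 + s\<^sup>2) * Q y"
    unfolding Q_def using linear_H
    by (simp add: linear_add linear_diff linear_cmul inner_simps sym_H algebra_simps power2_eq_square add_divide_distrib diff_divide_distrib)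
  then have "- Q (c *\<^sub>R x + s *\<^sub>R y) + - Q (c *\<^sub>R y - s *\<^sub>R x) = - Q x + - Q y"
    by (simp add: assms)
  then show ?thesis by (simp only: mult_exp_exp fst_conv snd_conv)
qed

text \<open>Interpolate between \<open>X\<close> and an independent copy \<open>Y\<close> by \<open>X\<^sub>\<theta> = cos \<theta> X + sin \<theta> Y\<close>. After
  rotating the pair and integrating by parts, the \<open>\<theta>\<close>-derivative of \<open>E[\<phi>(X) \<phi>(X\<^sub>\<theta>)]\<close> is
  \<open>- sin \<theta> E[\<langle>H\<^sup>-\<^sup>1 \<nabla>\<phi>(X), \<nabla>\<phi>(X\<^sub>\<theta>)\<rangle>]\<close>; since \<open>sin\<close> has integral \<open>1\<close> over the quarter period, the
  resulting constant \<open>1/\<lambda>\<close> is sharp.\<close>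

lemma gaussian_poincare:
  fixes phi :: "'a \<Rightarrow> real"
  assumes D: "\<And>x. (phi has_derivative (\<lambda>v. Dphi x \<bullet> v)) (at x)"
    and cont: "continuous_on UNIV Dphi"
    and supp: "\<And>x. norm x > r \<Longrightarrow> phi x = 0"
  defines "Z \<equiv> \<integral>x. exp (- Q x) \<partial>lborel"
  shows "Z * (\<integral>x. (phi x)\<^sup>2 * exp (- Q x) \<partial>lborel)
    \<le> (\<integral>x. phi x * exp (- Q x) \<partial>lborel)\<^sup>2 + Z / lam * (\<integral>x. (norm (Dphi x))\<^sup>2 * exp (- Q x) \<partial>lborel)"
proof -
  have contp: "continuous_on UNIV phi"
    using D has_derivative_continuous by (blast intro: continuous_at_imp_continuous_on)
  have D0: "Dphi x = 0" if "norm x > r" for x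
    using has_derivative_zero_outside[OF D supp that] by (metis inner_eq_zero_iff)
  obtain B1 where B1: "B1 \<ge> 0" "\<And>x. norm (phi x) \<le> B1"
    using continuous_on_compact_support_bounded[OF contp supp] by blast
  obtain B2 where B2: "B2 \<ge> 0" "\<And>x. norm (Dphi x) \<le> B2"
    using continuous_on_compact_support_bounded[OF cont D0] by blast
  have cp [continuous_intros]: "continuous_on S (\<lambda>x. phi (g x))" if "continuous_on S g" for S :: "('a \<times> 'a) set" and g
    using continuous_on_compose2[OF contp that] by auto
  have cD [continuous_intros]: "continuous_on S (\<lambda>x. Dphi (g x))" if "continuous_on S g" for S :: "('a \<times> 'a) set" and g
    using continuous_on_compose2[OF cont that] by auto
  define f where "f t z = phi (fst z) * phi (cos t *\<^sub>R fst z + sin t *\<^sub>R snd z) * W z" for t and z :: "'a \<times> 'a"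
  define f' where "f' t z = phi (fst z) * (Dphi (cos t *\<^sub>R fst z + sin t *\<^sub>R snd z) \<bullet>
     (cos t *\<^sub>R snd z - sin t *\<^sub>R fst z)) * W z" for t and z :: "'a \<times> 'a"
  define E where "E = (\<integral>x. (norm (Dphi x))\<^sup>2 * exp (- Q x) \<partial>lborel)"
  have bd1: "K \<le> K * (1 + (norm z)\<^sup>2)" if "K \<ge> 0" for K and z :: "'a \<times> 'a"
    using that by (simp add: distrib_left)
  have intf: "integrable lborel (f t)" for t
    unfolding f_def
  proof (rule integrable_W[where M="B1 * B1"])
    show "\<bar>phi (fst z) * phi (cos t *\<^sub>R fst z + sin t *\<^sub>R snd z)\<bar> \<le> B1 * B1 * (1 + (norm z)\<^sup>2)" for z
      using mult_mono[OF B1(2) B1(2) B1(1) norm_ge_zero, of "fst z" "cos t *\<^sub>R fst z + sin t *\<^sub>R snd z"]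
        bd1[of "B1 * B1" z] B1(1) by (simp add: abs_mult)
  qed (intro continuous_intros)
  \<comment> \<open>A crude bound free of the angle: it makes one dominating function serve all
    \<open>t\<close> in the differentiation under the integral.\<close>
  have normz: "norm (c *\<^sub>R snd z - s *\<^sub>R fst z) \<le> 1 + (norm z)\<^sup>2" if "\<bar>c\<bar> \<le> 1" "\<bar>s\<bar> \<le> 1" for c s and z :: "'a \<times> 'a"
  proof -
    obtain x y where z: "z = (x, y)" by fastforce
    have "norm (c *\<^sub>R y - s *\<^sub>R x) \<le> \<bar>c\<bar> * norm y + \<bar>s\<bar> * norm x"
      using norm_triangle_ineq4[of "c *\<^sub>R y" "s *\<^sub>R x"] by simp
    also have "\<dots> \<le> norm y + norm x"
      using that by (intro add_mono mult_left_le_one_le) auto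
    also have "\<dots> \<le> 1 + ((norm x)\<^sup>2 + (norm y)\<^sup>2)"
      using zero_le_power2[of "norm x - 1"] zero_le_power2[of "norm y - 1"]
      by (simp add: power2_diff) (smt (verit) zero_le_power2)
    finally show ?thesis by (simp add: z norm_Pair)
  qed
  have bd': "\<bar>phi u * (Dphi v \<bullet> w)\<bar> \<le> B1 * B2 * norm w" for u v w
  proof -
    have "\<bar>Dphi v \<bullet> w\<bar> \<le> B2 * norm w"
      using Cauchy_Schwarz_ineq2[of "Dphi v" w] mult_right_mono[OF B2(2)[of v] norm_ge_zero[of w]] by linarith
    then have "\<bar>phi u\<bar> * \<bar>Dphi v \<bullet> w\<bar> \<le> B1 * (B2 * norm w)"
      using B1(2)[of u] B1(1) by (intro mult_mono) auto
    then show ?thesis by (simp add: abs_mult mult.assoc)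
  qed
  have deriv: "((\<lambda>t. \<integral>z. f t z \<partial>lborel) has_field_derivative (\<integral>z. f' t z \<partial>lborel)) (at t)" for t
  proof (rule has_field_derivative_parametric_integral[where B="\<lambda>z. B1 * B2 * (1 + (norm z)\<^sup>2) * W z"])
    show "((\<lambda>t. f t z) has_real_derivative f' t z) (at t)" for t z
    proof -
      have "((\<lambda>t. phi (cos t *\<^sub>R fst z + sin t *\<^sub>R snd z)) has_derivative
        (\<lambda>h. Dphi (cos t *\<^sub>R fst z + sin t *\<^sub>R snd z) \<bullet> (h *\<^sub>R (cos t *\<^sub>R snd z - sin t *\<^sub>R fst z)))) (at t)"
        by (rule has_derivative_compose[OF _ D])
           (auto intro!: derivative_eq_intros simp: algebra_simps)
      then have "((\<lambda>t. phi (cos t *\<^sub>R fst z + sin t *\<^sub>R snd z)) has_real_derivative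
        Dphi (cos t *\<^sub>R fst z + sin t *\<^sub>R snd z) \<bullet> (cos t *\<^sub>R snd z - sin t *\<^sub>R fst z)) (at t)"
        by (simp add: has_field_derivative_def mult.commute[of _ "_ \<bullet> _"])
      then show ?thesis unfolding f_def f'_def
        by (auto intro!: derivative_eq_intros)
    qed
    show "\<bar>f' t z\<bar> \<le> B1 * B2 * (1 + (norm z)\<^sup>2) * W z" for t z
    proof -
      have "\<bar>phi (fst z) * (Dphi (cos t *\<^sub>R fst z + sin t *\<^sub>R snd z) \<bullet> (cos t *\<^sub>R snd z - sin t *\<^sub>R fst z))\<bar>
        \<le> B1 * B2 * norm (cos t *\<^sub>R snd z - sin t *\<^sub>R fst z)"
        by (rule bd')
      also have "\<dots> \<le> B1 * B2 * (1 + (norm z)\<^sup>2)"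
        using B1(1) B2(1) by (intro mult_left_mono normz) auto
      finally show ?thesis unfolding f'_def abs_mult[of _ "W z"]
        by (intro mult_mono) auto
    qed
    show "integrable lborel (\<lambda>z. B1 * B2 * (1 + (norm z)\<^sup>2) * W z)"
      using B1(1) B2(1) by (intro integrable_W[where M="B1 * B2"] continuous_intros) (auto simp: abs_mult)
    show "f' t \<in> borel_measurable lborel"
      unfolding f'_def by (simp, intro borel_measurable_continuous_onI continuous_intros) 
  qed (rule intf)
  have lower: "(\<integral>z. f' t z \<partial>lborel) \<ge> - (Z / lam * E) * sin t" if t: "0 < t" "t < pi/2" for t
  proof -
    define c s where "c = cos t" and "s = sin t"
    have cs: "c > 0" "s > 0" "c\<^sup>2 + s\<^sup>2 = 1" "\<bar>c\<bar> \<le> 1" "\<bar>s\<bar> \<le> 1"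
      using t by (auto simp: c_def s_def cos_gt_zero sin_gt_zero)
    \<comment> \<open>In the rotated variables U = c X + s Y and V = c Y - s X one has X = c U - s
      V, and V is the derivative of U in the angle. Hence \<open>k\<close> is \<open>f' t\<close>
      written in (U, V); the factor V is linear and ready for integration by parts with U
      fixed.\<close>
    define k where "k z = phi (c *\<^sub>R fst z - s *\<^sub>R snd z) * (Dphi (fst z) \<bullet> snd z) * W z" for z :: "'a \<times> 'a"
    define k' where "k' z = (Dphi (c *\<^sub>R fst z - s *\<^sub>R snd z) \<bullet> G (Dphi (fst z))) * W z" for z :: "'a \<times> 'a"
    have intk: "integrable lborel k" unfolding k_def
    proof (rule integrable_W[where M="B1 * B2"])
      show "\<bar>phi (c *\<^sub>R fst z - s *\<^sub>R snd z) * (Dphi (fst z) \<bullet> snd z)\<bar> \<le> B1 * B2 * (1 + (norm z)\<^sup>2)" for z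
        using bd'[of "c *\<^sub>R fst z - s *\<^sub>R snd z" "fst z" "snd z"] normz[of 1 0 z]
          mult_left_mono[of "norm (snd z)" "1 + (norm z)\<^sup>2" "B1 * B2"] B1(1) B2(1) by simp
    qed (intro continuous_intros)
    have linG: "linear G"
    proof (rule linearI)
      show "G (a + b) = G a + G b" for a b
        using injD[OF inj_H, of "G (a + b)" "G a + G b"] linear_H by (simp add: H_G linear_add)
      show "G (q *\<^sub>R a) = q *\<^sub>R G a" for q a
        using injD[OF inj_H, of "G (q *\<^sub>R a)" "q *\<^sub>R G a"] linear_H by (simp add: H_G linear_cmul)
    qed
    then have contG [continuous_intros]: "continuous_on S (\<lambda>x. G (g x))" if "continuous_on S g" for S :: "('a \<times> 'a) set" and g
      using that by (simp add: bounded_linear.continuous_on linear_conv_bounded_linear)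
    \<comment> \<open>\<open>G\<close> has norm at most \<open>1 / lam\<close>, and the
      arithmetic-geometric mean inequality decouples the two points. Nothing is lost in the
      constant, since both squared gradients turn out to have the same integral by rotation
      invariance.\<close>
    have ineqk': "\<bar>Dphi u \<bullet> G (Dphi v)\<bar> \<le> ((norm (Dphi u))\<^sup>2 + (norm (Dphi v))\<^sup>2) / (2 * lam)" for u v
    proof -
      have "\<bar>Dphi u \<bullet> G (Dphi v)\<bar> \<le> norm (Dphi u) * (norm (Dphi v) / lam)"
        using Cauchy_Schwarz_ineq2[of "Dphi u" "G (Dphi v)"]
          mult_left_mono[OF norm_G_le[of "Dphi v"] norm_ge_zero[of "Dphi u"]] by linarith
      also have "\<dots> \<le> ((norm (Dphi u))\<^sup>2 + (norm (Dphi v))\<^sup>2) / (2 * lam)"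
        using sum_squares_bound[of "norm (Dphi u)" "norm (Dphi v)"] lam_pos by (simp add: field_simps)
      finally show ?thesis .
    qed
    have sqB: "(norm (Dphi u))\<^sup>2 \<le> B2\<^sup>2" for u
      using B2(2) by (intro power_mono) auto
    have int1: "integrable lborel (\<lambda>z. (norm (Dphi (c *\<^sub>R fst z - s *\<^sub>R snd z)))\<^sup>2 * W z)"
    proof (rule integrable_W[where M="B2\<^sup>2"])
      show "\<bar>(norm (Dphi (c *\<^sub>R fst z - s *\<^sub>R snd z)))\<^sup>2\<bar> \<le> B2\<^sup>2 * (1 + (norm z)\<^sup>2)" for z
        using sqB[of "c *\<^sub>R fst z - s *\<^sub>R snd z"] bd1[of "B2\<^sup>2" z] by simp
    qed (intro continuous_intros)
    have int2: "integrable lborel (\<lambda>z. (norm (Dphi (fst z)))\<^sup>2 * W z)"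
    proof (rule integrable_W[where M="B2\<^sup>2"])
      show "\<bar>(norm (Dphi (fst z)))\<^sup>2\<bar> \<le> B2\<^sup>2 * (1 + (norm z)\<^sup>2)" for z :: "'a \<times> 'a"
        using sqB[of "fst z"] bd1[of "B2\<^sup>2" z] by simp
    qed (intro continuous_intros)
    have intk': "integrable lborel k'"
      unfolding k'_def
    proof (rule integrable_W[where M="(B2\<^sup>2 + B2\<^sup>2) / (2 * lam)"])
      show "\<bar>Dphi (c *\<^sub>R fst z - s *\<^sub>R snd z) \<bullet> G (Dphi (fst z))\<bar> \<le> (B2\<^sup>2 + B2\<^sup>2) / (2 * lam) * (1 + (norm z)\<^sup>2)" for z
      proof -
        have "((norm (Dphi (c *\<^sub>R fst z - s *\<^sub>R snd z)))\<^sup>2 + (norm (Dphi (fst z)))\<^sup>2) / (2 * lam) \<le> (B2\<^sup>2 + B2\<^sup>2) / (2 * lam)"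
          using lam_pos sqB by (intro divide_right_mono add_mono) auto
        then show ?thesis
          using ineqk'[of "c *\<^sub>R fst z - s *\<^sub>R snd z" "fst z"] bd1[of "(B2\<^sup>2 + B2\<^sup>2) / (2 * lam)" z] lam_pos by simp
      qed
    qed (intro continuous_intros)
    have "f' t z = k (c *\<^sub>R fst z + s *\<^sub>R snd z, c *\<^sub>R snd z - s *\<^sub>R fst z)" for z
    proof -
      have "c *\<^sub>R (c *\<^sub>R fst z + s *\<^sub>R snd z) - s *\<^sub>R (c *\<^sub>R snd z - s *\<^sub>R fst z) = (c\<^sup>2 + s\<^sup>2) *\<^sub>R fst z"
        by (simp add: algebra_simps power2_eq_square)
      then show ?thesis
        unfolding k_def f'_def using W_rotation[OF cs(3), of "fst z" "snd z"] cs(3)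
        by (simp flip: c_def s_def)
    qed
    then have "(\<integral>z. f' t z \<partial>lborel) = (\<integral>z. k (c *\<^sub>R fst z + s *\<^sub>R snd z, c *\<^sub>R snd z - s *\<^sub>R fst z) \<partial>lborel)"
      by simp
    also have "\<dots> = (\<integral>z. k z \<partial>lborel)"
      using intk by (intro lborel_integral_rotation cs) auto
    also have "\<dots> = (\<integral>x. (\<integral>y. k (x, y) \<partial>lborel) \<partial>lborel)"
      by (rule lborel_integral_fst_snd[OF intk])
    also have "\<dots> = (\<integral>x. (\<integral>y. - s * k' (x, y) \<partial>lborel) \<partial>lborel)"
    proof (rule Bochner_Integration.integral_cong[OF refl])
      fix x :: 'a
      have "(\<integral>y. phi (c *\<^sub>R x - s *\<^sub>R y) * (Dphi x \<bullet> y) * exp (- Q y) \<partial>lborel)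
        = (\<integral>y. ((- s) *\<^sub>R Dphi (c *\<^sub>R x - s *\<^sub>R y) \<bullet> G (Dphi x)) * exp (- Q y) \<partial>lborel)"
      proof (rule gaussian_ibp[where r="(\<bar>r\<bar> + norm (c *\<^sub>R x)) / s"])
        show "((\<lambda>y. phi (c *\<^sub>R x - s *\<^sub>R y)) has_derivative (\<lambda>v. ((- s) *\<^sub>R Dphi (c *\<^sub>R x - s *\<^sub>R y)) \<bullet> v)) (at y)" for y
        proof -
          have "((\<lambda>y. c *\<^sub>R x - s *\<^sub>R y) has_derivative (\<lambda>v. (- s) *\<^sub>R v)) (at y)"
            by (auto intro!: derivative_eq_intros)
          from has_derivative_compose[OF this D] show ?thesis by simp
        qed
        show "continuous_on UNIV (\<lambda>y. (- s) *\<^sub>R Dphi (c *\<^sub>R x - s *\<^sub>R y))"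
          by (intro continuous_intros continuous_on_compose2[OF cont]) auto
        show "phi (c *\<^sub>R x - s *\<^sub>R y) = 0" if "(\<bar>r\<bar> + norm (c *\<^sub>R x)) / s < norm y" for y
        proof (rule supp)
          have "\<bar>r\<bar> + norm (c *\<^sub>R x) < norm (s *\<^sub>R y)"
            using that cs by (simp add: field_simps)
          then show "r < norm (c *\<^sub>R x - s *\<^sub>R y)"
            using norm_triangle_ineq2[of "s *\<^sub>R y" "c *\<^sub>R x"] by (simp add: norm_minus_commute)
        qed
      qed
      then have "exp (- Q x) * (\<integral>y. phi (c *\<^sub>R x - s *\<^sub>R y) * (Dphi x \<bullet> y) * exp (- Q y) \<partial>lborel)
        = exp (- Q x) * (\<integral>y. ((- s) *\<^sub>R Dphi (c *\<^sub>R x - s *\<^sub>R y) \<bullet> G (Dphi x)) * exp (- Q y) \<partial>lborel)"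
        by simp
      then show "(\<integral>y. k (x, y) \<partial>lborel) = (\<integral>y. - s * k' (x, y) \<partial>lborel)"
        unfolding integral_mult_right_zero[symmetric] k_def k'_def by (simp add: mult_ac)
    qed
    also have "\<dots> = - s * (\<integral>z. k' z \<partial>lborel)"
      by (simp add: lborel_integral_fst_snd[OF intk'])
    also have "\<dots> \<ge> - s * (Z * E / lam)"
    proof -
      have "(\<integral>z. k' z \<partial>lborel) \<le> (\<integral>z. (1 / (2 * lam)) * ((norm (Dphi (c *\<^sub>R fst z - s *\<^sub>R snd z)))\<^sup>2 * W z
          + (norm (Dphi (fst z)))\<^sup>2 * W z) \<partial>lborel)"
      proof (rule integral_mono[OF intk'])
        show "integrable lborel (\<lambda>z. (1 / (2 * lam)) * ((norm (Dphi (c *\<^sub>R fst z - s *\<^sub>R snd z)))\<^sup>2 * W z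
          + (norm (Dphi (fst z)))\<^sup>2 * W z))"
          using Bochner_Integration.integrable_add[OF int1 int2] by (rule integrable_mult_right)
        show "k' z \<le> (1 / (2 * lam)) * ((norm (Dphi (c *\<^sub>R fst z - s *\<^sub>R snd z)))\<^sup>2 * W z
          + (norm (Dphi (fst z)))\<^sup>2 * W z)" for z
        proof -
          have "Dphi (c *\<^sub>R fst z - s *\<^sub>R snd z) \<bullet> G (Dphi (fst z))
            \<le> ((norm (Dphi (c *\<^sub>R fst z - s *\<^sub>R snd z)))\<^sup>2 + (norm (Dphi (fst z)))\<^sup>2) / (2 * lam)"
            using ineqk'[of "c *\<^sub>R fst z - s *\<^sub>R snd z" "fst z"] by linarith
          from mult_right_mono[OF this, of "W z"] show ?thesis
            unfolding k'_def by (simp add: algebra_simps add_divide_distrib)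
        qed
      qed
      also have "\<dots> = (1 / (2 * lam)) * ((\<integral>z. (norm (Dphi (c *\<^sub>R fst z - s *\<^sub>R snd z)))\<^sup>2 * W z \<partial>lborel)
          + (\<integral>z. (norm (Dphi (fst z)))\<^sup>2 * W z \<partial>lborel))"
        using int1 int2 by (simp only: integral_mult_right_zero Bochner_Integration.integral_add)
      also have "(\<integral>z. (norm (Dphi (c *\<^sub>R fst z - s *\<^sub>R snd z)))\<^sup>2 * W z \<partial>lborel)
         = (\<integral>z. (norm (Dphi (fst z)))\<^sup>2 * W z \<partial>lborel)"
      proof -
        \<comment> \<open>The inverse rotation, with \<open>- s\<close> in place of
          \<open>s\<close>, takes the first component to
          \<open>c *\<^sub>R fst z - s *\<^sub>R snd z\<close>.\<close>
        have eq: "(norm (Dphi (c *\<^sub>R fst z - s *\<^sub>R snd z)))\<^sup>2 * W z =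
          (\<lambda>z. (norm (Dphi (fst z)))\<^sup>2 * W z) (c *\<^sub>R fst z + (- s) *\<^sub>R snd z, c *\<^sub>R snd z - (- s) *\<^sub>R fst z)" for z
          using W_rotation[of c "- s" "fst z" "snd z"] cs(3) by simp
        show ?thesis
          by (subst eq, rule lborel_integral_rotation) (use cs int2 in auto)
      qed
      also have "(\<integral>z. (norm (Dphi (fst z)))\<^sup>2 * W z \<partial>lborel) = E * Z"
        using lborel_integral_prod_mult[of "\<lambda>x. (norm (Dphi x))\<^sup>2 * exp (- Q x)" "\<lambda>y. exp (- Q y)"] int2
        by (simp add: E_def Z_def mult.assoc)
      finally have "(\<integral>z. k' z \<partial>lborel) \<le> Z * E / lam" by (simp add: field_simps)
      then show ?thesis using mult_left_mono_neg[of _ "Z * E / lam" "- s"] cs by simp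
    qed
    finally show ?thesis by (simp add: s_def mult_ac)
  qed
  \<comment> \<open>Subtracting the multiple of \<open>cos t\<close> makes the interpolation
    nondecreasing by \<open>lower\<close>. As \<open>lower\<close> is proved only strictly between 0
    and pi/2, monotonicity is taken in its version for the open interval, with continuity at the
    ends.\<close>
  have "(\<integral>z. f 0 z \<partial>lborel) - Z / lam * E * cos 0 \<le> (\<integral>z. f (pi/2) z \<partial>lborel) - Z / lam * E * cos (pi/2)"
  proof (rule DERIV_nonneg_imp_increasing_open[where f="\<lambda>t. (\<integral>z. f t z \<partial>lborel) - Z / lam * E * cos t"])
    have d: "((\<lambda>t. (\<integral>z. f t z \<partial>lborel) - Z / lam * E * cos t) has_real_derivative
        ((\<integral>z. f' t z \<partial>lborel) + Z / lam * E * sin t)) (at t)" for t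
      by (rule derivative_eq_intros deriv refl)+ simp
    show "\<exists>y. ((\<lambda>t. (\<integral>z. f t z \<partial>lborel) - Z / lam * E * cos t) has_real_derivative y) (at t) \<and> 0 \<le> y"
      if "0 < t" "t < pi/2" for t
      using d[of t] lower[OF that] by (intro exI[of _ "(\<integral>z. f' t z \<partial>lborel) + Z / lam * E * sin t"]) auto
    show "continuous_on {0..pi/2} (\<lambda>t. (\<integral>z. f t z \<partial>lborel) - Z / lam * E * cos t)"
      using d by (intro continuous_at_imp_continuous_on) (blast intro: DERIV_isCont)
  qed simp
  moreover have "(\<integral>z. f 0 z \<partial>lborel) = Z * (\<integral>x. (phi x)\<^sup>2 * exp (- Q x) \<partial>lborel)"
  proof -
    have *: "f 0 = (\<lambda>z. ((phi (fst z))\<^sup>2 * exp (- Q (fst z))) * exp (- Q (snd z)))"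
      by (auto simp: f_def power2_eq_square)
    show ?thesis
      using lborel_integral_prod_mult[of "\<lambda>x. (phi x)\<^sup>2 * exp (- Q x)" "\<lambda>y. exp (- Q y)"] intf[of 0]
      by (simp add: * Z_def mult.commute)
  qed
  moreover have "(\<integral>z. f (pi/2) z \<partial>lborel) = (\<integral>x. phi x * exp (- Q x) \<partial>lborel)\<^sup>2"
  proof -
    have *: "f (pi/2) = (\<lambda>z. (phi (fst z) * exp (- Q (fst z))) * (phi (snd z) * exp (- Q (snd z))))"
      by (auto simp: f_def mult_ac)
    show ?thesis
      using lborel_integral_prod_mult[of "\<lambda>x. phi x * exp (- Q x)" "\<lambda>x. phi x * exp (- Q x)"] intf[of "pi/2"]
      by (simp add: * power2_eq_square)
  qed
  ultimately show ?thesis by (simp add: E_def)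
qed

end

section \<open>The Witten Laplacian and localisation\<close>

lemma integrable_bounded_mult:
  fixes g w :: "'a::euclidean_space \<Rightarrow> real"
  assumes w: "integrable lborel w" "\<And>x. 0 \<le> w x"
    and g: "continuous_on UNIV g" and bd: "\<And>x. \<bar>g x\<bar> \<le> M"
  shows "integrable lborel (\<lambda>x. g x * w x)"
proof (rule Bochner_Integration.integrable_bound[of _ "\<lambda>x. M * w x"])
  show "integrable lborel (\<lambda>x. M * w x)" using w(1) by simp
  show "(\<lambda>x. g x * w x) \<in> borel_measurable lborel"
    using borel_measurable_continuous_onI[OF g] borel_measurable_integrable[OF w(1)] by simp
  have "norm (g x * w x) \<le> norm (M * w x)" for x
  proof -
    have "\<bar>g x\<bar> * w x \<le> M * w x" using bd w(2) by (intro mult_right_mono)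
    moreover have "norm (g x * w x) = \<bar>g x\<bar> * w x" using w(2)[of x] by (simp add: abs_mult)
    ultimately show ?thesis using abs_ge_self[of "M * w x"] unfolding real_norm_def by linarith
  qed
  then show "AE x in lborel. norm (g x * w x) \<le> norm (M * w x)" by simp
qed

lemma integral_pos_continuous:
  fixes f :: "'a::euclidean_space \<Rightarrow> real"
  assumes cont: "continuous_on UNIV f" and int: "integrable lborel f"
    and nn: "\<And>x. 0 \<le> f x" and pos: "f c > 0"
  shows "0 < (\<integral>x. f x \<partial>lborel)"
proof (rule ccontr)
  assume "\<not> ?thesis"
  then have "(\<integral>x. f x \<partial>lborel) = 0"
    using nn Bochner_Integration.integral_nonneg[of lborel f] by (simp add: not_less order_antisym)
  then have "AE x in lborel. f x = 0"
    using integral_nonneg_eq_0_iff_AE[OF int] nn by simp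
  moreover have op: "open {x. f x \<noteq> 0}"
    by (intro open_Collect_neq cont continuous_on_const)
  ultimately have "{x. f x \<noteq> 0} \<in> null_sets lborel"
    by (subst AE_iff_null_sets) auto
  then have "negligible {x. f x \<noteq> 0}"
    by (simp add: negligible_iff_null_sets null_sets_completionI)
  note op this
  then show False using pos open_not_negligible[of "{x. f x \<noteq> 0}"] by force
qed

text \<open>The Witten Laplacian form of the energy: completing the square in \<open>Dh\<close> leaves half the
  divergence of \<open>h\<^sup>2 \<nabla>F e\<^sup>-\<^sup>F\<close>.\<close>

lemma witten_inequality:
  fixes F h :: "'a::euclidean_space \<Rightarrow> real"
  assumes F: "\<And>x. (F has_derivative (\<lambda>v. DF x \<bullet> v)) (at x)"
    and DF: "\<And>x. (DF has_derivative D2F x) (at x)"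
    and D2F: "\<And>b. b \<in> Basis \<Longrightarrow> continuous_on UNIV (\<lambda>x. D2F x b \<bullet> b)"
    and h: "\<And>x. (h has_derivative (\<lambda>v. Dh x \<bullet> v)) (at x)"
    and Dh: "continuous_on UNIV Dh" and supp: "\<And>x. norm x > r \<Longrightarrow> h x = 0"
  shows "(\<integral>x. ((norm (DF x))\<^sup>2 / 4 - (\<Sum>b\<in>Basis. D2F x b \<bullet> b) / 2) * (h x)\<^sup>2 * exp (- F x) \<partial>lborel)
    \<le> (\<integral>x. (norm (Dh x))\<^sup>2 * exp (- F x) \<partial>lborel)"
proof -
  have cont: "continuous_on UNIV F" "continuous_on UNIV DF" "continuous_on UNIV h"
    using F DF h has_derivative_continuous by (blast intro: continuous_at_imp_continuous_on)+
  have Dh0: "Dh x = 0" if "norm x > r" for x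
    using has_derivative_zero_outside[OF h supp that] by (metis inner_eq_zero_iff)
  \<comment> \<open>The derivative of the \<open>b\<close>-th component of the field
    \<open>h\<close>^2 \<open>DF\<close> exp(- \<open>F\<close>). Its divergence is the sum of
    \<open>w' b x b\<close>, so the second derivatives enter through the diagonal entries whose
    continuity is assumed.\<close>
  define w' where "w' b x v = (2 * h x * (Dh x \<bullet> v) * (DF x \<bullet> b) + (h x)\<^sup>2 * (D2F x v \<bullet> b)
     - (h x)\<^sup>2 * (DF x \<bullet> b) * (DF x \<bullet> v)) * exp (- F x)" for b x v
  have cont_w': "continuous_on UNIV (\<lambda>x. w' b x b)" if "b \<in> Basis" for b
    unfolding w'_def by (intro continuous_intros cont Dh D2F that)
  have supp_w': "w' b x v = 0" if "norm x > r" for b x v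
    using supp[OF that] by (simp add: w'_def)
  have zero: "(\<integral>x. w' b x b \<partial>lborel) = 0" if "b \<in> Basis" for b
  proof (rule integral_directional_derivative_zero[where w'="w' b" and v=b and w="\<lambda>x. (h x)\<^sup>2 * (DF x \<bullet> b) * exp (- F x)"])
    show "((\<lambda>x. (h x)\<^sup>2 * (DF x \<bullet> b) * exp (- F x)) has_derivative w' b x) (at x)" for x
      unfolding w'_def
      by (rule derivative_eq_intros F h DF refl)+ (auto simp: algebra_simps power2_eq_square)
    show "(h x)\<^sup>2 * (DF x \<bullet> b) * exp (- F x) = 0" if "norm x > r" for x
      using supp[OF that] by simp
  qed (rule cont_w'[OF that])
  have intw: "integrable lborel (\<lambda>x. w' b x b)" if "b \<in> Basis" for b
    using integrable_compact_support[OF cont_w'[OF that]] supp_w' by blast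
  have "(\<integral>x. ((norm (DF x))\<^sup>2 / 4 - (\<Sum>b\<in>Basis. D2F x b \<bullet> b) / 2) * (h x)\<^sup>2 * exp (- F x) \<partial>lborel)
    = (\<integral>x. ((norm (DF x))\<^sup>2 / 4 - (\<Sum>b\<in>Basis. D2F x b \<bullet> b) / 2) * (h x)\<^sup>2 * exp (- F x) \<partial>lborel)
      + (\<Sum>b\<in>Basis. (\<integral>x. w' b x b \<partial>lborel)) / 2"
    using zero by simp
  also have "\<dots> = (\<integral>x. ((norm (DF x))\<^sup>2 / 4 - (\<Sum>b\<in>Basis. D2F x b \<bullet> b) / 2) * (h x)\<^sup>2 * exp (- F x)
      + (\<Sum>b\<in>Basis. w' b x b) / 2 \<partial>lborel)"
  proof -
    have "integrable lborel (\<lambda>x. ((norm (DF x))\<^sup>2 / 4 - (\<Sum>b\<in>Basis. D2F x b \<bullet> b) / 2) * (h x)\<^sup>2 * exp (- F x))"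
      by (rule integrable_compact_support[where r=r]) (auto intro!: continuous_intros cont D2F simp: supp)
    then show ?thesis using intw by simp
  qed
  also have "\<dots> \<le> (\<integral>x. (norm (Dh x))\<^sup>2 * exp (- F x) \<partial>lborel)"
  proof (rule integral_mono)
    show "integrable lborel (\<lambda>x. (norm (Dh x))\<^sup>2 * exp (- F x))"
      by (rule integrable_compact_support[where r=r]) (auto intro!: continuous_intros cont Dh simp: Dh0)
    show "integrable lborel (\<lambda>x. ((norm (DF x))\<^sup>2 / 4 - (\<Sum>b\<in>Basis. D2F x b \<bullet> b) / 2) * (h x)\<^sup>2 * exp (- F x)
      + (\<Sum>b\<in>Basis. w' b x b) / 2)"
      by (rule integrable_compact_support[where r=r])
         (auto intro!: continuous_intros cont D2F cont_w' simp: supp supp_w')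
    fix x
    have 1: "(\<Sum>b\<in>Basis. w' b x b) = (2 * h x * (Dh x \<bullet> DF x) + (h x)\<^sup>2 * (\<Sum>b\<in>Basis. D2F x b \<bullet> b)
        - (h x)\<^sup>2 * (norm (DF x))\<^sup>2) * exp (- F x)"
      unfolding w'_def power2_norm_eq_inner euclidean_inner[of "Dh x" "DF x"] euclidean_inner[of "DF x" "DF x"]
      by (simp add: sum_distrib_left sum_distrib_right sum.distrib sum_subtractf algebra_simps)
    have "0 \<le> (norm (Dh x - (h x / 2) *\<^sub>R DF x))\<^sup>2 * exp (- F x)" by simp
    also have "(norm (Dh x - (h x / 2) *\<^sub>R DF x))\<^sup>2
      = (norm (Dh x))\<^sup>2 - h x * (Dh x \<bullet> DF x) + (h x)\<^sup>2 * (norm (DF x))\<^sup>2 / 4"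
      unfolding power2_norm_eq_inner by (simp add: inner_simps inner_commute power2_eq_square)
    finally show "((norm (DF x))\<^sup>2 / 4 - (\<Sum>b\<in>Basis. D2F x b \<bullet> b) / 2) * (h x)\<^sup>2 * exp (- F x)
      + (\<Sum>b\<in>Basis. w' b x b) / 2 \<le> (norm (Dh x))\<^sup>2 * exp (- F x)"
      unfolding 1 by (simp add: algebra_simps add_divide_distrib diff_divide_distrib)
  qed
  finally show ?thesis .
qed

text \<open>The one-sided square is C^1 across 0; its translates are the building blocks of the
  quadratic spline in the cutoff.\<close>

lemma has_field_derivative_max_sq:
  "((\<lambda>u::real. (max 0 u)\<^sup>2) has_field_derivative 2 * max 0 u) (at u)"
proof -
  consider "u > 0" | "u < 0" | "u = 0" by linarith
  then show ?thesis
  proof cases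
    case 1
    have "((\<lambda>u::real. u\<^sup>2) has_field_derivative 2 * u) (at u)"
      by (auto intro!: derivative_eq_intros)
    then have "((\<lambda>u::real. (max 0 u)\<^sup>2) has_field_derivative 2 * u) (at u)"
      by (rule has_field_derivative_transform_within_open[where S="{0<..}"]) (use 1 in simp_all)
    then show ?thesis using 1 by simp
  next
    case 2
    have "((\<lambda>u::real. (max 0 u)\<^sup>2) has_field_derivative 0) (at u)"
      by (rule has_field_derivative_transform_within_open[where S="{..<0}" and f="\<lambda>_. 0"]) (use 2 in simp_all)
    then show ?thesis using 2 by simp
  next
    case 3
    have "((\<lambda>h::real. (max 0 h)\<^sup>2 / h) \<longlongrightarrow> 0) (at 0)"
    proof (rule tendsto_rabs_zero_cancel, rule tendsto_sandwich)
      show "\<forall>\<^sub>F h in at (0::real). 0 \<le> \<bar>(max 0 h)\<^sup>2 / h\<bar>" by simp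
      have "\<bar>(max 0 h)\<^sup>2 / h\<bar> \<le> \<bar>h\<bar>" for h :: real
        by (auto simp: max_def power2_eq_square)
      then show "\<forall>\<^sub>F h in at (0::real). \<bar>(max 0 h)\<^sup>2 / h\<bar> \<le> \<bar>h\<bar>" by simp
      show "((\<lambda>h::real. \<bar>h\<bar>) \<longlongrightarrow> 0) (at 0)" by (auto intro!: tendsto_eq_intros)
    qed simp
    then show ?thesis using 3 by (simp add: DERIV_def)
  qed
qed

text \<open>The angle \<open>\<theta>\<close> of the quadratic partition of unity \<open>cos\<^sup>2 \<theta> + sin\<^sup>2 \<theta> = 1\<close>.\<close>

lemma cutoff_angle:
  assumes R: "R > 0"
  obtains th :: "'a::euclidean_space \<Rightarrow> real" and Dth :: "'a \<Rightarrow> 'a" where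
    "\<And>x. (th has_derivative (\<lambda>v. Dth x \<bullet> v)) (at x)" "continuous_on UNIV Dth"
    "\<And>x. norm x \<le> R \<Longrightarrow> th x = 0" "\<And>x. norm x \<ge> 2 * R \<Longrightarrow> th x = pi / 2"
    "\<And>x. 0 \<le> th x \<and> th x \<le> pi / 2" "\<And>x. norm (Dth x) \<le> 6 / R"
proof -
  \<comment> \<open>A quadratic spline: its derivative \<open>q'\<close> is the tent over [0,1] with
    height 2 at 1/2, which has area 1, so \<open>q\<close> climbs from 0 to 1.\<close>
  define q where "q u = 2 * (max 0 u)\<^sup>2 - 4 * (max 0 (u - 1/2))\<^sup>2 + 2 * (max 0 (u - 1))\<^sup>2" for u :: real
  define q' where "q' u = 4 * max 0 u - 8 * max 0 (u - 1/2) + 4 * max 0 (u - 1)" for u :: real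
  have q_deriv: "(q has_field_derivative q' u) (at u)" for u
  proof -
    have shift: "((\<lambda>u. (max 0 (u - a))\<^sup>2) has_field_derivative 2 * max 0 (u - a)) (at u)" for a
      using DERIV_shift[of "\<lambda>u. (max 0 u)\<^sup>2" "2 * max 0 (u - a)" u "- a"]
        has_field_derivative_max_sq[of "u - a"] by simp
    show ?thesis unfolding q_def[abs_def] q'_def
      by (rule derivative_eq_intros shift has_field_derivative_max_sq refl)+ simp
  qed
  have q_low: "q u = 0" "q' u = 0" if "u \<le> 0" for u using that by (auto simp: q_def q'_def)
  have q_high: "q u = 1" "q' u = 0" if "u \<ge> 1" for u
    using that by (auto simp: q_def q'_def max_def power2_eq_square algebra_simps)
  have q'_bd: "0 \<le> q' u" "q' u \<le> 2" for u by (auto simp: q'_def max_def)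
  have q_mono: "q u \<le> q v" if "u \<le> v" for u v
    using DERIV_nonneg_imp_nondecreasing[OF that, of q] q_deriv q'_bd(1) by blast
  have q_bd: "0 \<le> q u" "q u \<le> 1" for u
    using q_mono[of "min u 0" u] q_low[of "min u 0"] q_mono[of u "max u 1"] q_high[of "max u 1"] by auto
  have cont_q': "continuous_on UNIV q'" unfolding q'_def[abs_def] by (intro continuous_intros)
  \<comment> \<open>This normalisation makes \<open>u\<close> vanish at radius \<open>R\<close> and
    equal 1 at radius \<open>2 * R\<close>. A function of the squared norm stays differentiable at
    the origin.\<close>
  define k where "k = 1 / (3 * R\<^sup>2)"
  define u where "u x = (x \<bullet> x) * k - 1 / 3" for x :: 'a
  have u_eq: "u x = ((norm x)\<^sup>2 / R\<^sup>2 - 1) / 3" for x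
    using R by (simp add: u_def k_def power2_norm_eq_inner field_simps)
  define th where "th x = pi / 2 * q (u x)" for x
  define Dth where "Dth x = (pi / 2 * q' (u x) * (2 * k)) *\<^sub>R x" for x
  show ?thesis
  proof (rule that)
    have "(u has_derivative (\<lambda>v. 2 * k * (x \<bullet> v))) (at x)" for x
      unfolding u_def[abs_def]
      by (rule derivative_eq_intros refl)+ (auto simp: inner_commute field_simps)
    then have "((\<lambda>x. q (u x)) has_derivative (\<lambda>v. q' (u x) * (2 * k * (x \<bullet> v)))) (at x)" for x
      using q_deriv by (intro has_derivative_compose[of u _ _ _ q "\<lambda>y. q' (u x) * y"]) (simp_all add: has_field_derivative_def)
    then show "(th has_derivative (\<lambda>v. Dth x \<bullet> v)) (at x)" for x
      unfolding th_def[abs_def] Dth_def by (auto intro!: derivative_eq_intros simp: field_simps)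
    have "continuous_on UNIV (\<lambda>x. q' (u x))"
      unfolding u_def by (intro continuous_on_compose2[OF cont_q'] continuous_intros) auto
    then show "continuous_on UNIV Dth"
      unfolding Dth_def by (intro continuous_intros)
    show "th x = 0" if "norm x \<le> R" for x
    proof -
      have "(norm x)\<^sup>2 \<le> R\<^sup>2" using that by (intro power_mono) auto
      then have "u x \<le> 0" using R by (simp add: u_eq field_simps)
      then show ?thesis by (simp add: th_def q_low)
    qed
    have high: "u x \<ge> 1" if "norm x \<ge> 2 * R" for x
    proof -
      have "(2 * R)\<^sup>2 \<le> (norm x)\<^sup>2" using that R by (intro power_mono) auto
      then show "u x \<ge> 1" using R by (simp add: u_eq field_simps)
    qed
    then show "th x = pi / 2" if "norm x \<ge> 2 * R" for x
      using that by (simp add: th_def q_high)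
    show "0 \<le> th x \<and> th x \<le> pi / 2" for x
      using q_bd[of "u x"] pi_gt_zero unfolding th_def by (auto simp: mult_left_le)
    show "norm (Dth x) \<le> 6 / R" for x
    proof (cases "norm x \<ge> 2 * R")
      case True
      then show ?thesis using R by (simp add: Dth_def q_high high)
    next
      case False
      have "norm (Dth x) = pi / 2 * q' (u x) * (2 / (3 * R\<^sup>2)) * norm x"
        using q'_bd[of "u x"] by (simp add: Dth_def k_def)
      \<comment> \<open>With pi below 4, \<open>q'\<close> at most 2 and \<open>norm x\<close> at
        most \<open>2 * R\<close> the product is 16/(3 R), which is rounded up to 6/R.\<close>
      also have "\<dots> \<le> 4 / 2 * 2 * (2 / (3 * R\<^sup>2)) * (2 * R)"
        using q'_bd[of "u x"] pi_less_4 False by (intro mult_mono) auto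
      also have "\<dots> \<le> 6 / R" using R by (simp add: field_simps power2_eq_square)
      finally show ?thesis .
    qed
  qed
qed

text \<open>Extends the Witten inequality from compact support to bounded functions by truncating
  with \<open>cos (th n x)\<close>. At each point the truncation is eventually inactive, since there
  \<open>th n x\<close> is 0 and its gradient enters with the factor \<open>sin (th n x)\<close>;
  the uniform bounds on the gradients allow dominated convergence.\<close>

lemma witten_outside:
  fixes F g :: "'a::euclidean_space \<Rightarrow> real"
  assumes F: "\<And>x. (F has_derivative (\<lambda>v. DF x \<bullet> v)) (at x)"
    and DF: "\<And>x. (DF has_derivative D2F x) (at x)"
    and D2F: "\<And>b. b \<in> Basis \<Longrightarrow> continuous_on UNIV (\<lambda>x. D2F x b \<bullet> b)"
    and intF: "integrable lborel (\<lambda>x. exp (- F x))"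
    and g: "\<And>x. (g has_derivative (\<lambda>v. Dg x \<bullet> v)) (at x)" and Dg: "continuous_on UNIV Dg"
    and bd: "\<And>x. \<bar>g x\<bar> \<le> M" "\<And>x. norm (Dg x) \<le> M"
    and K: "\<And>x. g x \<noteq> 0 \<Longrightarrow> K \<le> (norm (DF x))\<^sup>2 / 4 - (\<Sum>b\<in>Basis. D2F x b \<bullet> b) / 2"
  shows "K * (\<integral>x. (g x)\<^sup>2 * exp (- F x) \<partial>lborel) \<le> (\<integral>x. (norm (Dg x))\<^sup>2 * exp (- F x) \<partial>lborel)"
proof -
  have cont: "continuous_on UNIV F" "continuous_on UNIV DF" "continuous_on UNIV g"
    using F DF g has_derivative_continuous by (blast intro: continuous_at_imp_continuous_on)+
  have M: "M \<ge> 0" using bd(1)[of 0] by linarith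
  define P where "P n th Dth \<longleftrightarrow> (\<forall>x. (th has_derivative (\<lambda>v. Dth x \<bullet> v)) (at x)) \<and> continuous_on UNIV Dth \<and>
     (\<forall>x. norm x \<le> real (Suc n) \<longrightarrow> th x = 0) \<and> (\<forall>x. norm x \<ge> 2 * real (Suc n) \<longrightarrow> th x = pi/2) \<and>
     (\<forall>x. norm (Dth x) \<le> 6 / real (Suc n))" for n and th :: "'a \<Rightarrow> real" and Dth :: "'a \<Rightarrow> 'a"
  have "\<exists>th Dth. P n th Dth" for n
    unfolding P_def by (rule cutoff_angle[of "real (Suc n)", where 'a='a]) (simp, blast)
  then obtain th Dth where P: "\<And>n. P n (th n) (Dth n)" by metis
  have th: "((th n) has_derivative (\<lambda>v. Dth n x \<bullet> v)) (at x)"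
    and contD: "continuous_on UNIV (Dth n)"
    and th0: "norm x \<le> real (Suc n) \<Longrightarrow> th n x = 0"
    and th1: "norm x \<ge> 2 * real (Suc n) \<Longrightarrow> th n x = pi/2"
    and Dth_le: "norm (Dth n x) \<le> 6 / real (Suc n)" for n x
    using P[of n] unfolding P_def by blast+
  have contth: "continuous_on UNIV (th n)" for n
    using th has_derivative_continuous by (blast intro: continuous_at_imp_continuous_on)
  have Dth6: "norm (Dth n x) \<le> 6" for n x
  proof -
    have "6 / real (Suc n) \<le> 6" by (simp add: field_simps)
    then show ?thesis using Dth_le[of n x] by linarith
  qed
  define phi where "phi n x = cos (th n x) * g x" for n x
  define Dphi where "Dphi n x = cos (th n x) *\<^sub>R Dg x - (g x * sin (th n x)) *\<^sub>R Dth n x" for n x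
  have Dphi_le: "norm (Dphi n x) \<le> 7 * M" for n x
  proof -
    have "norm (Dphi n x) \<le> \<bar>cos (th n x)\<bar> * norm (Dg x) + \<bar>g x\<bar> * \<bar>sin (th n x)\<bar> * norm (Dth n x)"
      unfolding Dphi_def by (rule order_trans[OF norm_triangle_ineq4]) (simp add: abs_mult)
    also have "\<dots> \<le> 1 * M + (M * 1) * 6"
      using bd Dth6 M by (intro add_mono mult_mono) auto
    finally show ?thesis by simp
  qed
  have step: "K * (\<integral>x. (phi n x)\<^sup>2 * exp (- F x) \<partial>lborel) \<le> (\<integral>x. (norm (Dphi n x))\<^sup>2 * exp (- F x) \<partial>lborel)" for n
  proof -
    have supp: "phi n x = 0" if "norm x > 2 * real (Suc n)" for x
      using th1[of n x] that by (simp only: phi_def cos_pi_half mult_zero_left less_imp_le)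
    have contphi: "continuous_on UNIV (phi n)"
      unfolding phi_def by (intro continuous_intros contth cont)
    have "K * (\<integral>x. (phi n x)\<^sup>2 * exp (- F x) \<partial>lborel) = (\<integral>x. K * (phi n x)\<^sup>2 * exp (- F x) \<partial>lborel)"
      by (simp add: mult.assoc)
    also have "\<dots> \<le> (\<integral>x. ((norm (DF x))\<^sup>2 / 4 - (\<Sum>b\<in>Basis. D2F x b \<bullet> b) / 2) * (phi n x)\<^sup>2 * exp (- F x) \<partial>lborel)"
    proof (rule integral_mono)
      show "integrable lborel (\<lambda>x. K * (phi n x)\<^sup>2 * exp (- F x))"
        by (rule integrable_compact_support[where r="2 * real (Suc n)"])
           (auto intro!: continuous_intros cont contphi simp: supp)
      show "integrable lborel (\<lambda>x. ((norm (DF x))\<^sup>2 / 4 - (\<Sum>b\<in>Basis. D2F x b \<bullet> b) / 2) * (phi n x)\<^sup>2 * exp (- F x))"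
        by (rule integrable_compact_support[where r="2 * real (Suc n)"])
           (auto intro!: continuous_intros cont contphi D2F simp: supp)
      show "K * (phi n x)\<^sup>2 * exp (- F x) \<le> ((norm (DF x))\<^sup>2 / 4 - (\<Sum>b\<in>Basis. D2F x b \<bullet> b) / 2) * (phi n x)\<^sup>2 * exp (- F x)" for x
      proof (cases "g x = 0")
        case False
        then show ?thesis using K[of x] by (intro mult_right_mono) auto
      qed (simp add: phi_def)
    qed
    also have "\<dots> \<le> (\<integral>x. (norm (Dphi n x))\<^sup>2 * exp (- F x) \<partial>lborel)"
    proof (rule witten_inequality[OF F DF D2F])
      show "(phi n has_derivative (\<lambda>v. Dphi n x \<bullet> v)) (at x)" for x
        unfolding phi_def[abs_def] Dphi_def
        by (rule derivative_eq_intros th g refl)+ (auto simp: inner_simps algebra_simps)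
      show "continuous_on UNIV (Dphi n)"
        unfolding Dphi_def by (intro continuous_intros contth cont Dg contD)
      show "phi n x = 0" if "norm x > 2 * real (Suc n)" for x by (rule supp[OF that])
    qed auto
    finally show ?thesis .
  qed
  have ev: "\<forall>\<^sub>F n in sequentially. th n x = 0" for x
  proof -
    have "\<forall>\<^sub>F n in sequentially. norm x \<le> real (Suc n)"
      using eventually_ge_at_top[of "nat \<lceil>norm x\<rceil>"] by eventually_elim linarith
    then show ?thesis by eventually_elim (rule th0)
  qed
  have lim1: "(\<lambda>n. \<integral>x. (phi n x)\<^sup>2 * exp (- F x) \<partial>lborel) \<longlonglongrightarrow> (\<integral>x. (g x)\<^sup>2 * exp (- F x) \<partial>lborel)"
  proof (rule integral_dominated_convergence[where w="\<lambda>x. M\<^sup>2 * exp (- F x)"])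
    have "(\<lambda>n. (phi n x)\<^sup>2 * exp (- F x)) \<longlonglongrightarrow> (g x)\<^sup>2 * exp (- F x)" for x
      using ev[of x] by (intro tendsto_eventually) (auto elim!: eventually_mono simp: phi_def)
    then show "AE x in lborel. (\<lambda>n. (phi n x)\<^sup>2 * exp (- F x)) \<longlonglongrightarrow> (g x)\<^sup>2 * exp (- F x)" by simp
    have "(phi n x)\<^sup>2 \<le> M\<^sup>2" for n x
    proof -
      have "\<bar>cos (th n x)\<bar> * \<bar>g x\<bar> \<le> 1 * M" using bd(1) by (intro mult_mono) auto
      then show ?thesis using M by (intro abs_le_square_iff[THEN iffD1]) (simp add: phi_def abs_mult)
    qed
    then show "AE x in lborel. norm ((phi n x)\<^sup>2 * exp (- F x)) \<le> M\<^sup>2 * exp (- F x)" for n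
      by (simp add: abs_mult)
    show "(\<lambda>x. (phi n x)\<^sup>2 * exp (- F x)) \<in> borel_measurable lborel" for n
      unfolding phi_def by (simp, intro borel_measurable_continuous_onI continuous_intros contth cont)
    show "(\<lambda>x. (g x)\<^sup>2 * exp (- F x)) \<in> borel_measurable lborel"
      by (simp, intro borel_measurable_continuous_onI continuous_intros cont)
  qed (use intF in auto)
  have lim2: "(\<lambda>n. \<integral>x. (norm (Dphi n x))\<^sup>2 * exp (- F x) \<partial>lborel) \<longlonglongrightarrow> (\<integral>x. (norm (Dg x))\<^sup>2 * exp (- F x) \<partial>lborel)"
  proof (rule integral_dominated_convergence[where w="\<lambda>x. (7 * M)\<^sup>2 * exp (- F x)"])
    have "(\<lambda>n. (norm (Dphi n x))\<^sup>2 * exp (- F x)) \<longlonglongrightarrow> (norm (Dg x))\<^sup>2 * exp (- F x)" for x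
      using ev[of x] by (intro tendsto_eventually) (auto elim!: eventually_mono simp: Dphi_def)
    then show "AE x in lborel. (\<lambda>n. (norm (Dphi n x))\<^sup>2 * exp (- F x)) \<longlonglongrightarrow> (norm (Dg x))\<^sup>2 * exp (- F x)" by simp
    have "(norm (Dphi n x))\<^sup>2 \<le> (7 * M)\<^sup>2" for n x
      by (intro power_mono Dphi_le) auto
    then show "AE x in lborel. norm ((norm (Dphi n x))\<^sup>2 * exp (- F x)) \<le> (7 * M)\<^sup>2 * exp (- F x)" for n
      by (simp add: abs_mult)
    show "(\<lambda>x. (norm (Dphi n x))\<^sup>2 * exp (- F x)) \<in> borel_measurable lborel" for n
      unfolding Dphi_def by (simp, intro borel_measurable_continuous_onI continuous_intros contth cont Dg contD)
    show "(\<lambda>x. (norm (Dg x))\<^sup>2 * exp (- F x)) \<in> borel_measurable lborel"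
      by (simp, intro borel_measurable_continuous_onI continuous_intros cont Dg)
  qed (use intF in auto)
  show ?thesis
    by (rule LIMSEQ_le[OF tendsto_mult_left[OF lim1] lim2]) (use step in auto)
qed

section \<open>Localised Poincare inequality near a Gaussian\<close>

context pos_def_form
begin

lemma Z_pos: "0 < (\<integral>x. exp (- Q x) \<partial>lborel)"
  by (rule integral_pos_continuous[where c=0])
     (auto intro!: continuous_intros integrable_exp_neg_Q)

text \<open>IMS localisation: near the origin \<open>F\<close> is compared with the quadratic form \<open>Q\<close>, away from it
  the Witten potential of \<open>F\<close> is large.\<close>

lemma perturbed_poincare:
  fixes F h :: "'a \<Rightarrow> real"
  assumes F: "\<And>x. (F has_derivative (\<lambda>v. DF x \<bullet> v)) (at x)"
    and DF: "\<And>x. (DF has_derivative D2F x) (at x)"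
    and D2F: "\<And>b. b \<in> Basis \<Longrightarrow> continuous_on UNIV (\<lambda>x. D2F x b \<bullet> b)"
    and intF: "integrable lborel (\<lambda>x. exp (- F x))"
    and h: "\<And>x. (h has_derivative (\<lambda>v. Dh x \<bullet> v)) (at x)" and Dh: "continuous_on UNIV Dh"
    and supp: "\<And>x. norm x > r \<Longrightarrow> h x = 0"
    and R: "R > 0" and near: "\<And>x. norm x \<le> 2 * R \<Longrightarrow> \<bar>F x - Q x\<bar> \<le> d"
    and K: "K > 0"
    and far: "\<And>x. norm x > R \<Longrightarrow> K \<le> (norm (DF x))\<^sup>2 / 4 - (\<Sum>b\<in>Basis. D2F x b \<bullet> b) / 2"
    and A: "exp (2 * d) / lam \<le> A" "1 / K \<le> A"
  shows "\<exists>m. (1 - 36 * A / R\<^sup>2) * (\<integral>x. (h x - m)\<^sup>2 * exp (- F x) \<partial>lborel)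
    \<le> A * (\<integral>x. (norm (Dh x))\<^sup>2 * exp (- F x) \<partial>lborel)"
proof -
  obtain th and Dth :: "'a \<Rightarrow> 'a" where
    th: "\<And>x. (th has_derivative (\<lambda>v. Dth x \<bullet> v)) (at x)" and contD: "continuous_on UNIV Dth"
    and th0: "\<And>x. norm x \<le> R \<Longrightarrow> th x = 0" and th1: "\<And>x. norm x \<ge> 2 * R \<Longrightarrow> th x = pi / 2"
    and th_range: "\<And>x. 0 \<le> th x \<and> th x \<le> pi / 2" and Dth: "\<And>x. norm (Dth x) \<le> 6 / R"
    using cutoff_angle[OF R] by blast
  have cont: "continuous_on UNIV F" "continuous_on UNIV h" "continuous_on UNIV th"
    using F h th has_derivative_continuous by (blast intro: continuous_at_imp_continuous_on)+
  have Dh0: "Dh x = 0" if "norm x > r" for x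
    using has_derivative_zero_outside[OF h supp that] by (metis inner_eq_zero_iff)
  obtain B1 where B1: "B1 \<ge> 0" "\<And>x. norm (h x) \<le> B1"
    using continuous_on_compact_support_bounded[OF cont(2) supp] by blast
  obtain B2 where B2: "B2 \<ge> 0" "\<And>x. norm (Dh x) \<le> B2"
    using continuous_on_compact_support_bounded[OF Dh Dh0] by blast
  have A0: "A > 0" using A(2) K by (smt (verit) divide_pos_pos)
  have cos0: "cos (th x) = 0" if "norm x > 2 * R" for x
    using th1[of x] that by (simp only: cos_pi_half less_imp_le)
  have cos_nn: "0 \<le> cos (th x)" for x
    using th_range[of x] by (intro cos_ge_zero) auto

  have cpos: "0 < (\<integral>x. cos (th x) * exp (- Q x) \<partial>lborel)"
  proof (rule integral_pos_continuous[where c=0])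
    show "integrable lborel (\<lambda>x. cos (th x) * exp (- Q x))"
      by (rule integrable_compact_support[where r="2 * R"]) (auto intro!: continuous_intros cont simp: cos0)
    show "0 < cos (th 0) * exp (- Q 0)" using th0[of 0] R by simp
  qed (auto intro!: continuous_intros cont cos_nn mult_nonneg_nonneg)
  \<comment> \<open>Chosen so that \<open>chi\<close> has integral 0 against
    \<open>exp (- Q x)\<close>, which removes the mean from \<open>gaussian_poincare\<close>. It is
    not the mean of \<open>h\<close> under \<open>exp (- F x)\<close>, so the conclusion only
    asserts some \<open>m\<close>.\<close>
  define m where "m = (\<integral>x. cos (th x) * h x * exp (- Q x) \<partial>lborel) / (\<integral>x. cos (th x) * exp (- Q x) \<partial>lborel)"
  define g where "g x = h x - m" for x
  define chi where "chi x = cos (th x) * g x" for x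
  define eta where "eta x = sin (th x) * g x" for x
  define Dchi where "Dchi x = cos (th x) *\<^sub>R Dh x - (g x * sin (th x)) *\<^sub>R Dth x" for x
  define Deta where "Deta x = sin (th x) *\<^sub>R Dh x + (g x * cos (th x)) *\<^sub>R Dth x" for x
  have contg: "continuous_on UNIV g" unfolding g_def by (intro continuous_intros cont)
  have g: "(g has_derivative (\<lambda>v. Dh x \<bullet> v)) (at x)" for x
    unfolding g_def by (rule derivative_eq_intros h refl)+ simp
  have chi: "(chi has_derivative (\<lambda>v. Dchi x \<bullet> v)) (at x)" for x
    unfolding chi_def[abs_def] Dchi_def
    by (rule derivative_eq_intros th g refl)+ (auto simp: inner_simps algebra_simps)
  have eta: "(eta has_derivative (\<lambda>v. Deta x \<bullet> v)) (at x)" for x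
    unfolding eta_def[abs_def] Deta_def
    by (rule derivative_eq_intros th g refl)+ (auto simp: inner_simps algebra_simps)
  have contchi: "continuous_on UNIV chi" "continuous_on UNIV Dchi" "continuous_on UNIV eta" "continuous_on UNIV Deta"
    unfolding chi_def Dchi_def eta_def Deta_def by (intro continuous_intros cont contg Dh contD)+
  have chi0: "chi x = 0" if "norm x > 2 * R" for x using cos0[OF that] by (simp add: chi_def)
  have Dchi0: "Dchi x = 0" if "norm x > 2 * R" for x
    using has_derivative_zero_outside[OF chi chi0 that] by (metis inner_eq_zero_iff)
  have gM: "\<bar>g x\<bar> \<le> B1 + \<bar>m\<bar>" for x
    using B1(2)[of x] unfolding g_def by simp
  have split1: "(chi x)\<^sup>2 + (eta x)\<^sup>2 = (g x)\<^sup>2" for x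
  proof -
    have "(chi x)\<^sup>2 + (eta x)\<^sup>2 = ((sin (th x))\<^sup>2 + (cos (th x))\<^sup>2) * (g x)\<^sup>2"
      unfolding chi_def eta_def by (simp only: power_mult_distrib distrib_right add.commute)
    then show ?thesis by simp
  qed
  \<comment> \<open>The IMS identity: the mixed terms of the two gradients cancel because cosine and
    sine are rotated into each other, and only the localisation error remains.\<close>
  have split2: "(norm (Dchi x))\<^sup>2 + (norm (Deta x))\<^sup>2 = (norm (Dh x))\<^sup>2 + (g x)\<^sup>2 * (norm (Dth x))\<^sup>2" for x
  proof -
    have "(norm (c *\<^sub>R u - (k * s) *\<^sub>R v))\<^sup>2 + (norm (s *\<^sub>R u + (k * c) *\<^sub>R v))\<^sup>2
      = (s\<^sup>2 + c\<^sup>2) * ((norm u)\<^sup>2 + k\<^sup>2 * (norm v)\<^sup>2)" for c s k :: real and u v :: 'a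
      unfolding power2_norm_eq_inner
      by (simp add: inner_simps inner_commute[of v u] power2_eq_square algebra_simps)
    then have "(norm (Dchi x))\<^sup>2 + (norm (Deta x))\<^sup>2
      = ((sin (th x))\<^sup>2 + (cos (th x))\<^sup>2) * ((norm (Dh x))\<^sup>2 + (g x)\<^sup>2 * (norm (Dth x))\<^sup>2)"
      unfolding Dchi_def Deta_def .
    then show ?thesis by simp
  qed
  have Deta_le: "norm (Deta x) \<le> B2 + (B1 + \<bar>m\<bar>) * (6 / R)" for x
  proof -
    have "norm (Deta x) \<le> \<bar>sin (th x)\<bar> * norm (Dh x) + (\<bar>g x\<bar> * \<bar>cos (th x)\<bar>) * norm (Dth x)"
      unfolding Deta_def by (rule order_trans[OF norm_triangle_ineq]) (simp add: abs_mult)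
    also have "\<dots> \<le> 1 * B2 + ((B1 + \<bar>m\<bar>) * 1) * (6 / R)"
      using gM B2 B1(1) Dth by (intro add_mono mult_mono) auto
    finally show ?thesis by simp
  qed
  have mean: "(\<integral>x. chi x * exp (- Q x) \<partial>lborel) = 0"
  proof -
    have i1: "integrable lborel (\<lambda>x. cos (th x) * h x * exp (- Q x))"
      by (rule integrable_compact_support[where r="2 * R"]) (auto intro!: continuous_intros cont simp: cos0)
    have i2: "integrable lborel (\<lambda>x. cos (th x) * exp (- Q x))"
      by (rule integrable_compact_support[where r="2 * R"]) (auto intro!: continuous_intros cont simp: cos0)
    have "(\<integral>x. chi x * exp (- Q x) \<partial>lborel)
      = (\<integral>x. cos (th x) * h x * exp (- Q x) - m * (cos (th x) * exp (- Q x)) \<partial>lborel)"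
      by (rule Bochner_Integration.integral_cong) (auto simp: chi_def g_def algebra_simps)
    also have "\<dots> = (\<integral>x. cos (th x) * h x * exp (- Q x) \<partial>lborel) - m * (\<integral>x. cos (th x) * exp (- Q x) \<partial>lborel)"
      using i1 i2 by simp
    also have "\<dots> = 0" using cpos by (simp add: m_def)
    finally show ?thesis .
  qed
  have near_chi: "(\<integral>x. (chi x)\<^sup>2 * exp (- F x) \<partial>lborel) \<le> A * (\<integral>x. (norm (Dchi x))\<^sup>2 * exp (- F x) \<partial>lborel)"
  proof -
    have intQ: "integrable lborel (\<lambda>x. (chi x)\<^sup>2 * exp (- Q x))" "integrable lborel (\<lambda>x. (norm (Dchi x))\<^sup>2 * exp (- Q x))"
      "integrable lborel (\<lambda>x. (chi x)\<^sup>2 * exp (- F x))" "integrable lborel (\<lambda>x. (norm (Dchi x))\<^sup>2 * exp (- F x))"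
      by (rule integrable_compact_support[where r="2 * R"], auto intro!: continuous_intros cont contchi simp: chi0 Dchi0)+
    \<comment> \<open>The comparison is used twice, from \<open>F\<close> to \<open>Q\<close> for
      the square and back from \<open>Q\<close> to \<open>F\<close> for the gradient; hence the
      factor \<open>exp (2 * d)\<close>.\<close>
    have comp: "exp (- F x) \<le> exp d * exp (- Q x)" "exp (- Q x) \<le> exp d * exp (- F x)" if "norm x \<le> 2 * R" for x
      using near[OF that] by (simp_all add: mult_exp_exp)
    have "(\<integral>x. (chi x)\<^sup>2 * exp (- F x) \<partial>lborel) \<le> (\<integral>x. exp d * ((chi x)\<^sup>2 * exp (- Q x)) \<partial>lborel)"
    proof (rule integral_mono)
      show "(chi x)\<^sup>2 * exp (- F x) \<le> exp d * ((chi x)\<^sup>2 * exp (- Q x))" for x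
      proof (cases "norm x \<le> 2 * R")
        case True
        then show ?thesis using mult_left_mono[OF comp(1)[OF True], of "(chi x)\<^sup>2"] by (simp add: mult_ac)
      qed (use chi0 in auto)
    qed (use intQ in auto)
    also have "\<dots> = exp d * (\<integral>x. (chi x)\<^sup>2 * exp (- Q x) \<partial>lborel)" by simp
    also have "\<dots> \<le> exp d * ((1 / lam) * (\<integral>x. (norm (Dchi x))\<^sup>2 * exp (- Q x) \<partial>lborel))"
    proof (rule mult_left_mono)
      show "(\<integral>x. (chi x)\<^sup>2 * exp (- Q x) \<partial>lborel) \<le> (1 / lam) * (\<integral>x. (norm (Dchi x))\<^sup>2 * exp (- Q x) \<partial>lborel)"
        using gaussian_poincare[OF chi contchi(2) chi0] Z_pos lam_pos by (simp add: mean field_simps)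
    qed simp
    also have "\<dots> \<le> exp d * ((1 / lam) * (\<integral>x. exp d * ((norm (Dchi x))\<^sup>2 * exp (- F x)) \<partial>lborel))"
    proof (intro mult_left_mono integral_mono)
      show "(norm (Dchi x))\<^sup>2 * exp (- Q x) \<le> exp d * ((norm (Dchi x))\<^sup>2 * exp (- F x))" for x
      proof (cases "norm x \<le> 2 * R")
        case True
        then show ?thesis using mult_left_mono[OF comp(2)[OF True], of "(norm (Dchi x))\<^sup>2"] by (simp add: mult_ac)
      qed (use Dchi0 in auto)
    qed (use intQ lam_pos in auto)
    also have "\<dots> = (exp (2 * d) / lam) * (\<integral>x. (norm (Dchi x))\<^sup>2 * exp (- F x) \<partial>lborel)"
      by (simp add: exp_double power2_eq_square)
    also have "\<dots> \<le> A * (\<integral>x. (norm (Dchi x))\<^sup>2 * exp (- F x) \<partial>lborel)"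
      using A(1) by (intro mult_right_mono) auto
    finally show ?thesis .
  qed
  have far_eta: "(\<integral>x. (eta x)\<^sup>2 * exp (- F x) \<partial>lborel) \<le> A * (\<integral>x. (norm (Deta x))\<^sup>2 * exp (- F x) \<partial>lborel)"
  proof -
    define M where "M = max (B1 + \<bar>m\<bar>) (B2 + (B1 + \<bar>m\<bar>) * (6 / R))"
    \<comment> \<open>Far away \<open>eta\<close> is the constant \<open>- m\<close>, so the version
      for bounded functions is required. Inside radius \<open>R\<close> it vanishes, so the lower
      bound \<open>K\<close> on the potential is available wherever it is asked for.\<close>
    have "K * (\<integral>x. (eta x)\<^sup>2 * exp (- F x) \<partial>lborel) \<le> (\<integral>x. (norm (Deta x))\<^sup>2 * exp (- F x) \<partial>lborel)"
    proof (rule witten_outside[OF F DF D2F intF eta contchi(4)])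
      show "\<bar>eta x\<bar> \<le> M" for x
      proof -
        have "\<bar>sin (th x)\<bar> * \<bar>g x\<bar> \<le> 1 * (B1 + \<bar>m\<bar>)" using gM by (intro mult_mono) auto
        then show ?thesis by (simp add: eta_def abs_mult M_def)
      qed
      show "norm (Deta x) \<le> M" for x using Deta_le[of x] by (simp add: M_def)
      show "K \<le> (norm (DF x))\<^sup>2 / 4 - (\<Sum>b\<in>Basis. D2F x b \<bullet> b) / 2" if "eta x \<noteq> 0" for x
        using that th0[of x] by (intro far) (force simp: eta_def)
    qed auto
    then have "(\<integral>x. (eta x)\<^sup>2 * exp (- F x) \<partial>lborel) \<le> 1 / K * (\<integral>x. (norm (Deta x))\<^sup>2 * exp (- F x) \<partial>lborel)"
      using K by (simp add: field_simps)
    also have "\<dots> \<le> A * (\<integral>x. (norm (Deta x))\<^sup>2 * exp (- F x) \<partial>lborel)"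
      using A(2) by (intro mult_right_mono) auto
    finally show ?thesis .
  qed
  have sq_le: "a\<^sup>2 \<le> b\<^sup>2" if "\<bar>a\<bar> \<le> b" for a b :: real
    using power_mono[OF that, of 2] by simp
  have intg: "integrable lborel (\<lambda>x. (g x)\<^sup>2 * exp (- F x))"
    using gM by (intro integrable_bounded_mult[where M="(B1 + \<bar>m\<bar>)\<^sup>2"] intF continuous_intros contg) (auto intro: sq_le)
  have inth: "integrable lborel (\<lambda>x. (norm (Dh x))\<^sup>2 * exp (- F x))"
    using B2 by (intro integrable_bounded_mult[where M="B2\<^sup>2"] intF continuous_intros Dh) (auto intro: sq_le)
  have inteta: "integrable lborel (\<lambda>x. (eta x)\<^sup>2 * exp (- F x))"
  proof (rule Bochner_Integration.integrable_bound[OF intg])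
    have "(eta x)\<^sup>2 \<le> (g x)\<^sup>2" for x using split1[of x] zero_le_power2[of "chi x"] by linarith
    then show "AE x in lborel. norm ((eta x)\<^sup>2 * exp (- F x)) \<le> norm ((g x)\<^sup>2 * exp (- F x))" by simp
    show "(\<lambda>x. (eta x)\<^sup>2 * exp (- F x)) \<in> borel_measurable lborel"
      by (simp, intro borel_measurable_continuous_onI continuous_intros contchi cont)
  qed
  have intDeta: "integrable lborel (\<lambda>x. (norm (Deta x))\<^sup>2 * exp (- F x))"
    using Deta_le by (intro integrable_bounded_mult[where M="(B2 + (B1 + \<bar>m\<bar>) * (6 / R))\<^sup>2"] intF continuous_intros contchi)
      (auto intro!: power_mono)
  have intchi: "integrable lborel (\<lambda>x. (chi x)\<^sup>2 * exp (- F x))" "integrable lborel (\<lambda>x. (norm (Dchi x))\<^sup>2 * exp (- F x))"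
    by (rule integrable_compact_support[where r="2 * R"], auto intro!: continuous_intros cont contchi simp: chi0 Dchi0)+
  have "(\<integral>x. (g x)\<^sup>2 * exp (- F x) \<partial>lborel) = (\<integral>x. (chi x)\<^sup>2 * exp (- F x) + (eta x)\<^sup>2 * exp (- F x) \<partial>lborel)"
    by (simp add: split1 flip: distrib_right)
  also have "\<dots> = (\<integral>x. (chi x)\<^sup>2 * exp (- F x) \<partial>lborel) + (\<integral>x. (eta x)\<^sup>2 * exp (- F x) \<partial>lborel)"
    using intchi inteta by simp
  also have "\<dots> \<le> A * ((\<integral>x. (norm (Dchi x))\<^sup>2 * exp (- F x) \<partial>lborel) + (\<integral>x. (norm (Deta x))\<^sup>2 * exp (- F x) \<partial>lborel))"
    using near_chi far_eta by (simp add: distrib_left)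
  also have "(\<integral>x. (norm (Dchi x))\<^sup>2 * exp (- F x) \<partial>lborel) + (\<integral>x. (norm (Deta x))\<^sup>2 * exp (- F x) \<partial>lborel)
      = (\<integral>x. ((norm (Dchi x))\<^sup>2 + (norm (Deta x))\<^sup>2) * exp (- F x) \<partial>lborel)"
    using intchi intDeta by (simp add: distrib_right)
  also have "\<dots> \<le> (\<integral>x. (norm (Dh x))\<^sup>2 * exp (- F x) + (36 / R\<^sup>2) * ((g x)\<^sup>2 * exp (- F x)) \<partial>lborel)"
  proof (rule integral_mono)
    show "integrable lborel (\<lambda>x. ((norm (Dchi x))\<^sup>2 + (norm (Deta x))\<^sup>2) * exp (- F x))"
      using intchi intDeta by (simp add: distrib_right)
    show "integrable lborel (\<lambda>x. (norm (Dh x))\<^sup>2 * exp (- F x) + (36 / R\<^sup>2) * ((g x)\<^sup>2 * exp (- F x)))"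
      using inth intg by simp
    fix x
    \<comment> \<open>Squaring the gradient bound 6/R of the cutoff gives the 36; the resulting
      multiple of the integral of \<open>g\<close>^2 is moved to the left at the end.\<close>
    have "(norm (Dth x))\<^sup>2 \<le> (6 / R)\<^sup>2" using Dth by (intro power_mono) auto
    then have "(g x)\<^sup>2 * (norm (Dth x))\<^sup>2 \<le> (g x)\<^sup>2 * (36 / R\<^sup>2)"
      by (intro mult_left_mono) (auto simp: power_divide)
    then have "((norm (Dchi x))\<^sup>2 + (norm (Deta x))\<^sup>2) * exp (- F x) \<le> ((norm (Dh x))\<^sup>2 + (g x)\<^sup>2 * (36 / R\<^sup>2)) * exp (- F x)"
      unfolding split2 by (intro mult_right_mono) auto
    then show "((norm (Dchi x))\<^sup>2 + (norm (Deta x))\<^sup>2) * exp (- F x)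
      \<le> (norm (Dh x))\<^sup>2 * exp (- F x) + (36 / R\<^sup>2) * ((g x)\<^sup>2 * exp (- F x))"
      by (simp add: algebra_simps)
  qed
  also have "\<dots> = (\<integral>x. (norm (Dh x))\<^sup>2 * exp (- F x) \<partial>lborel) + (36 / R\<^sup>2) * (\<integral>x. (g x)\<^sup>2 * exp (- F x) \<partial>lborel)"
    using inth intg by simp
  finally have "(\<integral>x. (g x)\<^sup>2 * exp (- F x) \<partial>lborel) \<le> A * ((\<integral>x. (norm (Dh x))\<^sup>2 * exp (- F x) \<partial>lborel)
     + (36 / R\<^sup>2) * (\<integral>x. (g x)\<^sup>2 * exp (- F x) \<partial>lborel))"
    using A0 by simp
  then have "(1 - 36 * A / R\<^sup>2) * (\<integral>x. (g x)\<^sup>2 * exp (- F x) \<partial>lborel)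
    \<le> A * (\<integral>x. (norm (Dh x))\<^sup>2 * exp (- F x) \<partial>lborel)"
    by (simp add: algebra_simps)
  then show ?thesis unfolding g_def by blast
qed

end

text \<open>Expanding the square and completing it in \<open>m\<close> leaves the surplus (b - m
  z)^2 / z. Thus the constant of the localisation argument may stand in for the true mean.\<close>

lemma weighted_variance_le:
  fixes h w :: "'a::euclidean_space \<Rightarrow> real"
  assumes w: "integrable lborel w" and pos: "0 < (\<integral>x. w x \<partial>lborel)"
    and h: "integrable lborel (\<lambda>x. h x * w x)" "integrable lborel (\<lambda>x. (h x)\<^sup>2 * w x)"
  shows "(\<integral>x. (h x)\<^sup>2 * w x \<partial>lborel) - (\<integral>x. h x * w x \<partial>lborel)\<^sup>2 / (\<integral>x. w x \<partial>lborel)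
    \<le> (\<integral>x. (h x - m)\<^sup>2 * w x \<partial>lborel)"
proof -
  define a b z where "a = (\<integral>x. (h x)\<^sup>2 * w x \<partial>lborel)" and "b = (\<integral>x. h x * w x \<partial>lborel)" and "z = (\<integral>x. w x \<partial>lborel)"
  have "(\<integral>x. (h x - m)\<^sup>2 * w x \<partial>lborel) = (\<integral>x. (h x)\<^sup>2 * w x - 2 * m * (h x * w x) + m\<^sup>2 * w x \<partial>lborel)"
    by (rule Bochner_Integration.integral_cong) (auto simp: power2_eq_square algebra_simps)
  also have "\<dots> = a - 2 * m * b + m\<^sup>2 * z"
    using w h by (simp add: a_def b_def z_def)
  also have "\<dots> = a - b\<^sup>2 / z + (b - m * z)\<^sup>2 / z"
    using pos by (simp add: z_def[symmetric] field_simps power2_eq_square)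
  also have "\<dots> \<ge> a - b\<^sup>2 / z" using pos by (simp add: z_def)
  finally show ?thesis by (simp add: a_def b_def z_def)
qed

section \<open>Second order behaviour at the minimiser\<close>

lemma has_derivative_gradient:
  fixes f :: "real ^ 'n \<Rightarrow> real"
  assumes "f differentiable (at x)"
  shows "(f has_derivative (\<lambda>v. gradient f x \<bullet> v)) (at x)"
proof -
  let ?D = "frechet_derivative f (at x)"
  have D: "(f has_derivative ?D) (at x)" using assms frechet_derivative_works by blast
  then have lin: "linear ?D" by (rule has_derivative_linear)
  have "?D v = gradient f x \<bullet> v" for v
  proof -
    have "?D v = ?D (\<Sum>i\<in>UNIV. (v $ i) *\<^sub>R axis i 1)"
      by (simp add: basis_expansion[of v, unfolded scalar_mult_eq_scaleR])
    also have "\<dots> = (\<Sum>i\<in>UNIV. (v $ i) * ?D (axis i 1))"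
      using lin by (simp add: linear_sum linear_cmul)
    also have "\<dots> = gradient f x \<bullet> v"
      by (simp add: gradient_def inner_vec_def mult.commute)
    finally show ?thesis .
  qed
  then have "?D = (\<lambda>v. gradient f x \<bullet> v)" by blast
  then show ?thesis using D by simp
qed

lemma gradient_eqI:
  fixes f :: "real ^ 'n \<Rightarrow> real"
  assumes "(f has_derivative (\<lambda>v. g \<bullet> v)) (at x)"
  shows "gradient f x = g"
proof -
  have "frechet_derivative f (at x) = (\<lambda>v. g \<bullet> v)"
    using frechet_derivative_at[OF assms] by simp
  then show ?thesis
    by (simp add: gradient_def vec_eq_iff inner_axis)
qed

lemma C_1_D:
  fixes f :: "real ^ 'n \<Rightarrow> real"
  assumes "C_k (Suc 0) f"
  shows "(f has_derivative (\<lambda>v. gradient f x \<bullet> v)) (at x)" "continuous_on UNIV (gradient f)"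
proof -
  show "(f has_derivative (\<lambda>v. gradient f x \<bullet> v)) (at x)"
    using assms by (intro has_derivative_gradient) simp
  have "continuous_on UNIV (\<lambda>x. \<chi> i. gradient f x $ i)"
    using assms by (intro continuous_on_vec_lambda) simp
  then show "continuous_on UNIV (gradient f)" by simp
qed

text \<open>Translates iterated partial derivatives into the Frechet derivative of the gradient: a
  diagonal entry of the Hessian is a second partial derivative, whose continuity is part of
  \<open>C_k\<close>.\<close>

lemma C_2_D:
  fixes f :: "real ^ 'n \<Rightarrow> real"
  assumes "C_k 2 f"
  shows "(f has_derivative (\<lambda>v. gradient f x \<bullet> v)) (at x)"
    and "(gradient f has_derivative (\<lambda>v. hessian f x *v v)) (at x)"
    and "b \<in> Basis \<Longrightarrow> continuous_on UNIV (\<lambda>x. (hessian f x *v b) \<bullet> b)"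
    and "laplacian f x = (\<Sum>b\<in>Basis. (hessian f x *v b) \<bullet> b)"
proof -
  have f: "f differentiable (at x)" and C1: "C_k (Suc 0) (\<lambda>x. gradient f x $ i)" for x i
    using assms by (auto simp: numeral_2_eq_2)
  show "(f has_derivative (\<lambda>v. gradient f x \<bullet> v)) (at x)"
    using f by (rule has_derivative_gradient)
  have "gradient f differentiable (at x)" for x
    unfolding differentiable_componentwise_within[of "gradient f"] Basis_vec_def
    using C1 by (auto simp: inner_axis)
  then show H: "(gradient f has_derivative (\<lambda>v. hessian f x *v v)) (at x)" for x
    by (simp add: hessian_def flip: jacobian_works)
  have diag: "(hessian f x *v axis i 1) \<bullet> axis i 1 = gradient (\<lambda>x. gradient f x $ i) x $ i" for x i
  proof -
    have "((\<lambda>x. gradient f x $ i) has_derivative (\<lambda>v. (hessian f x *v v) $ i)) (at x)"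
      using bounded_linear.has_derivative[OF bounded_linear_vec_nth H] .
    then have "(\<lambda>v. (hessian f x *v v) $ i) = frechet_derivative (\<lambda>x. gradient f x $ i) (at x)"
      by (rule frechet_derivative_at)
    then show ?thesis by (simp add: gradient_def[of "\<lambda>x. gradient f x $ i"] inner_axis) metis
  qed
  have B: "(Basis :: (real ^ 'n) set) = (\<lambda>i. axis i 1) ` UNIV" by (auto simp: Basis_vec_def)
  show "continuous_on UNIV (\<lambda>x. (hessian f x *v b) \<bullet> b)" if bB: "b \<in> Basis"
  proof -
    obtain i where b: "b = axis i 1" using bB B by blast
    show ?thesis unfolding b diag using C1[of i] by simp
  qed
  have "(\<Sum>b\<in>Basis. (hessian f x *v b) \<bullet> b) = (\<Sum>i\<in>UNIV. (hessian f x *v axis i 1) \<bullet> axis i 1)"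
    unfolding B by (subst sum.reindex) (auto simp: inj_on_def axis_eq_axis)
  also have "\<dots> = laplacian f x"
    by (simp add: laplacian_def trace_def inner_axis matrix_vector_mult_basis column_def)
  finally show "laplacian f x = (\<Sum>b\<in>Basis. (hessian f x *v b) \<bullet> b)" ..
qed

text \<open>The second difference is an increment in \<open>s\<close> of a difference of two values
  of \<open>f\<close>, so the mean value theorem expresses it by two values of \<open>g\<close> near
  \<open>c\<close>. Differentiability of \<open>g\<close> at the single point \<open>c\<close> then
  identifies the limit.\<close>

lemma second_difference:
  fixes f :: "'a::euclidean_space \<Rightarrow> real"
  assumes f: "\<And>x. (f has_derivative (\<lambda>v. g x \<bullet> v)) (at x)"
    and g: "(g has_derivative H) (at c)" and e: "e > 0"
  shows "\<exists>d>0. \<forall>t. 0 < t \<and> t < d \<longrightarrow>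
    \<bar>f (c + t *\<^sub>R u + t *\<^sub>R v) - f (c + t *\<^sub>R u) - f (c + t *\<^sub>R v) + f c - t\<^sup>2 * (H u \<bullet> v)\<bar> \<le> e * t\<^sup>2"
proof -
  \<comment> \<open>\<open>N - 1\<close> is the factor that the two remainders of \<open>g\<close>
    accumulate after pairing with \<open>v\<close>; adding 1 keeps the divisor positive when
    \<open>v\<close> is 0.\<close>
  define N where "N = (norm u + 2 * norm v) * norm v + 1"
  have N: "N > 0" by (simp add: N_def add_nonneg_pos)
  have linH: "linear H" using g by (rule has_derivative_linear)
  obtain d where d: "d > 0" "\<And>y. norm (y - c) < d \<Longrightarrow> norm (g y - g c - H (y - c)) \<le> e / N * norm (y - c)"
    using g[unfolded has_derivative_at_alt] e N by (meson divide_pos_pos)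
  have "\<bar>f (c + t *\<^sub>R u + t *\<^sub>R v) - f (c + t *\<^sub>R u) - f (c + t *\<^sub>R v) + f c - t\<^sup>2 * (H u \<bullet> v)\<bar> \<le> e * t\<^sup>2"
    if t: "0 < t" "t < d / (norm u + norm v + 1)" for t
  proof -
    have td: "t * (norm u + norm v + 1) < d"
      using t by (simp add: pos_less_divide_eq add_nonneg_pos)
    define p where "p s = f (c + t *\<^sub>R u + s *\<^sub>R (t *\<^sub>R v)) - f (c + s *\<^sub>R (t *\<^sub>R v))" for s
    have line: "((\<lambda>s. f (a + s *\<^sub>R w)) has_real_derivative (g (a + s *\<^sub>R w) \<bullet> w)) (at s)" for a w s
    proof -
      have "((\<lambda>s. f (a + s *\<^sub>R w)) has_derivative (\<lambda>h. g (a + s *\<^sub>R w) \<bullet> (h *\<^sub>R w))) (at s)"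
        by (rule has_derivative_compose[OF _ f]) (auto intro!: derivative_eq_intros)
      then show ?thesis by (simp add: has_field_derivative_def mult.commute[of _ "_ \<bullet> _"])
    qed
    have "(p has_real_derivative ((g (c + t *\<^sub>R u + s *\<^sub>R (t *\<^sub>R v)) - g (c + s *\<^sub>R (t *\<^sub>R v))) \<bullet> (t *\<^sub>R v))) (at s)" for s
      unfolding p_def[abs_def] inner_diff_left by (intro DERIV_diff line)
    then obtain s where s: "0 < s" "s < 1"
      and mvt: "p 1 - p 0 = (1 - 0) * ((g (c + t *\<^sub>R u + s *\<^sub>R (t *\<^sub>R v)) - g (c + s *\<^sub>R (t *\<^sub>R v))) \<bullet> (t *\<^sub>R v))"
      using MVT2[of 0 1 p "\<lambda>s. (g (c + t *\<^sub>R u + s *\<^sub>R (t *\<^sub>R v)) - g (c + s *\<^sub>R (t *\<^sub>R v))) \<bullet> (t *\<^sub>R v)"] zero_less_one by blast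
    define w1 where "w1 = t *\<^sub>R u + (s * t) *\<^sub>R v"
    define w2 where "w2 = (s * t) *\<^sub>R v"
    have st: "0 \<le> s * t" "s * t \<le> t" using s t by (auto intro: mult_left_le_one_le)
    have n2: "norm w2 \<le> t * norm v"
      using st mult_right_mono[OF st(2) norm_ge_zero[of v]] by (simp add: w2_def)
    have n1: "norm w1 \<le> t * (norm u + norm v)"
      using n2 norm_triangle_ineq[of "t *\<^sub>R u" w2] t by (simp add: w1_def w2_def distrib_left)
    have "t * (norm u + norm v) \<le> t * (norm u + norm v + 1)" "t * norm v \<le> t * (norm u + norm v + 1)"
      using t by (intro mult_left_mono; simp)+
    then have nd: "norm w1 < d" "norm w2 < d" using n1 n2 td by linarith+
    have r1: "norm (g (c + w1) - g c - H w1) \<le> e / N * (t * (norm u + norm v))"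
      using d(2)[of "c + w1"] nd(1) mult_left_mono[OF n1, of "e / N"] e N by simp
    have r2: "norm (g (c + w2) - g c - H w2) \<le> e / N * (t * norm v)"
      using d(2)[of "c + w2"] nd(2) mult_left_mono[OF n2, of "e / N"] e N by simp
    have Hd: "H w1 - H w2 = t *\<^sub>R H u"
      using linH by (simp add: w1_def w2_def linear_add linear_cmul)
    have "norm (g (c + w1) - g (c + w2) - t *\<^sub>R H u) \<le> e / N * (t * (norm u + norm v)) + e / N * (t * norm v)"
    proof -
      have eq: "g (c + w1) - g (c + w2) - t *\<^sub>R H u = (g (c + w1) - g c - H w1) - (g (c + w2) - g c - H w2)"
        by (simp add: Hd[symmetric])
      show ?thesis unfolding eq by (rule norm_triangle_le_diff[OF add_mono[OF r1 r2]])
    qed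
    also have "\<dots> = e / N * t * (norm u + 2 * norm v)" by (simp add: algebra_simps)
    finally have r: "norm (g (c + w1) - g (c + w2) - t *\<^sub>R H u) \<le> e / N * t * (norm u + 2 * norm v)" .
    have "f (c + t *\<^sub>R u + t *\<^sub>R v) - f (c + t *\<^sub>R u) - f (c + t *\<^sub>R v) + f c - t\<^sup>2 * (H u \<bullet> v)
      = (g (c + w1) - g (c + w2) - t *\<^sub>R H u) \<bullet> (t *\<^sub>R v)"
      using mvt by (simp add: p_def w1_def w2_def inner_diff_left power2_eq_square algebra_simps)
    also have "\<bar>\<dots>\<bar> \<le> norm (g (c + w1) - g (c + w2) - t *\<^sub>R H u) * norm (t *\<^sub>R v)"
      by (rule Cauchy_Schwarz_ineq2)
    also have "\<dots> \<le> (e / N * t * (norm u + 2 * norm v)) * norm (t *\<^sub>R v)"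
      using r by (intro mult_right_mono) auto
    also have "\<dots> = e * t\<^sup>2 * ((N - 1) / N)"
      using t by (simp add: N_def power2_eq_square mult_ac)
    also have "\<dots> \<le> e * t\<^sup>2 * 1"
      using N e by (intro mult_left_mono) auto
    finally show ?thesis by simp
  qed
  moreover have "d / (norm u + norm v + 1) > 0"
    using d(1) by (intro divide_pos_pos add_nonneg_pos) auto
  ultimately show ?thesis by blast
qed

text \<open>The second difference does not change when \<open>u\<close> and \<open>v\<close> are
  exchanged, and both orders approximate it to within o(t^2).\<close>

lemma second_derivative_symmetric:
  fixes f :: "'a::euclidean_space \<Rightarrow> real"
  assumes f: "\<And>x. (f has_derivative (\<lambda>v. g x \<bullet> v)) (at x)"
    and g: "(g has_derivative H) (at c)"
  shows "H u \<bullet> v = u \<bullet> H v"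
proof -
  have "\<bar>H u \<bullet> v - H v \<bullet> u\<bar> \<le> e" if "e > 0" for e
  proof -
    have e2: "e / 2 > 0" using that by simp
    obtain d1 where d1: "d1 > 0" "\<And>t. 0 < t \<Longrightarrow> t < d1 \<Longrightarrow>
      \<bar>f (c + t *\<^sub>R u + t *\<^sub>R v) - f (c + t *\<^sub>R u) - f (c + t *\<^sub>R v) + f c - t\<^sup>2 * (H u \<bullet> v)\<bar> \<le> e / 2 * t\<^sup>2"
      using second_difference[OF f g e2] by blast
    obtain d2 where d2: "d2 > 0" "\<And>t. 0 < t \<Longrightarrow> t < d2 \<Longrightarrow>
      \<bar>f (c + t *\<^sub>R v + t *\<^sub>R u) - f (c + t *\<^sub>R v) - f (c + t *\<^sub>R u) + f c - t\<^sup>2 * (H v \<bullet> u)\<bar> \<le> e / 2 * t\<^sup>2"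
      using second_difference[OF f g e2] by blast
    define t where "t = min d1 d2 / 2"
    have t: "0 < t" "t < d1" "t < d2" using d1(1) d2(1) by (auto simp: t_def)
    have sw: "c + t *\<^sub>R v + t *\<^sub>R u = c + t *\<^sub>R u + t *\<^sub>R v" by (simp add: algebra_simps)
    have "\<bar>t\<^sup>2 * (H u \<bullet> v) - t\<^sup>2 * (H v \<bullet> u)\<bar> \<le> e / 2 * t\<^sup>2 + e / 2 * t\<^sup>2"
      using d1(2)[OF t(1,2)] d2(2)[OF t(1,3)] unfolding sw by linarith
    moreover have "\<bar>t\<^sup>2 * (H u \<bullet> v) - t\<^sup>2 * (H v \<bullet> u)\<bar> = t\<^sup>2 * \<bar>H u \<bullet> v - H v \<bullet> u\<bar>"
      by (simp only: right_diff_distrib[symmetric] abs_mult abs_power2)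
    ultimately have "t\<^sup>2 * \<bar>H u \<bullet> v - H v \<bullet> u\<bar> \<le> t\<^sup>2 * e" by (simp add: mult.commute)
    then show ?thesis using t by simp
  qed
  then have "\<bar>H u \<bullet> v - H v \<bullet> u\<bar> \<le> 0" by (rule field_le_epsilon) simp
  then show ?thesis by (simp add: inner_commute)
qed

text \<open>The quadratic part is subtracted before the mean value theorem is applied on the
  segment; what is left is the first order remainder of \<open>g\<close> at \<open>c\<close>, paired
  with \<open>w\<close>.\<close>

lemma second_order_taylor:
  fixes f :: "'a::euclidean_space \<Rightarrow> real"
  assumes f: "\<And>x. (f has_derivative (\<lambda>v. g x \<bullet> v)) (at x)"
    and g: "(g has_derivative H) (at c)" and crit: "g c = 0" and e: "e > 0"
  shows "\<exists>d>0. \<forall>w. norm w < d \<longrightarrow> \<bar>f (c + w) - f c - w \<bullet> H w / 2\<bar> \<le> e * (norm w)\<^sup>2"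
proof -
  have linH: "linear H" using g by (rule has_derivative_linear)
  obtain d where d: "d > 0" "\<And>y. norm (y - c) < d \<Longrightarrow> norm (g y - g c - H (y - c)) \<le> e * norm (y - c)"
    using g[unfolded has_derivative_at_alt] e by meson
  have "\<bar>f (c + w) - f c - w \<bullet> H w / 2\<bar> \<le> e * (norm w)\<^sup>2" if w: "norm w < d" for w
  proof -
    define p where "p s = f (c + s *\<^sub>R w) - s\<^sup>2 * (w \<bullet> H w / 2)" for s
    have "((\<lambda>s. f (c + s *\<^sub>R w)) has_real_derivative (g (c + s *\<^sub>R w) \<bullet> w)) (at s)" for s
    proof -
      have "((\<lambda>s. f (c + s *\<^sub>R w)) has_derivative (\<lambda>h. g (c + s *\<^sub>R w) \<bullet> (h *\<^sub>R w))) (at s)"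
        by (rule has_derivative_compose[OF _ f]) (auto intro!: derivative_eq_intros)
      then show ?thesis by (simp add: has_field_derivative_def mult.commute[of _ "_ \<bullet> _"])
    qed
    moreover have "((\<lambda>s. s\<^sup>2 * (w \<bullet> H w / 2)) has_real_derivative s * (w \<bullet> H w)) (at s)" for s
      by (auto intro!: derivative_eq_intros)
    ultimately have "(p has_real_derivative (g (c + s *\<^sub>R w) \<bullet> w - s * (w \<bullet> H w))) (at s)" for s
      unfolding p_def[abs_def] by (rule DERIV_diff)
    then obtain s where s: "0 < s" "s < 1" and mvt: "p 1 - p 0 = (1 - 0) * (g (c + s *\<^sub>R w) \<bullet> w - s * (w \<bullet> H w))"
      using MVT2[OF zero_less_one, of p "\<lambda>s. g (c + s *\<^sub>R w) \<bullet> w - s * (w \<bullet> H w)"] by blast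
    have sw: "norm (s *\<^sub>R w) \<le> norm w" using s by (simp add: mult_left_le_one_le)
    have "f (c + w) - f c - w \<bullet> H w / 2 = (g (c + s *\<^sub>R w) - g c - H (s *\<^sub>R w)) \<bullet> w"
      using mvt linH by (simp add: p_def crit linear_cmul inner_diff_left inner_diff_right inner_commute)
    also have "\<bar>\<dots>\<bar> \<le> norm (g (c + s *\<^sub>R w) - g c - H (s *\<^sub>R w)) * norm w"
      by (rule Cauchy_Schwarz_ineq2)
    also have "\<dots> \<le> (e * norm (s *\<^sub>R w)) * norm w"
      using d(2)[of "c + s *\<^sub>R w"] sw w by (intro mult_right_mono) auto
    also have "\<dots> \<le> (e * norm w) * norm w"
      using sw e by (intro mult_right_mono mult_left_mono) auto
    finally show ?thesis by (simp add: power2_eq_square mult.assoc)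
  qed
  then show ?thesis using d(1) by blast
qed

lemma gradient_zero_at_minimum:
  fixes f :: "'a::euclidean_space \<Rightarrow> real"
  assumes "(f has_derivative (\<lambda>v. g \<bullet> v)) (at c)" and "\<And>y. f c \<le> f y"
  shows "g = 0"
proof -
  have "(\<forall>y\<in>UNIV. f y \<le> f c) \<or> (\<forall>y\<in>UNIV. f c \<le> f y)"
    using assms(2) by blast
  from differential_zero_maxmin[OF UNIV_I open_UNIV assms(1) this]
  have "g \<bullet> g = 0" by (rule fun_cong)
  then show ?thesis by simp
qed

text \<open>A substitute for the gradient flow: a minimiser of \<open>sqrt (f - f c) + a \<bar>x - x\<^sub>0\<bar>\<close> different
  from \<open>c\<close> would be a point where \<open>sqrt (f - f c)\<close> has slope at most \<open>a\<close>.\<close>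

lemma PL_quadratic_growth:
  fixes f :: "'a::euclidean_space \<Rightarrow> real"
  assumes f: "\<And>x. (f has_derivative (\<lambda>v. g x \<bullet> v)) (at x)"
    and min: "\<And>y. f c \<le> f y" and uniq: "\<And>x. (\<And>y. f x \<le> f y) \<Longrightarrow> x = c"
    and C: "C > 0" and PL: "\<And>x. f x - f c \<le> C / 2 * (norm (g x))\<^sup>2"
  shows "(norm (x - c))\<^sup>2 / (4 * C) \<le> f x - f c"
proof (rule ccontr)
  assume contra: "\<not> ?thesis"
  \<comment> \<open>By PL the gradient of sqrt(f - f c) has norm at least 1 / sqrt(2 C) wherever f
    exceeds its minimum. The slope \<open>a\<close> is strictly smaller, and this gap is the final
    contradiction.\<close>
  define a where "a = 1 / (2 * sqrt C)"
  define s where "s y = sqrt (f y - f c)" for y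
  have a: "a > 0" "a\<^sup>2 = 1 / (4 * C)" using C by (auto simp: a_def power_divide power_mult_distrib)
  have s_nn: "s y \<ge> 0" for y using min by (simp add: s_def)
  have s_sq: "(s y)\<^sup>2 = f y - f c" for y using min by (simp add: s_def)
  have s0: "s x < a * norm (x - c)"
  proof (rule power2_less_imp_less)
    show "(s x)\<^sup>2 < (a * norm (x - c))\<^sup>2"
      using contra a by (simp add: s_sq power_mult_distrib)
  qed (use a in auto)
  have contf: "continuous_on UNIV f"
    using f has_derivative_continuous by (blast intro: continuous_at_imp_continuous_on)
  have conts: "continuous_on S s" for S
    unfolding s_def by (intro continuous_intros continuous_on_subset[OF contf]) auto
  \<comment> \<open>Beyond this radius the penalty alone exceeds the value \<open>s x\<close> at the
    centre, so a minimiser over the compact ball is a global one.\<close>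
  define r where "r = s x / a"
  have r: "r \<ge> 0" using s_nn[of x] a by (simp add: r_def)
  have "\<exists>z\<in>cball x r. \<forall>y\<in>cball x r. s z + a * norm (z - x) \<le> s y + a * norm (y - x)"
    by (rule continuous_attains_inf) (use r in \<open>auto intro!: continuous_intros conts\<close>)
  then obtain z where z: "z \<in> cball x r" "\<And>y. y \<in> cball x r \<Longrightarrow> s z + a * norm (z - x) \<le> s y + a * norm (y - x)"
    by blast
  have zx: "s z + a * norm (z - x) \<le> s x"
    using z(2)[of x] r by simp
  have glob: "s z + a * norm (z - x) \<le> s y + a * norm (y - x)" for y
  proof (cases "y \<in> cball x r")
    case False
    then have "s x < a * norm (y - x)" using a by (simp add: r_def dist_norm norm_minus_commute field_simps)
    then show ?thesis using zx s_nn[of y] by linarith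
  qed (rule z(2))
  have "z \<noteq> c"
  proof
    assume "z = c"
    then show False using zx s0 s_nn[of z] by (simp add: norm_minus_commute)
  qed
  \<comment> \<open>Uniqueness enters here: since \<open>z\<close> is not \<open>c\<close>, it is no
    global minimiser, so \<open>f z\<close> exceeds \<open>f c\<close> and the square root is
    differentiable at \<open>z\<close>.\<close>
  then obtain y where "f y < f z" using uniq[of z] by (meson not_le)
  then have fz: "f z - f c > 0" using min[of y] by linarith
  then have sz: "s z > 0" by (simp add: s_def)
  \<comment> \<open>Steepest descent from \<open>z\<close>. The penalty is replaced by its upper
    bound from the triangle inequality, which is linear in \<open>h\<close>, so a negative
    derivative at 0 would contradict the minimality of \<open>z\<close>.\<close>
  define v where "v = - g z"
  have "((\<lambda>h. s (z + h *\<^sub>R v) + a * h * norm v) has_real_derivative (g z \<bullet> v / (2 * s z) + a * norm v)) (at 0)"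
  proof -
    have "((\<lambda>h. f (z + h *\<^sub>R v)) has_derivative (\<lambda>h. g z \<bullet> (h *\<^sub>R v))) (at 0)"
      by (rule has_derivative_compose[of _ _ _ _ f "\<lambda>w. g z \<bullet> w"]) (use f in \<open>auto intro!: derivative_eq_intros\<close>)
    then have "((\<lambda>h. f (z + h *\<^sub>R v)) has_real_derivative g z \<bullet> v) (at 0)"
      by (simp add: has_field_derivative_def mult.commute[of _ "_ \<bullet> _"])
    then show ?thesis
      unfolding s_def using fz by (auto intro!: derivative_eq_intros simp: field_simps)
  qed
  then have "0 \<le> g z \<bullet> v / (2 * s z) + a * norm v"
  proof (rule contrapos_pp)
    assume neg: "\<not> 0 \<le> g z \<bullet> v / (2 * s z) + a * norm v"
    show "\<not> ((\<lambda>h. s (z + h *\<^sub>R v) + a * h * norm v) has_real_derivative (g z \<bullet> v / (2 * s z) + a * norm v)) (at 0)"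
    proof
      assume "((\<lambda>h. s (z + h *\<^sub>R v) + a * h * norm v) has_real_derivative (g z \<bullet> v / (2 * s z) + a * norm v)) (at 0)"
      from DERIV_neg_dec_right[OF this] neg obtain d where
        d: "d > 0" "\<And>h. h > 0 \<Longrightarrow> h < d \<Longrightarrow> s (z + (0 + h) *\<^sub>R v) + a * (0 + h) * norm v < s (z + 0 *\<^sub>R v) + a * 0 * norm v"
        by (metis not_le)
      define h where "h = d / 2"
      have h: "0 < h" "h < d" using d(1) by (auto simp: h_def)
      have "s (z + h *\<^sub>R v) + a * h * norm v < s z" using d(2)[OF h] by simp
      moreover have "norm (z + h *\<^sub>R v - x) \<le> norm (z - x) + h * norm v"
        using norm_triangle_ineq[of "z - x" "h *\<^sub>R v"] h by (simp add: algebra_simps)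
      then have "a * norm (z + h *\<^sub>R v - x) \<le> a * norm (z - x) + a * h * norm v"
        using a mult_left_mono[of _ _ a] by (fastforce simp: algebra_simps)
      ultimately show False using glob[of "z + h *\<^sub>R v"] by linarith
    qed
  qed
  then have "(norm (g z))\<^sup>2 \<le> 2 * a * s z * norm (g z)"
    using sz by (simp add: v_def power2_norm_eq_inner field_simps)
  then have "norm (g z) * norm (g z) \<le> 2 * a * s z * norm (g z)" by (simp add: power2_eq_square)
  then have "norm (g z) \<le> 2 * a * s z"
    by (cases "norm (g z) = 0") (use a sz in auto)
  then have "(norm (g z))\<^sup>2 \<le> (2 * a * s z)\<^sup>2" by (intro power_mono) auto
  also have "\<dots> = (s z)\<^sup>2 / C" using a C by (simp add: power_mult_distrib)
  finally have "C / 2 * (norm (g z))\<^sup>2 \<le> C / 2 * ((s z)\<^sup>2 / C)"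
    using C by (intro mult_left_mono) auto
  then have "(s z)\<^sup>2 \<le> (s z)\<^sup>2 / 2" using PL[of z] C by (simp add: s_sq)
  then show False using sz by simp
qed

text \<open>The minimum of the Rayleigh quotient over the unit sphere is an eigenvalue and lies
  below all others. For \<open>Min\<close> to select it the set of eigenvalues must be finite:
  eigenvectors for distinct eigenvalues are orthogonal, hence independent.\<close>

lemma lambda_min_symmetric:
  fixes A :: "real ^ 'n ^ 'n"
  assumes sym: "\<And>x y. (A *v x) \<bullet> y = x \<bullet> (A *v y)"
  shows "\<exists>v. v \<noteq> 0 \<and> A *v v = lambda_min A *\<^sub>R v"
    and "lambda_min A * (norm x)\<^sup>2 \<le> x \<bullet> (A *v x)"
proof -
  let ?E = "{c. \<exists>v. v \<noteq> 0 \<and> A *v v = c *\<^sub>R v}"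
  have "\<exists>u\<in>sphere (0::real^'n) 1. \<forall>y\<in>sphere 0 1. u \<bullet> (A *v u) \<le> y \<bullet> (A *v y)"
    by (rule continuous_attains_inf)
       (auto intro!: continuous_intros matrix_vector_mult_linear_continuous_on)
  then obtain u where u: "norm u = 1" "\<And>y. norm y = 1 \<Longrightarrow> u \<bullet> (A *v u) \<le> y \<bullet> (A *v y)" by auto
  define l where "l = u \<bullet> (A *v u)"
  have lower: "l * (norm x)\<^sup>2 \<le> x \<bullet> (A *v x)" for x
  proof (cases "x = 0")
    case False
    have "l \<le> (x /\<^sub>R norm x) \<bullet> (A *v (x /\<^sub>R norm x))"
      unfolding l_def by (rule u(2)) (use False in simp)
    also have "\<dots> = (x \<bullet> (A *v x)) / (norm x)\<^sup>2"
      by (simp add: matrix_vector_mult_scaleR power2_eq_square field_simps)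
    finally show ?thesis using False by (simp add: field_simps)
  qed simp
  \<comment> \<open>First variation at the minimiser: the form minus \<open>l\<close> times the
    squared norm is nonnegative and vanishes at \<open>u\<close>, so its linear term in any
    direction \<open>w\<close> must vanish.\<close>
  have orth: "w \<bullet> (A *v u - l *\<^sub>R u) = 0" for w
  proof (rule ccontr)
    assume neq: "w \<bullet> (A *v u - l *\<^sub>R u) \<noteq> 0"
    define p where "p = w \<bullet> (A *v u - l *\<^sub>R u)"
    define q where "q = w \<bullet> (A *v w) - l * (norm w)\<^sup>2"
    have q: "q \<ge> 0" using lower[of w] by (simp add: q_def)
    have quad: "0 \<le> 2 * s * p + s\<^sup>2 * q" for s
    proof -
      have "(u + s *\<^sub>R w) \<bullet> (A *v (u + s *\<^sub>R w)) - l * (norm (u + s *\<^sub>R w))\<^sup>2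
        = (u \<bullet> (A *v u) - l * (u \<bullet> u)) + 2 * s * p + s\<^sup>2 * q"
      proof -
        have "A *v (u + s *\<^sub>R w) = A *v u + s *\<^sub>R (A *v w)"
          by (simp add: matrix_vector_right_distrib matrix_vector_mult_scaleR)
        moreover have "u \<bullet> (A *v w) = w \<bullet> (A *v u)" using sym[of u w] by (simp add: inner_commute)
        moreover have "u \<bullet> w = w \<bullet> u" by (rule inner_commute)
        ultimately show ?thesis
          unfolding p_def q_def power2_norm_eq_inner
          by (simp only: inner_add_left inner_add_right inner_diff_right inner_scaleR_left inner_scaleR_right)
             (simp only: power2_eq_square algebra_simps)
      qed
      moreover have "u \<bullet> u = 1" using u(1) by (simp flip: power2_norm_eq_inner)
      ultimately show ?thesis using lower[of "u + s *\<^sub>R w"] by (simp add: l_def)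
    qed
    \<comment> \<open>Nearly the minimiser of the quadratic polynomial; the added 1 covers the case
      that \<open>q\<close> is 0, and the value is still negative when \<open>p\<close> is not
      0.\<close>
    define s where "s = - p / (q + 1)"
    have "2 * s * p + s\<^sup>2 * q = - (p\<^sup>2 * (q + 2)) / (q + 1)\<^sup>2"
      using q by (simp add: s_def power2_eq_square divide_simps) (simp add: algebra_simps)
    moreover have "p\<^sup>2 * (q + 2) / (q + 1)\<^sup>2 > 0"
      using q neq by (intro divide_pos_pos mult_pos_pos) (auto simp: p_def)
    ultimately show False using quad[of s] by simp
  qed
  have eig: "A *v u = l *\<^sub>R u"
    using orth[of "A *v u - l *\<^sub>R u"] by simp
  have "finite ?E"
  proof (rule ccontr)
    assume inf: "infinite ?E"
    have "\<forall>c\<in>?E. \<exists>v. v \<noteq> 0 \<and> A *v v = c *\<^sub>R v" by blast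
    from bchoice[OF this] obtain V where V: "\<And>c. c \<in> ?E \<Longrightarrow> V c \<noteq> 0 \<and> A *v V c = c *\<^sub>R V c"
      by blast
    have ortho: "V c \<bullet> V c' = 0" if "c \<in> ?E" "c' \<in> ?E" "c \<noteq> c'" for c c'
      using sym[of "V c" "V c'"] V[OF that(1)] V[OF that(2)] that(3) by simp
    have inj: "inj_on V ?E"
    proof (rule inj_onI)
      fix c c' assume c: "c \<in> ?E" and c': "c' \<in> ?E" and eq: "V c = V c'"
      have "c *\<^sub>R V c' = A *v V c'" using V[OF c] unfolding eq by metis
      also have "\<dots> = c' *\<^sub>R V c'" using V[OF c'] by blast
      finally show "c = c'" using V[OF c'] scaleR_right_imp_eq by blast
    qed
    have "independent (V ` ?E)"
    proof (rule pairwise_orthogonal_independent)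
      show "pairwise orthogonal (V ` ?E)"
        unfolding pairwise_def orthogonal_def using ortho by blast
      show "0 \<notin> V ` ?E" using V by force
    qed
    then have "finite (V ` ?E)" using independent_bound by blast
    then show False using inf inj finite_imageD by blast
  qed
  moreover have u0: "u \<noteq> 0" using u(1) by auto
  then have "l \<in> ?E" using eig by (intro CollectI exI[of _ u] conjI)
  moreover have "l \<le> c" if c: "c \<in> ?E" for c
  proof -
    obtain v where v: "v \<noteq> 0" "A *v v = c *\<^sub>R v" using c by blast
    have "l * (norm v)\<^sup>2 \<le> c * (norm v)\<^sup>2"
      using lower[of v] unfolding v(2) by (simp add: power2_norm_eq_inner)
    then show ?thesis using v by simp
  qed
  ultimately have l: "lambda_min A = l" unfolding lambda_min_def by (intro Min_eqI)
  show "\<exists>v. v \<noteq> 0 \<and> A *v v = lambda_min A *\<^sub>R v"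
    unfolding l using eig u0 by blast
  show "lambda_min A * (norm x)\<^sup>2 \<le> x \<bullet> (A *v x)"
    unfolding l by (rule lower)
qed

section \<open>Rescaling around the minimiser\<close>

lemma lborel_integral_affine:
  fixes h :: "'a::euclidean_space \<Rightarrow> real"
  assumes "k \<noteq> 0" and "h \<in> borel_measurable borel"
  shows "(\<integral>x. h x \<partial>lborel) = \<bar>k\<bar> ^ DIM('a) * (\<integral>y. h (c + k *\<^sub>R y) \<partial>lborel)"
proof -
  have m: "(\<lambda>y::'a. c + k *\<^sub>R y) \<in> borel \<rightarrow>\<^sub>M borel"
    by (intro borel_measurable_continuous_onI continuous_intros)
  have "(\<integral>x. h x \<partial>lborel) = (\<integral>x. h x \<partial>density (distr lborel borel (\<lambda>y. c + k *\<^sub>R y)) (\<lambda>_. ennreal (\<bar>k\<bar> ^ DIM('a))))"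
    by (subst lborel_affine[OF assms(1), of c]) simp
  also have "\<dots> = (\<integral>x. \<bar>k\<bar> ^ DIM('a) *\<^sub>R h x \<partial>distr lborel borel (\<lambda>y. c + k *\<^sub>R y))"
    using assms(2) by (intro integral_density) auto
  also have "\<dots> = \<bar>k\<bar> ^ DIM('a) * (\<integral>x. h x \<partial>distr lborel borel (\<lambda>y. c + k *\<^sub>R y))"
    by simp
  also have "\<dots> = \<bar>k\<bar> ^ DIM('a) * (\<integral>y. h (c + k *\<^sub>R y) \<partial>lborel)"
    using m assms(2) by (subst integral_distr) auto
  finally show ?thesis .
qed

lemma lborel_integral_odd:
  fixes h :: "'a::euclidean_space \<Rightarrow> real"
  assumes "h \<in> borel_measurable borel" and "\<And>x. h (- x) = - h x"
  shows "(\<integral>x. h x \<partial>lborel) = 0"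
proof -
  have "(\<integral>x. h x \<partial>lborel) = (\<integral>y. h (- y) \<partial>lborel)"
    by (subst lborel_integral_affine[of "-1" h 0]) (use assms(1) in simp_all)
  also have "\<dots> = - (\<integral>x. h x \<partial>lborel)" by (simp add: assms(2))
  finally show ?thesis by simp
qed

text \<open>The facts that the rescaling argument consumes. Both \<open>growth\<close> and the
  positivity of the form at \<open>c\<close> are consequences of PL and uniqueness, and are
  established when the locale is instantiated in \<open>PL_min_gradient\<close>.\<close>

locale PL_min = pos_def_form "D2 c" lam
  for D2 :: "'a::euclidean_space \<Rightarrow> 'a \<Rightarrow> 'a" and c :: 'a and lam :: real +
  fixes f :: "'a \<Rightarrow> real" and g :: "'a \<Rightarrow> 'a" and C L :: real
  assumes f: "\<And>x. (f has_derivative (\<lambda>v. g x \<bullet> v)) (at x)"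
    and g: "\<And>x. (g has_derivative D2 x) (at x)"
    and D2_cont: "\<And>b. b \<in> Basis \<Longrightarrow> continuous_on UNIV (\<lambda>x. D2 x b \<bullet> b)"
    and crit: "g c = 0"
    and C: "C > 0" and PL: "\<And>x. f x - f c \<le> C / 2 * (norm (g x))\<^sup>2"
    and growth: "\<And>x. (norm (x - c))\<^sup>2 / (4 * C) \<le> f x - f c"
    and L: "L > 0" and lap: "\<And>x. (\<Sum>b\<in>Basis. D2 x b \<bullet> b) \<le> L * (1 + (norm (g x))\<^sup>2)"
begin

definition F :: "real \<Rightarrow> 'a \<Rightarrow> real" where "F t y = (f (c + sqrt t *\<^sub>R y) - f c) / t"

definition DF :: "real \<Rightarrow> 'a \<Rightarrow> 'a" where "DF t y = (1 / sqrt t) *\<^sub>R g (c + sqrt t *\<^sub>R y)"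

lemma F_deriv: "t > 0 \<Longrightarrow> (F t has_derivative (\<lambda>v. DF t y \<bullet> v)) (at y)"
proof -
  assume t: "t > 0"
  have "((\<lambda>y. c + sqrt t *\<^sub>R y) has_derivative (\<lambda>v. sqrt t *\<^sub>R v)) (at y)"
    by (auto intro!: derivative_eq_intros)
  from has_derivative_compose[OF this f]
  have "((\<lambda>y. f (c + sqrt t *\<^sub>R y)) has_derivative (\<lambda>v. g (c + sqrt t *\<^sub>R y) \<bullet> (sqrt t *\<^sub>R v))) (at y)" .
  then have "((\<lambda>y. (f (c + sqrt t *\<^sub>R y) - f c) * (1 / t)) has_derivative
      (\<lambda>v. (g (c + sqrt t *\<^sub>R y) \<bullet> (sqrt t *\<^sub>R v)) * (1 / t))) (at y)"
    by (intro has_derivative_mult_left) (auto intro!: derivative_eq_intros)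
  moreover have "(g (c + sqrt t *\<^sub>R y) \<bullet> (sqrt t *\<^sub>R v)) * (1 / t) = DF t y \<bullet> v" for v
  proof -
    have "(g (c + sqrt t *\<^sub>R y) \<bullet> (sqrt t *\<^sub>R v)) * (1 / t) = (sqrt t * (1 / t)) * (g (c + sqrt t *\<^sub>R y) \<bullet> v)"
      by simp
    also have "sqrt t * (1 / t) = 1 / sqrt t" using t by (simp add: field_simps)
    finally show ?thesis by (simp add: DF_def)
  qed
  ultimately show ?thesis by (simp add: F_def[abs_def])
qed

text \<open>The chain rule gives a factor \<open>sqrt t\<close> that cancels the one in
  \<open>DF\<close>: second derivatives of \<open>F t\<close> are those of \<open>f\<close>, without
  any power of t.\<close>

lemma DF_deriv: "t > 0 \<Longrightarrow> (DF t has_derivative D2 (c + sqrt t *\<^sub>R y)) (at y)"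
proof -
  assume t: "t > 0"
  have "((\<lambda>y. c + sqrt t *\<^sub>R y) has_derivative (\<lambda>v. sqrt t *\<^sub>R v)) (at y)"
    by (auto intro!: derivative_eq_intros)
  from has_derivative_scaleR_right[OF has_derivative_compose[OF this g], of "1 / sqrt t"]
  have "(DF t has_derivative (\<lambda>v. (1 / sqrt t) *\<^sub>R D2 (c + sqrt t *\<^sub>R y) (sqrt t *\<^sub>R v))) (at y)"
    by (simp add: DF_def[abs_def])
  moreover have "(1 / sqrt t) *\<^sub>R D2 (c + sqrt t *\<^sub>R y) (sqrt t *\<^sub>R v) = D2 (c + sqrt t *\<^sub>R y) v" for v
    using has_derivative_linear[OF g[of "c + sqrt t *\<^sub>R y"]] t by (simp add: linear_cmul)
  ultimately show ?thesis by simp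
qed

lemma D2F_cont: "b \<in> Basis \<Longrightarrow> continuous_on UNIV (\<lambda>y. D2 (c + sqrt t *\<^sub>R y) b \<bullet> b)"
  by (rule continuous_on_compose2[OF D2_cont[of b], of UNIV "\<lambda>y. c + sqrt t *\<^sub>R y"])
     (auto intro!: continuous_intros)

lemma F_cont: "t > 0 \<Longrightarrow> continuous_on UNIV (F t)"
  using has_derivative_continuous[OF F_deriv] by (intro continuous_at_imp_continuous_on) simp

text \<open>Quadratic growth is invariant under the rescaling, so a single Gaussian dominates
  \<open>exp (- F t y)\<close> for all t.\<close>

lemma F_growth: "t > 0 \<Longrightarrow> (norm y)\<^sup>2 / (4 * C) \<le> F t y"
proof -
  assume t: "t > 0"
  have "(norm y)\<^sup>2 / (4 * C) = ((norm (c + sqrt t *\<^sub>R y - c))\<^sup>2 / (4 * C)) / t"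
    using t by (simp add: power_mult_distrib)
  also have "\<dots> \<le> F t y"
    unfolding F_def by (rule divide_right_mono[OF growth]) (use t in simp)
  finally show ?thesis .
qed

text \<open>PL bounds the squared gradient below by 2/C times \<open>F t y\<close>, and
  \<open>F_growth\<close> supplies the remaining 1/(4 C).\<close>

lemma DF_growth: "t > 0 \<Longrightarrow> (norm y)\<^sup>2 / (2 * C\<^sup>2) \<le> (norm (DF t y))\<^sup>2"
proof -
  assume t: "t > 0"
  have "(norm y)\<^sup>2 / (2 * C\<^sup>2) = 2 / C * ((norm y)\<^sup>2 / (4 * C))"
    using C by (simp add: power2_eq_square)
  also have "\<dots> \<le> 2 / C * F t y" using C F_growth[OF t] by (intro mult_left_mono) auto
  also have "\<dots> \<le> 2 / C * (C / 2 * (norm (g (c + sqrt t *\<^sub>R y)))\<^sup>2 / t)"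
    unfolding F_def using C t PL by (intro mult_left_mono divide_right_mono) auto
  also have "\<dots> = (norm (DF t y))\<^sup>2"
    using C t by (simp add: DF_def power_divide)
  finally show ?thesis .
qed

text \<open>The squared gradient of \<open>f\<close> is t times that of \<open>F t\<close>, so for
  these t the Laplacian is at most L plus a quarter of the squared gradient of \<open>F t\<close>.
  Half of this leaves an eighth of the squared gradient, to which \<open>DF_growth\<close>
  applies.\<close>

lemma witten_potential_growth:
  assumes t: "t > 0" "t \<le> 1 / (4 * L)"
  shows "(norm y)\<^sup>2 / (16 * C\<^sup>2) - L / 2 \<le> (norm (DF t y))\<^sup>2 / 4 - (\<Sum>b\<in>Basis. D2 (c + sqrt t *\<^sub>R y) b \<bullet> b) / 2"
proof -
  have gD: "(norm (g (c + sqrt t *\<^sub>R y)))\<^sup>2 = t * (norm (DF t y))\<^sup>2"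
    using t by (simp add: DF_def power_divide)
  have "L * t \<le> 1 / 4" using t(2) L by (simp add: field_simps)
  then have "L * t * (norm (DF t y))\<^sup>2 \<le> 1 / 4 * (norm (DF t y))\<^sup>2" by (intro mult_right_mono) auto
  then have "(\<Sum>b\<in>Basis. D2 (c + sqrt t *\<^sub>R y) b \<bullet> b) \<le> L + (norm (DF t y))\<^sup>2 / 4"
    using lap[of "c + sqrt t *\<^sub>R y"] unfolding gD by (simp add: algebra_simps)
  then show ?thesis using DF_growth[OF t(1), of y] by simp
qed

lemma exp_F_le: "t > 0 \<Longrightarrow> exp (- F t y) \<le> exp (- (1 / (4 * C)) * (norm y)\<^sup>2)"
  using F_growth[of t y] by simp

lemma integrable_exp_F: "t > 0 \<Longrightarrow> integrable lborel (\<lambda>y. exp (- F t y))"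
proof (rule Bochner_Integration.integrable_bound[OF integrable_exp_neg_norm_sq[of "1 / (4 * C)"]])
  assume t: "t > 0"
  show "AE y in lborel. norm (exp (- F t y)) \<le> norm (exp (- (1 / (4 * C)) * (norm y)\<^sup>2))"
    using exp_F_le[OF t] by simp
  show "(\<lambda>y. exp (- F t y)) \<in> borel_measurable lborel"
    by (simp, intro borel_measurable_continuous_onI continuous_intros F_cont t)
qed (use C in simp)

lemma integral_exp_F_pos: "t > 0 \<Longrightarrow> 0 < (\<integral>y. exp (- F t y) \<partial>lborel)"
  by (rule integral_pos_continuous[where c=0]) (auto intro!: continuous_intros F_cont integrable_exp_F)

text \<open>A ball of radius r corresponds to radius \<open>sqrt t\<close> times r around
  \<open>c\<close>, where the Taylor error is a small multiple of the squared distance; dividing by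
  t turns it into \<open>e\<close> times the squared norm of \<open>y\<close>. Closeness of values
  is what the comparison of densities uses.\<close>

lemma F_near_Q:
  assumes "d > 0"
  shows "\<forall>\<^sub>F t in at_right 0. \<forall>y. norm y \<le> r \<longrightarrow> \<bar>F t y - Q y\<bar> \<le> d"
proof -
  define e where "e = d / (r\<^sup>2 + 1)"
  have r1: "r\<^sup>2 + 1 > 0" by (simp add: add_nonneg_pos)
  then have e: "e > 0" using assms by (simp add: e_def)
  obtain q where q: "q > 0" "\<And>w. norm w < q \<Longrightarrow> \<bar>f (c + w) - f c - w \<bullet> D2 c w / 2\<bar> \<le> e * (norm w)\<^sup>2"
    using second_order_taylor[OF f g crit e] by blast
  have near: "\<bar>F t y - Q y\<bar> \<le> d" if t: "0 < t" "t < (q / (\<bar>r\<bar> + 1))\<^sup>2" and y: "norm y \<le> r" for t y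
  proof -
    have "sqrt t < q / (\<bar>r\<bar> + 1)"
      using t q(1) real_sqrt_less_mono[OF t(2)] by (simp add: real_sqrt_abs)
    then have "sqrt t * (\<bar>r\<bar> + 1) < q" by (simp add: pos_less_divide_eq)
    moreover have "sqrt t * norm y \<le> sqrt t * (\<bar>r\<bar> + 1)" using t y by (intro mult_left_mono) auto
    moreover have "norm (sqrt t *\<^sub>R y) = sqrt t * norm y" using t by simp
    ultimately have "norm (sqrt t *\<^sub>R y) < q" by linarith
    moreover have "(sqrt t *\<^sub>R y) \<bullet> D2 c (sqrt t *\<^sub>R y) / 2 = t * Q y"
      using t linear_H by (simp add: linear_cmul Q_def flip: mult.assoc)
    ultimately have "\<bar>f (c + sqrt t *\<^sub>R y) - f c - t * Q y\<bar> \<le> e * (t * (norm y)\<^sup>2)"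
      using q(2)[of "sqrt t *\<^sub>R y"] t by (simp add: power_mult_distrib)
    moreover have "f (c + sqrt t *\<^sub>R y) - f c - t * Q y = t * (F t y - Q y)"
    proof -
      have "t * F t y = f (c + sqrt t *\<^sub>R y) - f c" using t by (simp add: F_def)
      then show ?thesis by (simp only: right_diff_distrib)
    qed
    ultimately have "t * \<bar>F t y - Q y\<bar> \<le> t * (e * (norm y)\<^sup>2)"
      using t by (simp add: abs_mult mult_ac)
    then have "\<bar>F t y - Q y\<bar> \<le> e * (norm y)\<^sup>2" using t by simp
    also have "\<dots> \<le> e * (r\<^sup>2 + 1)"
      using power_mono[OF y, of 2] e by (intro mult_left_mono) auto
    also have "\<dots> = d" using r1 by (simp add: e_def)
    finally show ?thesis .
  qed
  have "(q / (\<bar>r\<bar> + 1))\<^sup>2 > 0" using q(1) by simp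
  then show ?thesis
    unfolding eventually_at_right_field using near by blast
qed

text \<open>Dominated convergence, with the Gaussian of \<open>exp_F_le\<close> as a bound
  independent of t.\<close>

lemma tendsto_integral_F:
  fixes p :: "'a \<Rightarrow> real"
  assumes cont: "continuous_on UNIV p" and bd: "\<And>y. \<bar>p y\<bar> \<le> M"
  shows "((\<lambda>t. \<integral>y. p y * exp (- F t y) \<partial>lborel) \<longlongrightarrow> (\<integral>y. p y * exp (- Q y) \<partial>lborel)) (at_right 0)"
  unfolding tendsto_at_iff_sequentially
proof (intro allI impI)
  fix X :: "nat \<Rightarrow> real"
  assume X: "\<forall>i. X i \<in> {0<..} - {0}" and lim: "X \<longlonglongrightarrow> 0"
  have pos: "X i > 0" for i using X by auto
  have filt: "filterlim X (at_right 0) sequentially"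
    using lim pos less_imp_neq[OF pos, symmetric] by (simp add: filterlim_at)
  have "(\<lambda>i. \<integral>y. p y * exp (- F (X i) y) \<partial>lborel) \<longlonglongrightarrow> (\<integral>y. p y * exp (- Q y) \<partial>lborel)"
  proof (rule integral_dominated_convergence[where w="\<lambda>y. M * exp (- (1 / (4 * C)) * (norm y)\<^sup>2)"])
    show "(\<lambda>y. p y * exp (- Q y)) \<in> borel_measurable lborel"
      by (simp, intro borel_measurable_continuous_onI continuous_intros cont)
    show "(\<lambda>y. p y * exp (- F (X i) y)) \<in> borel_measurable lborel" for i
      by (simp, intro borel_measurable_continuous_onI continuous_intros cont F_cont pos)
    show "integrable lborel (\<lambda>y::'a. M * exp (- (1 / (4 * C)) * (norm y)\<^sup>2))"
      using C by (intro integrable_mult_right integrable_exp_neg_norm_sq) simp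
    have "((\<lambda>t. F t y) \<longlongrightarrow> Q y) (at_right 0)" for y
    proof (rule tendstoI)
      fix e :: real assume e: "e > 0"
      show "\<forall>\<^sub>F t in at_right 0. dist (F t y) (Q y) < e"
        using F_near_Q[of "e / 2" "norm y"] e by (auto elim!: eventually_mono simp: dist_real_def)
    qed
    then have "(\<lambda>i. F (X i) y) \<longlonglongrightarrow> Q y" for y
      using filterlim_compose filt by blast
    then show "AE y in lborel. (\<lambda>i. p y * exp (- F (X i) y)) \<longlonglongrightarrow> p y * exp (- Q y)"
      by (auto intro!: tendsto_intros)
    have "\<bar>p y\<bar> * exp (- F (X i) y) \<le> M * exp (- (1 / (4 * C)) * (norm y)\<^sup>2)" for i y
      using bd[of y] exp_F_le[OF pos] by (intro mult_mono) auto
    then show "AE y in lborel. norm (p y * exp (- F (X i) y)) \<le> M * exp (- (1 / (4 * C)) * (norm y)\<^sup>2)" for i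
      by (simp add: abs_mult)
  qed
  then show "((\<lambda>t. \<integral>y. p y * exp (- F t y) \<partial>lborel) \<circ> X) \<longlonglongrightarrow> (\<integral>y. p y * exp (- Q y) \<partial>lborel)"
    by (simp add: o_def)
qed

text \<open>The variance under the normalised density, multiplied by the total mass.
  \<open>Energy\<close> carries the same factor, so Poincare inequalities can be stated without
  normalising.\<close>

definition Var :: "real \<Rightarrow> ('a \<Rightarrow> real) \<Rightarrow> real" where
  "Var t h = (\<integral>y. (h y)\<^sup>2 * exp (- F t y) \<partial>lborel)
    - (\<integral>y. h y * exp (- F t y) \<partial>lborel)\<^sup>2 / (\<integral>y. exp (- F t y) \<partial>lborel)"

definition Energy :: "real \<Rightarrow> ('a \<Rightarrow> 'a) \<Rightarrow> real" where
  "Energy t Dh = (\<integral>y. (norm (Dh y))\<^sup>2 * exp (- F t y) \<partial>lborel)"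

lemma eventually_poincare:
  assumes eps: "eps > 0"
  shows "\<forall>\<^sub>F t in at_right 0. \<forall>h Dh r. (\<forall>x. (h has_derivative (\<lambda>v. Dh x \<bullet> v)) (at x)) \<longrightarrow>
    continuous_on UNIV Dh \<longrightarrow> (\<forall>x. norm x > r \<longrightarrow> h x = 0) \<longrightarrow>
    Var t h \<le> (1 / lam + eps) * Energy t Dh"
proof -
  define B where "B = 1 / lam + eps"
  \<comment> \<open>The allowance eps is halved: \<open>A\<close> takes one half for the comparison
    with the Gaussian, and \<open>k\<close>, chosen with \<open>A = B * (1 - k)\<close>, takes the
    other for the localisation error.\<close>
  define A where "A = 1 / lam + eps / 2"
  define k where "k = eps / 2 / B"
  have A: "A > 0" and B: "B > 0" using lam_pos eps by (auto simp: A_def B_def add_pos_pos)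
  have "eps / 2 < B" using eps lam_pos by (simp add: B_def add_pos_pos)
  moreover have "B * k = eps / 2" using B by (simp add: k_def)
  ultimately have k: "k > 0" "k < 1" "A = B * (1 - k)"
    using B eps by (simp_all add: k_def right_diff_distrib) (simp add: A_def B_def)
  \<comment> \<open>The first summand keeps the localisation error \<open>36 * A / R\<^sup>2\<close>
    below \<open>k\<close>; the second lifts the Witten potential above \<open>1 / A\<close> outside
    radius \<open>R\<close>.\<close>
  define R where "R = sqrt (36 * A / k + 16 * C\<^sup>2 * (1 / A + L / 2))"
  have Rsq: "R\<^sup>2 = 36 * A / k + 16 * C\<^sup>2 * (1 / A + L / 2)"
    using A k L by (simp add: R_def)
  have "36 * A / k > 0" "16 * C\<^sup>2 * (1 / A + L / 2) > 0" using A k C L by (auto intro!: mult_pos_pos add_pos_pos)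
  then have Rsq1: "R\<^sup>2 \<ge> 36 * A / k" and Rsq2: "R\<^sup>2 \<ge> 16 * C\<^sup>2 * (1 / A + L / 2)" and R: "R > 0"
    unfolding Rsq by (simp_all add: R_def)
  have k': "36 * A / R\<^sup>2 \<le> k" using Rsq1 k R by (simp add: field_simps)
  \<comment> \<open>The tolerance for which the comparison factor \<open>exp (2 * d)\<close> raises
    \<open>1 / lam\<close> to exactly \<open>A\<close>; it is positive because \<open>A\<close>
    exceeds \<open>1 / lam\<close>.\<close>
  define d where "d = ln (A * lam) / 2"
  have "A * lam > 1" using lam_pos eps by (simp add: A_def field_simps)
  then have d: "d > 0" "exp (2 * d) / lam = A" using lam_pos by (auto simp: d_def)
  have ev1: "\<forall>\<^sub>F t in at_right 0. t \<le> 1 / (4 * L)"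
    using L by (intro eventually_at_rightI[of 0 "1 / (4 * L)"]) auto
  have ev2: "\<forall>\<^sub>F t in at_right (0::real). t > 0" by (rule eventually_at_right_less)
  show ?thesis
    using ev1 ev2 F_near_Q[OF d(1), of "2 * R"]
  proof eventually_elim
    case (elim t)
    show ?case
    proof (intro allI impI)
      fix h Dh r
      assume h: "\<forall>x. (h has_derivative (\<lambda>v. Dh x \<bullet> v)) (at x)" and Dh: "continuous_on UNIV Dh"
        and supp: "\<forall>x::'a. norm x > r \<longrightarrow> h x = 0"
      have far: "1 / A \<le> (norm (DF t y))\<^sup>2 / 4 - (\<Sum>b\<in>Basis. D2 (c + sqrt t *\<^sub>R y) b \<bullet> b) / 2" if "norm y > R" for y
      proof -
        have "16 * C\<^sup>2 * (1 / A + L / 2) \<le> (norm y)\<^sup>2"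
          using Rsq2 power_mono[of R "norm y" 2] that R by linarith
        then have "1 / A + L / 2 \<le> (norm y)\<^sup>2 / (16 * C\<^sup>2)" using C by (simp add: pos_le_divide_eq mult.commute)
        then show ?thesis using witten_potential_growth[OF elim(2,1), of y] by linarith
      qed
      obtain m where m: "(1 - 36 * A / R\<^sup>2) * (\<integral>x. (h x - m)\<^sup>2 * exp (- F t x) \<partial>lborel)
          \<le> A * (\<integral>x. (norm (Dh x))\<^sup>2 * exp (- F t x) \<partial>lborel)"
        using perturbed_poincare[OF F_deriv DF_deriv D2F_cont integrable_exp_F, of t h Dh r R d "1 / A" A]
          elim h Dh supp R A d far by auto
      define I where "I = (\<integral>x. (h x - m)\<^sup>2 * exp (- F t x) \<partial>lborel)"
      have I0: "I \<ge> 0" unfolding I_def by (intro Bochner_Integration.integral_nonneg) auto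
      have "(1 - k) * I \<le> (1 - 36 * A / R\<^sup>2) * I"
        using k' I0 by (intro mult_right_mono) auto
      also have "\<dots> \<le> (1 - k) * (B * Energy t Dh)"
        using m k(3) by (simp add: I_def Energy_def mult_ac)
      finally have IB: "I \<le> B * Energy t Dh" using k(2) by simp
      have conth: "continuous_on UNIV h"
        using h has_derivative_continuous by (blast intro: continuous_at_imp_continuous_on)
      have "Var t h \<le> I"
        unfolding Var_def I_def
      proof (rule weighted_variance_le)
        show "integrable lborel (\<lambda>x. h x * exp (- F t x))" "integrable lborel (\<lambda>x. (h x)\<^sup>2 * exp (- F t x))"
          by (rule integrable_compact_support[where r=r],
              use supp in \<open>auto intro!: continuous_intros conth F_cont elim\<close>)+
      qed (use elim integrable_exp_F integral_exp_F_pos in auto)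
      then show "Var t h \<le> (1 / lam + eps) * Energy t Dh" using IB by (simp add: B_def)
    qed
  qed
qed

text \<open>For one fixed test function all integrals converge to their Gaussian values, so a strict
  inequality in the limit persists for small t. The mean is 0 only in the limit, where the squared
  mean drops out.\<close>

lemma eventually_test_function:
  assumes cont: "continuous_on UNIV phi" "continuous_on UNIV Dphi"
    and supp: "\<And>x. norm x > r \<Longrightarrow> phi x = 0" "\<And>x. norm x > r \<Longrightarrow> Dphi x = 0"
    and mean: "(\<integral>y. phi y * exp (- Q y) \<partial>lborel) = 0"
    and less: "B * (\<integral>y. (norm (Dphi y))\<^sup>2 * exp (- Q y) \<partial>lborel) < (\<integral>y. (phi y)\<^sup>2 * exp (- Q y) \<partial>lborel)"
  shows "\<forall>\<^sub>F t in at_right 0. B * Energy t Dphi < Var t phi"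
proof -
  have lim: "((\<lambda>t. \<integral>y. p y * exp (- F t y) \<partial>lborel) \<longlongrightarrow> (\<integral>y. p y * exp (- Q y) \<partial>lborel)) (at_right 0)"
    if p: "continuous_on UNIV p" "\<And>x. norm x > r \<Longrightarrow> p x = 0" for p :: "'a \<Rightarrow> real"
  proof -
    obtain M where "\<And>y. norm (p y) \<le> M"
      using continuous_on_compact_support_bounded[OF p] by blast
    then show ?thesis using tendsto_integral_F[OF p(1), of M] by auto
  qed
  have 1: "((\<lambda>t. Energy t Dphi) \<longlongrightarrow> (\<integral>y. (norm (Dphi y))\<^sup>2 * exp (- Q y) \<partial>lborel)) (at_right 0)"
    unfolding Energy_def by (rule lim) (auto intro!: continuous_intros cont simp: supp)
  have 2: "((\<lambda>t. \<integral>y. (phi y)\<^sup>2 * exp (- F t y) \<partial>lborel) \<longlongrightarrow> (\<integral>y. (phi y)\<^sup>2 * exp (- Q y) \<partial>lborel)) (at_right 0)"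
    by (rule lim) (auto intro!: continuous_intros cont simp: supp)
  have 3: "((\<lambda>t. \<integral>y. phi y * exp (- F t y) \<partial>lborel) \<longlongrightarrow> 0) (at_right 0)"
    using lim[of phi] cont supp mean by simp
  have 4: "((\<lambda>t. \<integral>y. exp (- F t y) \<partial>lborel) \<longlongrightarrow> (\<integral>y. exp (- Q y) \<partial>lborel)) (at_right 0)"
    using tendsto_integral_F[of "\<lambda>_. 1" 1] by simp
  have "((\<lambda>t. Var t phi - B * Energy t Dphi) \<longlongrightarrow>
     (\<integral>y. (phi y)\<^sup>2 * exp (- Q y) \<partial>lborel) - 0\<^sup>2 / (\<integral>y. exp (- Q y) \<partial>lborel)
       - B * (\<integral>y. (norm (Dphi y))\<^sup>2 * exp (- Q y) \<partial>lborel)) (at_right 0)"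
    unfolding Var_def using Z_pos by (intro tendsto_intros 1 2 3 4) auto
  from order_tendstoD(1)[OF this, of 0] less
  show ?thesis by (auto elim!: eventually_mono)
qed

end

section \<open>Near-extremal functions for the Gaussian\<close>

lemma bounded_if_zero_beyond_1:
  fixes p :: "real \<Rightarrow> real"
  assumes "continuous_on UNIV p" and "\<And>s. s \<ge> 1 \<Longrightarrow> p s = 0"
  obtains M where "M \<ge> 0" "\<And>s. s \<ge> 0 \<Longrightarrow> \<bar>p s\<bar> \<le> M"
proof -
  have "compact (p ` {0..1})"
    using assms(1) by (intro compact_continuous_image) (auto intro: continuous_on_subset)
  then obtain M where M: "\<forall>x\<in>p ` {0..1}. norm x \<le> M"
    using compact_imp_bounded bounded_iff by metis
  have "\<bar>p s\<bar> \<le> \<bar>M\<bar>" if "s \<ge> 0" for s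
  proof (cases "s \<le> 1")
    case True
    then have "norm (p s) \<le> M" using M that by simp
    then show ?thesis by simp
  next
    case False
    then show ?thesis using assms(2)[of s] by simp
  qed
  then show ?thesis using that[of "\<bar>M\<bar>"] by simp
qed

context pos_def_form
begin

lemma integrable_poly_Q:
  fixes p :: "'a \<Rightarrow> real"
  assumes cont: "continuous_on UNIV p" and bd: "\<And>z. \<bar>p z\<bar> \<le> M * (1 + (norm z)\<^sup>2)"
  shows "integrable lborel (\<lambda>z. p z * exp (- Q z))"
proof (rule integrable_gauss_bound[of "lam / 2" _ M])
  show "\<bar>p z * exp (- Q z)\<bar> \<le> M * (1 + (norm z)\<^sup>2) * exp (- (lam / 2) * (norm z)\<^sup>2)" for z
  proof -
    have "\<bar>p z\<bar> * exp (- Q z) \<le> (M * (1 + (norm z)\<^sup>2)) * exp (- (lam / 2) * (norm z)\<^sup>2)"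
      using bd[of z] Q_ge[of z] by (intro mult_mono) (auto intro: order_trans)
    then show ?thesis by (simp add: abs_mult)
  qed
qed (use lam_pos in \<open>auto intro!: borel_measurable_continuous_onI continuous_intros cont\<close>)

text \<open>Truncations of the linear function in the direction of an eigenvector for \<open>\<lambda>\<close> are almost
  extremal for the Gaussian Poincare inequality.\<close>

lemma truncated_linear_almost_extremal:
  fixes psi psi' :: "real \<Rightarrow> real"
  assumes psi: "\<And>s. (psi has_real_derivative psi' s) (at s)" and psi': "continuous_on UNIV psi'"
    and psi0: "psi 0 = 1" and psi_supp: "\<forall>s\<ge>1. psi s = 0 \<and> psi' s = 0"
    and v: "v \<noteq> 0" "H v = lam *\<^sub>R v" and B: "B < 1 / lam"
  defines "phi \<equiv> \<lambda>(R::real) y. (v \<bullet> y) * psi ((norm y)\<^sup>2 / R\<^sup>2)"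
    and "Dphi \<equiv> \<lambda>(R::real) y. psi ((norm y)\<^sup>2 / R\<^sup>2) *\<^sub>R v + ((v \<bullet> y) * psi' ((norm y)\<^sup>2 / R\<^sup>2) * (2 / R\<^sup>2)) *\<^sub>R y"
  shows "\<exists>R>0. B * (\<integral>y. (norm (Dphi R y))\<^sup>2 * exp (- Q y) \<partial>lborel) < (\<integral>y. (phi R y)\<^sup>2 * exp (- Q y) \<partial>lborel)"
    and "R > 0 \<Longrightarrow> (phi R has_derivative (\<lambda>w. Dphi R y \<bullet> w)) (at y)"
    and "R > 0 \<Longrightarrow> continuous_on UNIV (Dphi R)"
    and "R > 0 \<Longrightarrow> norm y > R \<Longrightarrow> phi R y = 0"
    and "R > 0 \<Longrightarrow> norm y > R \<Longrightarrow> Dphi R y = 0"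
    and "R > 0 \<Longrightarrow> (\<integral>y. phi R y * exp (- Q y) \<partial>lborel) = 0"
proof -
  have psi1: "psi s = 0" "psi' s = 0" if "s \<ge> 1" for s using psi_supp that by auto
  have contpsi: "continuous_on UNIV psi"
    using psi by (meson DERIV_isCont continuous_at_imp_continuous_on)
  have cp: "continuous_on UNIV (\<lambda>y::'a. psi ((norm y)\<^sup>2 / R\<^sup>2))" "continuous_on UNIV (\<lambda>y::'a. psi' ((norm y)\<^sup>2 / R\<^sup>2))"
    if "R > 0" for R
    using that by (intro continuous_on_compose2[OF contpsi] continuous_on_compose2[OF psi'] continuous_intros; auto)+
  show deriv: "(phi R has_derivative (\<lambda>w. Dphi R y \<bullet> w)) (at y)" if R: "R > 0" for R y
  proof -
    define k where "k = 1 / R\<^sup>2"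
    have "((\<lambda>y. (y \<bullet> y) * k) has_derivative (\<lambda>w. (2 * k) * (y \<bullet> w))) (at y)"
      by (rule derivative_eq_intros refl)+ (auto simp: inner_commute algebra_simps)
    moreover have "(psi has_derivative (\<lambda>z. psi' ((y \<bullet> y) * k) * z)) (at ((y \<bullet> y) * k))"
      using psi by (simp add: has_field_derivative_def)
    ultimately have dpsi: "((\<lambda>y. psi ((y \<bullet> y) * k)) has_derivative (\<lambda>w. psi' ((y \<bullet> y) * k) * ((2 * k) * (y \<bullet> w)))) (at y)"
      by (rule has_derivative_compose)
    have "((\<lambda>y. v \<bullet> y) has_derivative (\<lambda>w. v \<bullet> w)) (at y)"
      by (auto intro!: derivative_eq_intros)
    from has_derivative_mult[OF this dpsi]
    show ?thesis
      unfolding phi_def Dphi_def power2_norm_eq_inner k_def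
      by (simp add: inner_simps algebra_simps)
  qed
  show contD: "continuous_on UNIV (Dphi R)" if "R > 0" for R
    unfolding Dphi_def by (intro continuous_intros cp[OF that])
  have contphi: "continuous_on UNIV (phi R)" if "R > 0" for R
    unfolding phi_def by (intro continuous_intros cp[OF that])
  have big: "(norm y)\<^sup>2 / R\<^sup>2 \<ge> 1" if "R > 0" "norm y > R" for R and y :: 'a
    using that power_mono[of R "norm y" 2] by simp
  show supp: "phi R y = 0" if "R > 0" "norm y > R" for R y
    using big[OF that] by (simp add: phi_def psi1)
  show suppD: "Dphi R y = 0" if "R > 0" "norm y > R" for R y
    using big[OF that] by (simp add: Dphi_def psi1)
  show "(\<integral>y. phi R y * exp (- Q y) \<partial>lborel) = 0" if R: "R > 0" for R
  proof (rule lborel_integral_odd)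
    show "(\<lambda>y. phi R y * exp (- Q y)) \<in> borel_measurable borel"
      by (intro borel_measurable_continuous_onI continuous_intros contphi R)
    have "Q (- x) = Q x" for x using linear_H by (simp add: Q_def linear_neg)
    then show "phi R (- x) * exp (- Q (- x)) = - (phi R x * exp (- Q x))" for x
      by (simp add: phi_def)
  qed
  obtain M1 where M1: "M1 \<ge> 0" "\<And>s. s \<ge> 0 \<Longrightarrow> \<bar>psi s\<bar> \<le> M1"
    using bounded_if_zero_beyond_1[OF contpsi psi1(1)] by blast
  obtain M2 where M2: "M2 \<ge> 0" "\<And>s. s \<ge> 0 \<Longrightarrow> \<bar>psi' s\<bar> \<le> M2"
    using bounded_if_zero_beyond_1[OF psi' psi1(2)] by blast
  \<comment> \<open>A gradient bound uniform in R: differentiating the cutoff costs 2 |y|^2 / R^2,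
    which is at most 2 on the support.\<close>
  define N where "N = norm v * (M1 + 2 * M2)"
  have Dphi_le: "norm (Dphi R y) \<le> N" if R: "R > 0" for R y
  proof (cases "norm y > R")
    case True
    then show ?thesis using suppD[OF R] M1 M2 by (simp add: N_def)
  next
    case False
    then have y: "(norm y)\<^sup>2 \<le> R\<^sup>2" by (intro power_mono) auto
    have "norm (Dphi R y) \<le> \<bar>psi ((norm y)\<^sup>2 / R\<^sup>2)\<bar> * norm v + \<bar>v \<bullet> y\<bar> * \<bar>psi' ((norm y)\<^sup>2 / R\<^sup>2)\<bar> * (2 / R\<^sup>2) * norm y"
      unfolding Dphi_def by (rule order_trans[OF norm_triangle_ineq]) (simp add: abs_mult)
    also have "\<dots> \<le> M1 * norm v + (norm v * norm y) * M2 * (2 / R\<^sup>2) * norm y"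
      using M1 M2 by (intro add_mono mult_mono Cauchy_Schwarz_ineq2) auto
    also have "\<dots> = M1 * norm v + norm v * M2 * 2 * ((norm y)\<^sup>2 / R\<^sup>2)"
      by (simp add: power2_eq_square)
    also have "\<dots> \<le> M1 * norm v + norm v * M2 * 2 * 1"
      using y R M1 M2 by (intro add_mono mult_left_mono) auto
    finally show ?thesis by (simp add: N_def algebra_simps)
  qed
  have phi_le: "\<bar>phi R y\<bar> \<le> norm v * M1 * norm y" for R y
  proof -
    have "\<bar>v \<bullet> y\<bar> * \<bar>psi ((norm y)\<^sup>2 / R\<^sup>2)\<bar> \<le> (norm v * norm y) * M1"
      using M1 by (intro mult_mono Cauchy_Schwarz_ineq2) auto
    then show ?thesis by (simp add: phi_def abs_mult mult_ac)
  qed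
  define R where "R n = real (Suc n)" for n
  have R: "R n > 0" for n by (simp add: R_def)
  have lim0: "(\<lambda>n. k / (R n)\<^sup>2) \<longlonglongrightarrow> 0" for k
  proof -
    have "(\<lambda>n. k * (1 / real (Suc n))\<^sup>2) \<longlonglongrightarrow> k * 0\<^sup>2"
      by (intro tendsto_intros LIMSEQ_Suc[OF lim_1_over_n])
    then show ?thesis by (simp add: R_def power_divide)
  qed
  have psi_lim: "(\<lambda>n. psi (k / (R n)\<^sup>2)) \<longlonglongrightarrow> 1" for k
    using continuous_on_tendsto_compose[OF contpsi lim0[of k]] psi0 by simp
  have psi'_lim: "(\<lambda>n. psi' (k / (R n)\<^sup>2)) \<longlonglongrightarrow> psi' 0" for k
    using continuous_on_tendsto_compose[OF psi' lim0[of k]] by simp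
  have phi_lim: "(\<lambda>n. phi (R n) y) \<longlonglongrightarrow> v \<bullet> y" for y
    using tendsto_mult[OF tendsto_const[of "v \<bullet> y"] psi_lim[of "(norm y)\<^sup>2"]] by (simp add: phi_def)
  have Dphi_lim: "(\<lambda>n. Dphi (R n) y) \<longlonglongrightarrow> v" for y
  proof -
    have "(\<lambda>n. Dphi (R n) y) \<longlonglongrightarrow> 1 *\<^sub>R v + ((v \<bullet> y) * psi' 0 * 0) *\<^sub>R y"
      unfolding Dphi_def by (intro tendsto_intros psi_lim psi'_lim lim0)
    then show ?thesis by simp
  qed
  have dom: "integrable lborel (\<lambda>y. K * (1 + (norm y)\<^sup>2) * exp (- Q y))" for K
    by (rule integrable_poly_Q[where M="\<bar>K\<bar>"]) (auto intro!: continuous_intros simp: abs_mult)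
  have sq1: "(norm v * M1 * norm y)\<^sup>2 \<le> (norm v * M1)\<^sup>2 * (1 + (norm y)\<^sup>2)" for y :: 'a
    by (simp add: power_mult_distrib mult_left_mono)
  have K1: "K \<le> K * (1 + (norm y)\<^sup>2)" if "K \<ge> 0" for K and y :: 'a
    using that by (simp add: distrib_left)
  have lim1: "(\<lambda>n. \<integral>y. (phi (R n) y)\<^sup>2 * exp (- Q y) \<partial>lborel) \<longlonglongrightarrow> (\<integral>y. (v \<bullet> y)\<^sup>2 * exp (- Q y) \<partial>lborel)"
  proof (rule integral_dominated_convergence[OF _ _ dom[of "(norm v * M1)\<^sup>2"]])
    show "AE y in lborel. (\<lambda>n. (phi (R n) y)\<^sup>2 * exp (- Q y)) \<longlonglongrightarrow> (v \<bullet> y)\<^sup>2 * exp (- Q y)"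
      by (auto intro!: tendsto_intros phi_lim)
    have "(phi (R n) y)\<^sup>2 \<le> (norm v * M1)\<^sup>2 * (1 + (norm y)\<^sup>2)" for n y
      using power_mono[OF phi_le[of "R n" y], of 2] sq1[of y] by simp
    then show "AE y in lborel. norm ((phi (R n) y)\<^sup>2 * exp (- Q y)) \<le> (norm v * M1)\<^sup>2 * (1 + (norm y)\<^sup>2) * exp (- Q y)" for n
      by (simp add: abs_mult)
    show "(\<lambda>y. (v \<bullet> y)\<^sup>2 * exp (- Q y)) \<in> borel_measurable lborel"
      by (simp, intro borel_measurable_continuous_onI continuous_intros)
    show "(\<lambda>y. (phi (R n) y)\<^sup>2 * exp (- Q y)) \<in> borel_measurable lborel" for n
      by (simp, intro borel_measurable_continuous_onI continuous_intros contphi R)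
  qed
  have lim2: "(\<lambda>n. \<integral>y. (norm (Dphi (R n) y))\<^sup>2 * exp (- Q y) \<partial>lborel) \<longlonglongrightarrow> (\<integral>y. (norm v)\<^sup>2 * exp (- Q y) \<partial>lborel)"
  proof (rule integral_dominated_convergence[OF _ _ dom[of "N\<^sup>2"]])
    show "AE y in lborel. (\<lambda>n. (norm (Dphi (R n) y))\<^sup>2 * exp (- Q y)) \<longlonglongrightarrow> (norm v)\<^sup>2 * exp (- Q y)"
      by (auto intro!: tendsto_intros Dphi_lim)
    have "(norm (Dphi (R n) y))\<^sup>2 \<le> N\<^sup>2 * (1 + (norm y)\<^sup>2)" for n y
      using power_mono[OF Dphi_le[OF R, of n y], of 2] K1[of "N\<^sup>2" y] by simp
    then show "AE y in lborel. norm ((norm (Dphi (R n) y))\<^sup>2 * exp (- Q y)) \<le> N\<^sup>2 * (1 + (norm y)\<^sup>2) * exp (- Q y)" for n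
      by (simp add: abs_mult)
    show "(\<lambda>y. (norm v)\<^sup>2 * exp (- Q y)) \<in> borel_measurable lborel"
      by (simp, intro borel_measurable_continuous_onI continuous_intros)
    show "(\<lambda>y. (norm (Dphi (R n) y))\<^sup>2 * exp (- Q y)) \<in> borel_measurable lborel" for n
      by (simp, intro borel_measurable_continuous_onI continuous_intros contD R)
  qed
  have lim3: "(\<lambda>n. \<integral>y. phi (R n) y * (v \<bullet> y) * exp (- Q y) \<partial>lborel) \<longlonglongrightarrow> (\<integral>y. (v \<bullet> y) * (v \<bullet> y) * exp (- Q y) \<partial>lborel)"
  proof (rule integral_dominated_convergence[OF _ _ dom[of "(norm v)\<^sup>2 * M1"]])
    show "AE y in lborel. (\<lambda>n. phi (R n) y * (v \<bullet> y) * exp (- Q y)) \<longlonglongrightarrow> (v \<bullet> y) * (v \<bullet> y) * exp (- Q y)"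
      by (auto intro!: tendsto_intros phi_lim)
    have "\<bar>phi (R n) y\<bar> * \<bar>v \<bullet> y\<bar> \<le> (norm v)\<^sup>2 * M1 * (1 + (norm y)\<^sup>2)" for n y
    proof -
      have "\<bar>phi (R n) y\<bar> * \<bar>v \<bullet> y\<bar> \<le> (norm v * M1 * norm y) * (norm v * norm y)"
        using M1 by (intro mult_mono phi_le Cauchy_Schwarz_ineq2) auto
      also have "\<dots> = (norm v)\<^sup>2 * M1 * (norm y)\<^sup>2" by (simp add: power2_eq_square)
      also have "\<dots> \<le> (norm v)\<^sup>2 * M1 * (1 + (norm y)\<^sup>2)" using M1 by (intro mult_left_mono) auto
      finally show ?thesis .
    qed
    then show "AE y in lborel. norm (phi (R n) y * (v \<bullet> y) * exp (- Q y)) \<le> (norm v)\<^sup>2 * M1 * (1 + (norm y)\<^sup>2) * exp (- Q y)" for n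
      by (simp add: abs_mult mult.assoc)
    show "(\<lambda>y. (v \<bullet> y) * (v \<bullet> y) * exp (- Q y)) \<in> borel_measurable lborel"
      by (simp, intro borel_measurable_continuous_onI continuous_intros)
    show "(\<lambda>y. phi (R n) y * (v \<bullet> y) * exp (- Q y)) \<in> borel_measurable lborel" for n
      by (simp, intro borel_measurable_continuous_onI continuous_intros contphi R)
  qed
  have lim4: "(\<lambda>n. \<integral>y. (Dphi (R n) y \<bullet> G v) * exp (- Q y) \<partial>lborel) \<longlonglongrightarrow> (\<integral>y. (v \<bullet> G v) * exp (- Q y) \<partial>lborel)"
  proof (rule integral_dominated_convergence[OF _ _ dom[of "N * norm (G v)"]])
    show "AE y in lborel. (\<lambda>n. (Dphi (R n) y \<bullet> G v) * exp (- Q y)) \<longlonglongrightarrow> (v \<bullet> G v) * exp (- Q y)"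
      by (auto intro!: tendsto_intros Dphi_lim)
    have "\<bar>Dphi (R n) y \<bullet> G v\<bar> \<le> N * norm (G v) * (1 + (norm y)\<^sup>2)" for n y
    proof -
      have "\<bar>Dphi (R n) y \<bullet> G v\<bar> \<le> N * norm (G v)"
        using Cauchy_Schwarz_ineq2[of "Dphi (R n) y" "G v"] mult_right_mono[OF Dphi_le[OF R, of n y] norm_ge_zero[of "G v"]]
        by linarith
      also have "\<dots> \<le> N * norm (G v) * (1 + (norm y)\<^sup>2)"
        using M1 M2 by (intro K1) (auto simp: N_def)
      finally show ?thesis .
    qed
    then show "AE y in lborel. norm ((Dphi (R n) y \<bullet> G v) * exp (- Q y)) \<le> N * norm (G v) * (1 + (norm y)\<^sup>2) * exp (- Q y)" for n
      by (simp add: abs_mult mult.assoc)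
    show "(\<lambda>y. (v \<bullet> G v) * exp (- Q y)) \<in> borel_measurable lborel"
      by (simp, intro borel_measurable_continuous_onI continuous_intros)
    show "(\<lambda>y. (Dphi (R n) y \<bullet> G v) * exp (- Q y)) \<in> borel_measurable lborel" for n
      by (simp, intro borel_measurable_continuous_onI continuous_intros contD R)
  qed
  \<comment> \<open>Integration by parts is available for compact support, so it is applied to the
    truncations and carried to the limit. This computes the Gaussian second moment of the linear
    function, and the eigenvector equation evaluates \<open>v \<bullet> G v\<close>.\<close>
  have "(\<integral>y. phi (R n) y * (v \<bullet> y) * exp (- Q y) \<partial>lborel) = (\<integral>y. (Dphi (R n) y \<bullet> G v) * exp (- Q y) \<partial>lborel)" for n
    by (rule gaussian_ibp[OF deriv contD supp]) (use R in auto)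
  then have ibp: "(\<integral>y. (v \<bullet> y) * (v \<bullet> y) * exp (- Q y) \<partial>lborel) = (\<integral>y. (v \<bullet> G v) * exp (- Q y) \<partial>lborel)"
    using LIMSEQ_unique[OF lim3] lim4 by simp
  have "v \<bullet> G v = (norm v)\<^sup>2 / lam"
  proof -
    have "lam * (v \<bullet> G v) = H v \<bullet> G v" by (simp add: v)
    also have "\<dots> = v \<bullet> v" by (simp add: sym_H H_G)
    finally show ?thesis using lam_pos by (simp add: power2_norm_eq_inner field_simps)
  qed
  then have lim1': "(\<lambda>n. \<integral>y. (phi (R n) y)\<^sup>2 * exp (- Q y) \<partial>lborel)
      \<longlonglongrightarrow> (norm v)\<^sup>2 / lam * (\<integral>y. exp (- Q y) \<partial>lborel)"
    using lim1 ibp by (simp add: power2_eq_square)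
  have lim: "(\<lambda>n. (\<integral>y. (phi (R n) y)\<^sup>2 * exp (- Q y) \<partial>lborel) - B * (\<integral>y. (norm (Dphi (R n) y))\<^sup>2 * exp (- Q y) \<partial>lborel))
    \<longlonglongrightarrow> (norm v)\<^sup>2 / lam * (\<integral>y. exp (- Q y) \<partial>lborel) - B * ((norm v)\<^sup>2 * (\<integral>y. exp (- Q y) \<partial>lborel))"
    using lim2 by (intro tendsto_intros lim1') simp
  have "(norm v)\<^sup>2 / lam * (\<integral>y. exp (- Q y) \<partial>lborel) - B * ((norm v)\<^sup>2 * (\<integral>y. exp (- Q y) \<partial>lborel))
    = (1 / lam - B) * ((norm v)\<^sup>2 * (\<integral>y. exp (- Q y) \<partial>lborel))" by (simp add: algebra_simps)
  also have "\<dots> > 0"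
    using B v(1) Z_pos by (intro mult_pos_pos) auto
  finally have "\<forall>\<^sub>F n in sequentially. 0 < (\<integral>y. (phi (R n) y)\<^sup>2 * exp (- Q y) \<partial>lborel)
      - B * (\<integral>y. (norm (Dphi (R n) y))\<^sup>2 * exp (- Q y) \<partial>lborel)"
    by (rule order_tendstoD(1)[OF lim])
  then obtain n where "B * (\<integral>y. (norm (Dphi (R n) y))\<^sup>2 * exp (- Q y) \<partial>lborel) < (\<integral>y. (phi (R n) y)\<^sup>2 * exp (- Q y) \<partial>lborel)"
    by (auto simp: eventually_sequentially)
  then show "\<exists>R>0. B * (\<integral>y. (norm (Dphi R y))\<^sup>2 * exp (- Q y) \<partial>lborel) < (\<integral>y. (phi R y)\<^sup>2 * exp (- Q y) \<partial>lborel)"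
    using R by blast
qed

end

section \<open>Smooth test functions\<close>

text \<open>The powers of \<open>s\<close> in the denominator make the family closed under
  differentiation up to linear combinations, so that all orders of smoothness follow by one
  induction.\<close>

definition flat_exp :: "nat \<Rightarrow> real \<Rightarrow> real" where
  "flat_exp m s = (if s > 0 then exp (- 1 / s) / s ^ m else 0)"

lemma flat_exp_tendsto_0: "((\<lambda>h. flat_exp m h) \<longlongrightarrow> 0) (at 0)"
proof -
  have "((\<lambda>h::real. inverse h ^ m / exp (inverse h)) \<longlongrightarrow> 0) (at_right 0)"
    using filterlim_compose[OF tendsto_power_div_exp_0 filterlim_inverse_at_top_right] .
  moreover have "\<forall>\<^sub>F h in at_right 0. inverse h ^ m / exp (inverse h) = flat_exp m h"
    using eventually_at_right_less[of 0]
    by eventually_elim (simp add: flat_exp_def exp_minus divide_inverse power_inverse)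
  ultimately have "((\<lambda>h. flat_exp m h) \<longlongrightarrow> 0) (at_right 0)"
    by (rule Lim_transform_eventually)
  moreover have "\<forall>\<^sub>F h in at_left 0. 0 = flat_exp m h"
    by (auto simp: eventually_at_filter flat_exp_def)
  then have "((\<lambda>h. flat_exp m h) \<longlongrightarrow> 0) (at_left 0)"
    by (rule Lim_transform_eventually[OF tendsto_const])
  ultimately show ?thesis using filterlim_split_at by blast
qed

lemma flat_exp_deriv:
  "(flat_exp m has_real_derivative (flat_exp (m + 2) s - real m * flat_exp (m + 1) s)) (at s)"
proof -
  consider "s > 0" | "s < 0" | "s = 0" by linarith
  then show ?thesis
  proof cases
    case 1
    have "((\<lambda>s. exp (- 1 / s)) has_real_derivative exp (- 1 / s) / s\<^sup>2) (at s)"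
      using 1 by (auto intro!: derivative_eq_intros simp: power2_eq_square)
    moreover have "((\<lambda>s. s ^ m) has_real_derivative real m * s ^ (m - 1)) (at s)"
      by (auto intro!: derivative_eq_intros)
    ultimately have "((\<lambda>s. exp (- 1 / s) / s ^ m) has_real_derivative
        (exp (- 1 / s) / s\<^sup>2 * s ^ m - exp (- 1 / s) * (real m * s ^ (m - 1))) / (s ^ m * s ^ m)) (at s)"
      using 1 by (intro DERIV_divide) auto
    moreover have "(exp (- 1 / s) / s\<^sup>2 * s ^ m - exp (- 1 / s) * (real m * s ^ (m - 1))) / (s ^ m * s ^ m)
      = flat_exp (m + 2) s - real m * flat_exp (m + 1) s"
      using 1 by (cases m) (simp_all add: flat_exp_def divide_simps power2_eq_square, simp_all add: algebra_simps)
    ultimately have "((\<lambda>s. exp (- 1 / s) / s ^ m) has_real_derivative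
        (flat_exp (m + 2) s - real m * flat_exp (m + 1) s)) (at s)" by simp
    then show ?thesis
      by (rule has_field_derivative_transform_within_open[where S="{0<..}"]) (use 1 in \<open>simp_all add: flat_exp_def\<close>)
  next
    case 2
    have "(flat_exp m has_real_derivative 0) (at s)"
      by (rule has_field_derivative_transform_within_open[where S="{..<0}" and f="\<lambda>_. 0"])
         (use 2 in \<open>simp_all add: flat_exp_def\<close>)
    then show ?thesis using 2 by (simp add: flat_exp_def)
  next
    case 3
    \<comment> \<open>The difference quotient at 0 is again a member of the family. At
      \<open>h = 0\<close> the convention for division by zero makes both sides 0.\<close>
    have "flat_exp m h / h = flat_exp (m + 1) h" for h
      by (simp add: flat_exp_def)
    then have "((\<lambda>h. flat_exp m h / h) \<longlongrightarrow> 0) (at 0)"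
      using flat_exp_tendsto_0[of "m + 1"] by simp
    then show ?thesis using 3 by (simp add: DERIV_def flat_exp_def[of _ 0])
  qed
qed

lemma continuous_on_flat_exp [continuous_intros]:
  "continuous_on S h \<Longrightarrow> continuous_on S (\<lambda>x. flat_exp m (h x))"
proof -
  have "continuous_on UNIV (flat_exp m)"
    by (intro continuous_at_imp_continuous_on ballI DERIV_isCont[OF flat_exp_deriv])
  then show "continuous_on S h \<Longrightarrow> continuous_on S (\<lambda>x. flat_exp m (h x))"
    by (rule continuous_on_compose2) auto
qed

lemma C_k_Suc_imp: "C_k (Suc k) h \<Longrightarrow> C_k k h"
proof (induction k arbitrary: h)
  case 0
  then have "\<And>x. h differentiable (at x)" by simp
  then show ?case
    using differentiable_imp_continuous_within by (auto intro!: continuous_at_imp_continuous_on)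
next
  case (Suc k)
  then show ?case by (metis C_k.simps(2))
qed

lemma C_k_Suc_I:
  assumes "\<And>x. (h has_derivative (\<lambda>v. D x \<bullet> v)) (at x)" and "\<And>i. C_k k (\<lambda>x. D x $ i)"
  shows "C_k (Suc k) h"
proof -
  have "gradient h x = D x" for x by (rule gradient_eqI[OF assms(1)])
  then show ?thesis using assms by (auto simp: differentiable_def)
qed

lemma C_k_Suc_D:
  assumes "C_k (Suc k) h"
  shows "(h has_derivative (\<lambda>v. gradient h x \<bullet> v)) (at x)" and "C_k k (\<lambda>x. gradient h x $ i)"
  using assms by (simp_all add: has_derivative_gradient)

lemma C_k_const: "C_k k (\<lambda>_. a)"
proof (induction k arbitrary: a)
  case (Suc k)
  show ?case by (rule C_k_Suc_I[where D="\<lambda>_. 0"]) (use Suc in auto)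
qed simp

lemma C_k_add: "C_k k p \<Longrightarrow> C_k k q \<Longrightarrow> C_k k (\<lambda>x. p x + q x)"
proof (induction k arbitrary: p q)
  case 0
  then show ?case by (simp add: continuous_on_add)
next
  case (Suc k)
  show ?case
  proof (rule C_k_Suc_I[where D="\<lambda>x. gradient p x + gradient q x"])
    show "((\<lambda>x. p x + q x) has_derivative (\<lambda>v. (gradient p x + gradient q x) \<bullet> v)) (at x)" for x
      using has_derivative_add[OF C_k_Suc_D(1)[OF Suc.prems(1)] C_k_Suc_D(1)[OF Suc.prems(2)]]
      by (simp add: inner_add_left)
    show "C_k k (\<lambda>x. (gradient p x + gradient q x) $ i)" for i
      using Suc.IH[OF C_k_Suc_D(2)[OF Suc.prems(1)] C_k_Suc_D(2)[OF Suc.prems(2)]] by simp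
  qed
qed

lemma C_k_mult: "C_k k p \<Longrightarrow> C_k k q \<Longrightarrow> C_k k (\<lambda>x. p x * q x)"
proof (induction k arbitrary: p q)
  case 0
  then show ?case by (simp add: continuous_on_mult)
next
  case (Suc k)
  show ?case
  proof (rule C_k_Suc_I[where D="\<lambda>x. p x *\<^sub>R gradient q x + q x *\<^sub>R gradient p x"])
    show "((\<lambda>x. p x * q x) has_derivative (\<lambda>v. (p x *\<^sub>R gradient q x + q x *\<^sub>R gradient p x) \<bullet> v)) (at x)" for x
      using has_derivative_mult[OF C_k_Suc_D(1)[OF Suc.prems(1)] C_k_Suc_D(1)[OF Suc.prems(2)]]
      by (simp add: inner_add_left mult.commute)
    show "C_k k (\<lambda>x. (p x *\<^sub>R gradient q x + q x *\<^sub>R gradient p x) $ i)" for i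
      using C_k_add[OF Suc.IH[OF C_k_Suc_imp[OF Suc.prems(1)] C_k_Suc_D(2)[OF Suc.prems(2)]]
          Suc.IH[OF C_k_Suc_imp[OF Suc.prems(2)] C_k_Suc_D(2)[OF Suc.prems(1)]]] by simp
  qed
qed

lemma C_k_sum: "finite I \<Longrightarrow> (\<And>i. i \<in> I \<Longrightarrow> C_k k (p i)) \<Longrightarrow> C_k k (\<lambda>x. \<Sum>i\<in>I. p i x)"
  by (induction I rule: finite_induct) (simp_all add: C_k_const C_k_add)

lemma C_k_affine: "C_k k (\<lambda>x. a \<bullet> (x - c))"
proof (cases k)
  case 0
  then show ?thesis by (auto intro!: continuous_intros)
next
  case (Suc j)
  show ?thesis unfolding Suc
    by (rule C_k_Suc_I[where D="\<lambda>_. a"]) (auto intro!: derivative_eq_intros C_k_const)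
qed

text \<open>Each derivative raises the index, hence the induction on \<open>k\<close> for arbitrary
  \<open>m\<close>.\<close>

lemma C_k_flat_exp: "(\<And>k. C_k k p) \<Longrightarrow> C_k k (\<lambda>x. flat_exp m (p x))"
proof (induction k arbitrary: m)
  case 0
  have "C_k 0 p" by (rule 0)
  then show ?case by (simp add: continuous_on_flat_exp)
next
  case (Suc k)
  define d where "d s = flat_exp (m + 2) s + (- real m) * flat_exp (m + 1) s" for s
  show ?case
  proof (rule C_k_Suc_I[where D="\<lambda>x. d (p x) *\<^sub>R gradient p x"])
    show "((\<lambda>x. flat_exp m (p x)) has_derivative (\<lambda>v. (d (p x) *\<^sub>R gradient p x) \<bullet> v)) (at x)" for x
    proof -
      have "(flat_exp m has_derivative (\<lambda>s. d (p x) * s)) (at (p x))"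
        using flat_exp_deriv[of m "p x"] by (simp add: has_field_derivative_def d_def)
      from has_derivative_compose[OF C_k_Suc_D(1)[OF Suc.prems[of "Suc k"]] this] show ?thesis by simp
    qed
    have "C_k k (\<lambda>x. d (p x))"
      unfolding d_def by (intro C_k_add C_k_mult C_k_const Suc.IH Suc.prems)
    from C_k_mult[OF this C_k_Suc_D(2)[OF Suc.prems[of "Suc k"]]]
    show "C_k k (\<lambda>x. (d (p x) *\<^sub>R gradient p x) $ i)" for i by simp
  qed
qed

section \<open>The Poincare constant of the Gibbs measures\<close>

text \<open>The Jacobian of x = c + sqrt(t) y and the factor exp(- f(c) / t) occur in the integral
  and in the normalising constant alike, and cancel.\<close>

lemma gibbs_integral:
  fixes f h :: "real ^ 'n \<Rightarrow> real"
  assumes f: "continuous_on UNIV f" and h: "continuous_on UNIV h" and t: "t > 0"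
  shows "(\<integral>x. h x \<partial>gibbs f t) = (\<integral>y. h (c + sqrt t *\<^sub>R y) * exp (- ((f (c + sqrt t *\<^sub>R y) - f c) / t)) \<partial>lborel)
    / (\<integral>y. exp (- ((f (c + sqrt t *\<^sub>R y) - f c) / t)) \<partial>lborel)"
proof -
  define k where "k = \<bar>sqrt t\<bar> ^ DIM(real ^ 'n) * exp (- f c / t)"
  have k: "k \<noteq> 0" using t by (simp add: k_def)
  have split: "exp (- f x / t) = exp (- f c / t) * exp (- ((f x - f c) / t))" for x
    by (simp add: mult_exp_exp diff_divide_distrib)
  have scale: "(\<integral>x. p x * exp (- f x / t) \<partial>lborel)
    = k * (\<integral>y. p (c + sqrt t *\<^sub>R y) * exp (- ((f (c + sqrt t *\<^sub>R y) - f c) / t)) \<partial>lborel)"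
    if "continuous_on UNIV p" for p :: "real ^ 'n \<Rightarrow> real"
  proof -
    have "(\<integral>x. p x * exp (- f x / t) \<partial>lborel) = \<bar>sqrt t\<bar> ^ DIM(real ^ 'n) *
       (\<integral>y. p (c + sqrt t *\<^sub>R y) * exp (- f (c + sqrt t *\<^sub>R y) / t) \<partial>lborel)"
      using t that f by (intro lborel_integral_affine borel_measurable_continuous_onI continuous_intros) auto
    also have "(\<integral>y. p (c + sqrt t *\<^sub>R y) * exp (- f (c + sqrt t *\<^sub>R y) / t) \<partial>lborel)
      = (\<integral>y. exp (- f c / t) * (p (c + sqrt t *\<^sub>R y) * exp (- ((f (c + sqrt t *\<^sub>R y) - f c) / t))) \<partial>lborel)"
      by (rule Bochner_Integration.integral_cong[OF refl], subst split) (simp only: mult_ac)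
    also have "\<dots> = exp (- f c / t) * (\<integral>y. p (c + sqrt t *\<^sub>R y) * exp (- ((f (c + sqrt t *\<^sub>R y) - f c) / t)) \<partial>lborel)"
      by simp
    finally show ?thesis by (simp add: k_def)
  qed
  have Z: "gibbs_Z f t = k * (\<integral>y. exp (- ((f (c + sqrt t *\<^sub>R y) - f c) / t)) \<partial>lborel)"
    using scale[of "\<lambda>_. 1"] by (simp add: gibbs_Z_def)
  have Z0: "gibbs_Z f t \<ge> 0" unfolding gibbs_Z_def by (intro Bochner_Integration.integral_nonneg) auto
  have "(\<integral>x. h x \<partial>gibbs f t) = (\<integral>x. (exp (- f x / t) / gibbs_Z f t) *\<^sub>R h x \<partial>lborel)"
    unfolding gibbs_def
  proof (rule integral_density)
    show "(\<lambda>x. exp (- f x / t) / gibbs_Z f t) \<in> borel_measurable lborel"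
      using borel_measurable_continuous_onI[OF f] by simp
  qed (use Z0 borel_measurable_continuous_onI[OF h] in auto)
  also have "\<dots> = (\<integral>x. (h x * exp (- f x / t)) / gibbs_Z f t \<partial>lborel)"
    by (simp add: mult.commute)
  also have "\<dots> = (\<integral>x. h x * exp (- f x / t) \<partial>lborel) / gibbs_Z f t" by simp
  finally show ?thesis unfolding scale[OF h] Z using k by simp
qed

lemma compactly_supported_affine:
  fixes h :: "real ^ 'n \<Rightarrow> real"
  assumes "compactly_supported h" and s: "s > 0"
  shows "\<exists>r. \<forall>y. norm y > r \<longrightarrow> h (c + s *\<^sub>R y) = 0"
proof -
  have "bounded (closure {x. h x \<noteq> 0})"
    using assms(1) by (simp add: compactly_supported_def compact_imp_bounded)
  then have "bounded {x. h x \<noteq> 0}" by (rule bounded_subset[OF _ closure_subset])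
  then obtain b where b: "\<And>x. h x \<noteq> 0 \<Longrightarrow> norm x \<le> b"
    unfolding bounded_iff by blast
  have "h (c + s *\<^sub>R y) = 0" if y: "norm y > (b + norm c) / s" for y
  proof (rule ccontr)
    assume "h (c + s *\<^sub>R y) \<noteq> 0"
    from b[OF this] have "norm (s *\<^sub>R y) \<le> b + norm c"
      using norm_triangle_ineq2[of "s *\<^sub>R y" "- c"] by (simp add: add.commute)
    then show False using y s by (simp add: field_simps)
  qed
  then show ?thesis by blast
qed

lemma smooth_D:
  assumes "smooth h"
  shows "(h has_derivative (\<lambda>v. gradient h x \<bullet> v)) (at x)" "continuous_on UNIV (gradient h)" "continuous_on UNIV h"
proof -
  have "C_k (Suc 0) h" and "C_k 0 h" using assms unfolding smooth_def by blast+
  then show "(h has_derivative (\<lambda>v. gradient h x \<bullet> v)) (at x)" "continuous_on UNIV (gradient h)" "continuous_on UNIV h"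
    using C_1_D by auto
qed

lemma has_derivative_affine_arg:
  fixes h :: "'a::euclidean_space \<Rightarrow> real"
  assumes "\<And>x. (h has_derivative (\<lambda>v. Dh x \<bullet> v)) (at x)"
  shows "((\<lambda>y. h (c + s *\<^sub>R y)) has_derivative (\<lambda>v. (s *\<^sub>R Dh (c + s *\<^sub>R y)) \<bullet> v)) (at y)"
proof -
  have "((\<lambda>y. c + s *\<^sub>R y) has_derivative (\<lambda>v. s *\<^sub>R v)) (at y)"
    by (auto intro!: derivative_eq_intros)
  from has_derivative_compose[OF this assms] show ?thesis by simp
qed

text \<open>The gradient of the rescaled function carries a factor \<open>sqrt t\<close>, so the
  energy carries t: a constant \<open>K\<close> for the Gibbs measure becomes \<open>K / t\<close>.
  This is the division by t in \<open>C_bP\<close>.\<close>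

lemma gibbs_poincare_iff:
  fixes f h :: "real ^ 'n \<Rightarrow> real"
  assumes min: "PL_min D2 c lam f g C L" and t: "t > 0" and h: "smooth h"
  shows "(\<integral>x. (h x)\<^sup>2 \<partial>gibbs f t) - (\<integral>x. h x \<partial>gibbs f t)\<^sup>2 \<le> K * (\<integral>x. (norm (gradient h x))\<^sup>2 \<partial>gibbs f t)
    \<longleftrightarrow> PL_min.Var c f t (\<lambda>y. h (c + sqrt t *\<^sub>R y))
      \<le> K / t * PL_min.Energy c f t (\<lambda>y. sqrt t *\<^sub>R gradient h (c + sqrt t *\<^sub>R y))"
proof -
  interpret PL_min D2 c lam f g C L by (rule min)
  have contf: "continuous_on UNIV f"
    using f has_derivative_continuous by (blast intro: continuous_at_imp_continuous_on)
  define Z where "Z = (\<integral>y. exp (- F t y) \<partial>lborel)"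
  have Z: "Z > 0" using integral_exp_F_pos[OF t] by (simp add: Z_def)
  have int: "(\<integral>x. p x \<partial>gibbs f t) = (\<integral>y. p (c + sqrt t *\<^sub>R y) * exp (- F t y) \<partial>lborel) / Z"
    if "continuous_on UNIV p" for p
    using gibbs_integral[OF contf that t, of c] by (simp add: Z_def F_def)
  have "(\<integral>x. (h x)\<^sup>2 \<partial>gibbs f t) - (\<integral>x. h x \<partial>gibbs f t)\<^sup>2 = Var t (\<lambda>y. h (c + sqrt t *\<^sub>R y)) / Z"
  proof -
    have "continuous_on UNIV (\<lambda>x. (h x)\<^sup>2)" by (intro continuous_intros smooth_D(3) h)
    from int[OF this] int[OF smooth_D(3)[OF h]] show ?thesis
      unfolding Var_def Z_def[symmetric] using Z
      by (simp add: power2_eq_square diff_divide_distrib)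
  qed
  moreover have "(\<integral>x. (norm (gradient h x))\<^sup>2 \<partial>gibbs f t)
      = Energy t (\<lambda>y. sqrt t *\<^sub>R gradient h (c + sqrt t *\<^sub>R y)) / t / Z"
  proof -
    have "continuous_on UNIV (\<lambda>x. (norm (gradient h x))\<^sup>2)" by (intro continuous_intros smooth_D(2) h)
    from int[OF this] show ?thesis
      using t by (simp add: Energy_def power_mult_distrib mult.assoc)
  qed
  ultimately have iff: "(\<integral>x. (h x)\<^sup>2 \<partial>gibbs f t) - (\<integral>x. h x \<partial>gibbs f t)\<^sup>2 \<le> K * (\<integral>x. (norm (gradient h x))\<^sup>2 \<partial>gibbs f t)
    \<longleftrightarrow> Var t (\<lambda>y. h (c + sqrt t *\<^sub>R y)) / Z
      \<le> (K / t * Energy t (\<lambda>y. sqrt t *\<^sub>R gradient h (c + sqrt t *\<^sub>R y))) / Z" by simp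
  have "a / Z \<le> b / Z \<longleftrightarrow> a \<le> b" for a b using Z by (simp add: divide_le_cancel)
  then show ?thesis unfolding iff .
qed

lemma poincare_const_upper:
  fixes f :: "real ^ 'n \<Rightarrow> real"
  assumes min: "PL_min D2 c lam f g C L" and eps: "eps > 0"
  shows "\<forall>\<^sub>F t in at_right 0. poincare_const (gibbs f t) / ereal t \<le> ereal (1 / lam + eps)"
proof -
  interpret PL_min D2 c lam f g C L by (rule min)
  have ev: "\<forall>\<^sub>F t in at_right (0::real). t > 0" by (rule eventually_at_right_less)
  show ?thesis using ev eventually_poincare[OF eps]
  proof eventually_elim
    case (elim t)
    have "poincare_const (gibbs f t) \<le> ereal ((1 / lam + eps) * t)"
      unfolding poincare_const_def
    proof (rule Inf_lower, clarify, intro exI conjI allI impI)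
      fix h :: "real ^ 'n \<Rightarrow> real"
      assume h: "smooth h \<and> compactly_supported h"
      obtain r where r: "\<And>y. norm y > r \<Longrightarrow> h (c + sqrt t *\<^sub>R y) = 0"
        using compactly_supported_affine[of h "sqrt t" c] h elim(1) by auto
      have "Var t (\<lambda>y. h (c + sqrt t *\<^sub>R y))
        \<le> (1 / lam + eps) * Energy t (\<lambda>y. sqrt t *\<^sub>R gradient h (c + sqrt t *\<^sub>R y))"
      proof (rule elim(2)[rule_format])
        show "((\<lambda>y. h (c + sqrt t *\<^sub>R y)) has_derivative (\<lambda>v. (sqrt t *\<^sub>R gradient h (c + sqrt t *\<^sub>R x)) \<bullet> v)) (at x)" for x
          using h by (intro has_derivative_affine_arg smooth_D) simp
        have "continuous_on UNIV (gradient h)" using h smooth_D by blast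
        then show "continuous_on UNIV (\<lambda>y. sqrt t *\<^sub>R gradient h (c + sqrt t *\<^sub>R y))"
          by (intro continuous_intros continuous_on_compose2[of UNIV "gradient h" UNIV "\<lambda>y. c + sqrt t *\<^sub>R y"]) auto
        show "h (c + sqrt t *\<^sub>R x) = 0" if "r < norm x" for x using r[OF that] .
      qed
      then show "(\<integral>x. (h x)\<^sup>2 \<partial>gibbs f t) - (\<integral>x. h x \<partial>gibbs f t)\<^sup>2
        \<le> ((1 / lam + eps) * t) * (\<integral>x. (norm (gradient h x))\<^sup>2 \<partial>gibbs f t)"
        using elim(1) h by (subst gibbs_poincare_iff[OF min]) auto
    qed simp
    then have "poincare_const (gibbs f t) / ereal t \<le> ereal ((1 / lam + eps) * t) / ereal t"
      using elim(1) by (intro ereal_divide_right_mono) auto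
    then show ?case using elim(1) by simp
  qed
qed

lemma poincare_const_lower:
  fixes f :: "real ^ 'n \<Rightarrow> real"
  assumes min: "PL_min D2 c lam f g C L" and v: "v \<noteq> 0" "D2 c v = lam *\<^sub>R v" and B: "B < 1 / lam"
  shows "\<forall>\<^sub>F t in at_right 0. ereal B \<le> poincare_const (gibbs f t) / ereal t"
proof -
  interpret PL_min D2 c lam f g C L by (rule min)
  \<comment> \<open>The standard bump exp(-1/(1 - s)), multiplied by e so that its value at 0 is
    1.\<close>
  define psi where "psi s = exp 1 * flat_exp 0 (1 - s)" for s
  define psi' where "psi' s = - exp 1 * flat_exp 2 (1 - s)" for s
  have psi: "(psi has_real_derivative psi' s) (at s)" for s
  proof -
    have "(flat_exp 0 has_real_derivative flat_exp 2 (1 - s)) (at (1 - s))"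
      using flat_exp_deriv[of 0 "1 - s"] by (simp add: numeral_2_eq_2)
    then have "((\<lambda>s. flat_exp 0 (1 - s)) has_real_derivative flat_exp 2 (1 - s) * (- 1)) (at s)"
      by (intro DERIV_chain2[of "flat_exp 0"]) (auto intro!: derivative_eq_intros)
    from DERIV_cmult[OF this, of "exp 1"] show ?thesis
      by (simp add: psi_def[abs_def] psi'_def)
  qed
  have psi': "continuous_on UNIV psi'" unfolding psi'_def by (intro continuous_intros)
  have psi0: "psi 0 = 1" by (simp add: psi_def flat_exp_def mult_exp_exp)
  have psi1: "\<forall>s\<ge>1. psi s = 0 \<and> psi' s = 0"
    by (auto simp: psi_def psi'_def flat_exp_def)
  define phi where "phi R y = (v \<bullet> y) * psi ((norm y)\<^sup>2 / R\<^sup>2)" for R and y :: "real ^ 'n"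
  define Dphi where "Dphi R y = psi ((norm y)\<^sup>2 / R\<^sup>2) *\<^sub>R v + ((v \<bullet> y) * psi' ((norm y)\<^sup>2 / R\<^sup>2) * (2 / R\<^sup>2)) *\<^sub>R y"
    for R and y :: "real ^ 'n"
  note test = truncated_linear_almost_extremal[OF psi psi' psi0 psi1 v B, folded phi_def Dphi_def]
  obtain R where R: "R > 0"
    and less: "B * (\<integral>y. (norm (Dphi R y))\<^sup>2 * exp (- Q y) \<partial>lborel) < (\<integral>y. (phi R y)\<^sup>2 * exp (- Q y) \<partial>lborel)"
    using test(1) by blast
  have contphi: "continuous_on UNIV (phi R)"
    using test(2)[OF R] has_derivative_continuous by (blast intro: continuous_at_imp_continuous_on)
  have ev: "\<forall>\<^sub>F t in at_right 0. B * Energy t (Dphi R) < Var t (phi R)"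
    by (rule eventually_test_function[OF contphi test(3)[OF R] test(4)[OF R] test(5)[OF R] test(6)[OF R] less])
  have ev': "\<forall>\<^sub>F t in at_right (0::real). t > 0" by (rule eventually_at_right_less)
  show ?thesis using ev' ev
  proof eventually_elim
    case (elim t)
    define k where "k = 1 / sqrt t"
    have kt: "k * sqrt t = 1" using elim(1) by (simp add: k_def)
    \<comment> \<open>Undoes the rescaling for the current t, so that the rescaled test function is
      \<open>phi R\<close> for every t.\<close>
    define h where "h x = phi R (k *\<^sub>R (x - c))" for x
    have hR: "h (c + sqrt t *\<^sub>R y) = phi R y" for y by (simp add: h_def kt)
    have "C_k j h" for j
    proof -
      \<comment> \<open>Written as products and sums of affine functions and one
        \<open>flat_exp\<close> of a polynomial, \<open>h\<close> falls under the closure rules for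
        \<open>C_k\<close>.\<close>
      have "h = (\<lambda>x. (k * (v \<bullet> (x - c))) * (exp 1 *
          flat_exp 0 (1 + (- (k\<^sup>2 / R\<^sup>2)) * (\<Sum>i\<in>UNIV. (axis i 1 \<bullet> (x - c)) * (axis i 1 \<bullet> (x - c))))))"
      proof
        fix x
        have "(norm (k *\<^sub>R (x - c)))\<^sup>2 = k\<^sup>2 * (\<Sum>i\<in>UNIV. (axis i 1 \<bullet> (x - c)) * (axis i 1 \<bullet> (x - c)))"
          by (simp add: power_mult_distrib power2_norm_eq_inner[of "x - c"] inner_vec_def[of "x - c"] inner_axis')
        then show "h x = (k * (v \<bullet> (x - c))) * (exp 1 *
          flat_exp 0 (1 + (- (k\<^sup>2 / R\<^sup>2)) * (\<Sum>i\<in>UNIV. (axis i 1 \<bullet> (x - c)) * (axis i 1 \<bullet> (x - c)))))"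
          unfolding h_def phi_def psi_def by simp
      qed
      moreover have "C_k j (\<lambda>x. (k * (v \<bullet> (x - c))) * (exp 1 *
          flat_exp 0 (1 + (- (k\<^sup>2 / R\<^sup>2)) * (\<Sum>i\<in>UNIV. (axis i 1 \<bullet> (x - c)) * (axis i 1 \<bullet> (x - c))))))"
        by (intro C_k_mult C_k_flat_exp C_k_add C_k_sum C_k_const C_k_affine) simp_all
      ultimately show ?thesis by simp
    qed
    then have smooth: "smooth h" by (simp add: smooth_def)
    have supp: "compactly_supported h"
    proof -
      have "{x. h x \<noteq> 0} \<subseteq> cball c (R * sqrt t)"
      proof
        fix x assume "x \<in> {x. h x \<noteq> 0}"
        then have "\<not> R < norm (k *\<^sub>R (x - c))"
          using test(4)[OF R, of "k *\<^sub>R (x - c)"] unfolding h_def by blast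
        moreover have "norm (k *\<^sub>R (x - c)) = norm (x - c) / sqrt t" using elim(1) by (simp add: k_def)
        ultimately show "x \<in> cball c (R * sqrt t)"
          using elim(1) by (simp add: not_less dist_norm norm_minus_commute pos_divide_le_eq)
      qed
      then have "bounded {x. h x \<noteq> 0}" using bounded_subset bounded_cball by blast
      then show ?thesis by (simp add: compactly_supported_def compact_closure)
    qed
    have "sqrt t *\<^sub>R gradient h (c + sqrt t *\<^sub>R y) = Dphi R y" for y
    proof -
      have 1: "((\<lambda>y. h (c + sqrt t *\<^sub>R y)) has_derivative (\<lambda>v. (sqrt t *\<^sub>R gradient h (c + sqrt t *\<^sub>R y)) \<bullet> v)) (at y)"
        by (intro has_derivative_affine_arg smooth_D smooth)
      have 2: "((\<lambda>y. h (c + sqrt t *\<^sub>R y)) has_derivative (\<lambda>v. Dphi R y \<bullet> v)) (at y)"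
        unfolding hR by (rule test(2)[OF R])
      show ?thesis using gradient_eqI[OF 1] gradient_eqI[OF 2] by simp
    qed
    then have iff: "(\<integral>x. (h x)\<^sup>2 \<partial>gibbs f t) - (\<integral>x. h x \<partial>gibbs f t)\<^sup>2 \<le> K * (\<integral>x. (norm (gradient h x))\<^sup>2 \<partial>gibbs f t)
      \<longleftrightarrow> Var t (phi R) \<le> K / t * Energy t (Dphi R)" for K
      using gibbs_poincare_iff[OF min elim(1) smooth] by (simp add: hR)
    \<comment> \<open>Nonnegativity is enough to cancel the energy: the strict inequality obtained
      below cannot hold when it is 0.\<close>
    have E: "Energy t (Dphi R) \<ge> 0" unfolding Energy_def by (intro Bochner_Integration.integral_nonneg) auto
    have "ereal (B * t) \<le> poincare_const (gibbs f t)"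
      unfolding poincare_const_def
    proof (rule Inf_greatest, clarify)
      fix K
      assume "\<forall>h. smooth h \<and> compactly_supported h \<longrightarrow> (\<integral>x. (h x)\<^sup>2 \<partial>gibbs f t) - (\<integral>x. h x \<partial>gibbs f t)\<^sup>2
        \<le> K * (\<integral>x. (norm (gradient h x))\<^sup>2 \<partial>gibbs f t)"
      then have "Var t (phi R) \<le> K / t * Energy t (Dphi R)" using smooth supp iff by blast
      then have "B * Energy t (Dphi R) < K / t * Energy t (Dphi R)" using elim(2) by linarith
      then have "B < K / t" using E by (meson mult_right_mono not_le)
      then show "ereal (B * t) \<le> ereal K" using elim(1) by (simp add: field_simps)
    qed
    then have "ereal (B * t) / ereal t \<le> poincare_const (gibbs f t) / ereal t"
      using elim(1) by (intro ereal_divide_right_mono) auto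
    then show ?case using elim(1) by simp
  qed
qed

lemma PL_min_gradient:
  fixes f :: "real ^ 'n \<Rightarrow> real"
  assumes C2: "C_k 2 f" and min: "\<And>y. f xs \<le> f y" and uniq: "\<And>x. (\<And>y. f x \<le> f y) \<Longrightarrow> x = xs"
    and C: "C > 0" and PL: "\<And>x. f x - f xs \<le> C / 2 * (norm (gradient f x))\<^sup>2"
    and L: "L > 0" and lap: "\<And>x. laplacian f x \<le> L * (1 + (norm (gradient f x))\<^sup>2)"
  shows "PL_min (\<lambda>x v. hessian f x *v v) xs (lambda_min (hessian f xs)) f (gradient f) C L"
    and "\<exists>v. v \<noteq> 0 \<and> hessian f xs *v v = lambda_min (hessian f xs) *\<^sub>R v"
proof -
  let ?H = "hessian f xs"
  note D = C_2_D[OF C2]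
  have crit: "gradient f xs = 0" by (rule gradient_zero_at_minimum[OF D(1) min])
  have sym: "(?H *v x) \<bullet> y = x \<bullet> (?H *v y)" for x y
    by (rule second_derivative_symmetric[OF D(1) D(2)])
  have growth: "(norm (x - xs))\<^sup>2 / (4 * C) \<le> f x - f xs" for x
    by (rule PL_quadratic_growth[OF D(1) min uniq C PL])
  show ex: "\<exists>v. v \<noteq> 0 \<and> ?H *v v = lambda_min ?H *\<^sub>R v"
    by (rule lambda_min_symmetric(1)[OF sym])
  then obtain v where v: "v \<noteq> 0" "?H *v v = lambda_min ?H *\<^sub>R v" by blast
  \<comment> \<open>Along a short multiple \<open>w\<close> of the eigenvector, growth gives |w|^2 /
    (4 C) while the Taylor error is at most |w|^2 / (8 C); the remaining half must come from the
    quadratic form.\<close>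
  have pos: "lambda_min ?H > 0"
  proof -
    obtain d where d: "d > 0" "\<And>w. norm w < d \<Longrightarrow> \<bar>f (xs + w) - f xs - w \<bullet> (?H *v w) / 2\<bar> \<le> 1 / (8 * C) * (norm w)\<^sup>2"
      using second_order_taylor[OF D(1) D(2) crit, of "1 / (8 * C)"] C by auto
    define w where "w = (d / 2 / norm v) *\<^sub>R v"
    have w: "norm w = d / 2" using v d(1) by (simp add: w_def)
    have Hw: "?H *v w = lambda_min ?H *\<^sub>R w" by (simp add: w_def matrix_vector_mult_scaleR v(2))
    have "(norm w)\<^sup>2 / (4 * C) \<le> w \<bullet> (?H *v w) / 2 + 1 / (8 * C) * (norm w)\<^sup>2"
    proof -
      have "norm w < d" using w d(1) by simp
      note d(2)[OF this]
      moreover have "(norm w)\<^sup>2 / (4 * C) \<le> f (xs + w) - f xs" using growth[of "xs + w"] by simp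
      ultimately show ?thesis by linarith
    qed
    moreover have "(norm w)\<^sup>2 / (8 * C) \<le> lambda_min ?H * (norm w)\<^sup>2 / 2"
      if "(norm w)\<^sup>2 / (4 * C) \<le> w \<bullet> (?H *v w) / 2 + 1 / (8 * C) * (norm w)\<^sup>2"
    proof -
      have "(norm w)\<^sup>2 / (4 * C) = 1 / (8 * C) * (norm w)\<^sup>2 + (norm w)\<^sup>2 / (8 * C)"
        using C by (simp add: field_simps)
      moreover have "w \<bullet> (?H *v w) = lambda_min ?H * (norm w)\<^sup>2" by (simp add: Hw power2_norm_eq_inner)
      ultimately show ?thesis using that by linarith
    qed
    moreover have "(norm w)\<^sup>2 / (8 * C) > 0"
    proof -
      have "w \<noteq> 0" using w d(1) by auto
      then show ?thesis using C by simp
    qed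
    ultimately have "lambda_min ?H * (norm w)\<^sup>2 > 0" by linarith
    then show ?thesis by (simp add: zero_less_mult_iff)
  qed
  show "PL_min (\<lambda>x v. hessian f x *v v) xs (lambda_min ?H) f (gradient f) C L"
  proof unfold_locales
    show "(\<Sum>b\<in>Basis. (hessian f x *v b) \<bullet> b) \<le> L * (1 + (norm (gradient f x))\<^sup>2)" for x
      using lap[of x] by (simp add: D(4))
  qed (fact matrix_vector_right_distrib matrix_vector_mult_scaleR sym lambda_min_symmetric(2)[OF sym]
      pos D crit C PL growth L)+
qed

text \<open>Positivity of the eigenvalue belongs to the conclusion so that the reciprocal is a true
  one and not the convention for division by zero.\<close>

theorem theorem2:
  fixes f :: "real ^ 'n \<Rightarrow> real" and xs :: "real ^ 'n"
  assumes "C_k 2 f"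
    and "\<forall>y. f xs \<le> f y"
    and "\<forall>x. (\<forall>y. f x \<le> f y) \<longrightarrow> x = xs"
    and "PL_const f < \<infinity>"
    and "\<exists>L>0. \<forall>x. laplacian f x \<le> L * (1 + (norm (gradient f x))\<^sup>2)"
  shows "(\<exists>l. ((\<lambda>t. poincare_const (gibbs f t) / ereal t) \<longlongrightarrow> l) (at_right 0)) \<and>
    0 < lambda_min (hessian f xs) \<and>
    C_bP f = ereal (1 / lambda_min (hessian f xs))"
proof -
  let ?lam = "lambda_min (hessian f xs)"
  have "(INF y. f y) = f xs"
    using assms(2) by (intro cInf_eq_minimum) auto
  moreover obtain C where "C > 0" "\<And>x. f x - (INF y. f y) \<le> C / 2 * (norm (gradient f x))\<^sup>2"
    using assms(4) unfolding PL_const_def Inf_less_iff by auto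
  ultimately have C: "C > 0" "\<And>x. f x - f xs \<le> C / 2 * (norm (gradient f x))\<^sup>2" by auto
  obtain L where L: "L > 0" "\<And>x. laplacian f x \<le> L * (1 + (norm (gradient f x))\<^sup>2)"
    using assms(5) by blast
  have min: "PL_min (\<lambda>x v. hessian f x *v v) xs ?lam f (gradient f) C L"
    and "\<exists>v. v \<noteq> 0 \<and> hessian f xs *v v = ?lam *\<^sub>R v"
    using PL_min_gradient[OF assms(1) _ _ C L] assms(2,3) by blast+
  then obtain v where v: "v \<noteq> 0" "hessian f xs *v v = ?lam *\<^sub>R v" by blast
  interpret PL_min "\<lambda>x v. hessian f x *v v" xs ?lam f "gradient f" C L by (rule min)
  \<comment> \<open>The two eventual bounds are stated for real constants, while convergence is
    tested against extended reals; density inserts a real number in between.\<close>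
  have lim: "((\<lambda>t. poincare_const (gibbs f t) / ereal t) \<longlongrightarrow> ereal (1 / ?lam)) (at_right 0)"
  proof (rule order_tendstoI)
    fix a assume "a < ereal (1 / ?lam)"
    then obtain B where B: "a < ereal B" "ereal B < ereal (1 / ?lam)" using ereal_dense2 by blast
    then have "B < 1 / ?lam" by simp
    from poincare_const_lower[OF min v this]
    show "\<forall>\<^sub>F t in at_right 0. a < poincare_const (gibbs f t) / ereal t"
      by eventually_elim (use B(1) in \<open>rule less_le_trans\<close>)
  next
    fix a assume "ereal (1 / ?lam) < a"
    then obtain B where B: "ereal (1 / ?lam) < ereal B" "ereal B < a" using ereal_dense2 by blast
    then have "B - 1 / ?lam > 0" by simp
    from poincare_const_upper[OF min this]
    show "\<forall>\<^sub>F t in at_right 0. poincare_const (gibbs f t) / ereal t < a"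
    proof eventually_elim
      case (elim t)
      then show ?case using B(2) by (intro le_less_trans[OF elim]) simp
    qed
  qed
  then have "C_bP f = ereal (1 / ?lam)"
    unfolding C_bP_def by (intro tendsto_Lim) auto
  then show ?thesis using lim lam_pos by blast
qed

end
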